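(* Let $n,d\ge1$ be integers, let $p\in(1,n)$, $p^*=np/(n-p)$, and let $\Omega\subset\mathbb R^n$ be a bounded domain with $C^1$ boundary that is star-shaped with respect to $x_0\in\Omega$. Let $A=(a_{ij}):\overline\Omega\to M(n;\mathbb R)$ be continuous on $\overline\Omega$ and of class $C^1$ on $\overline\Omega\setminus\{x_0\}$, with $A(x)=A(x)^\top$ for all $x\in\overline\Omega$, and such that for some $\tau>0$, $\tau|\xi|^2\le\langle A(x)\xi,\xi\rangle$ for all $(x,\xi)\in\overline\Omega\times\mathbb R^n$. Suppose that $b_{ij}(x)=\langle x-x_0,\nabla a_{ij}(x)\rangle$ extends continuously to $x_0$ for all $i,j\in\{1,\dots,n\}$. Let $F\in C^1(\mathbb R^d)$ be homogeneous of degree $p$, and let $G\in C^1(\mathbb R^d)$ be homogeneous of degree $p^*$ with $G(s)>0$ for all $s\ne0$. If there are $C_0>0$ and $\gamma\in(0,p]$ for which $$(x-x_0)\cdot\nabla_x\big(\langle A(x)\xi,\xi\rangle^{p/2}\big)\ge\gamma C_0|x-x_0|^\gamma|\xi|^p\qquad\text{for all }(x,\xi)\in\Omega\times\mathbb R^n,$$ then there is a constant $\lambda_*>0$ such that if $M_F<\lambda_*$ then the problem $$\begin{cases}-L_{A,p}\mathbf u=\frac1p\nabla F(\mathbf u)+\frac1{p^*}\nabla G(\mathbf u)&\text{in }\Omega\\ \mathbf u=0&\text{on }\partial\Omega\end{cases}$$ has no nontrivial (weak) solution $\mathbf u\in C^1(\overline\Omega;\mathbb R^d)$.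
   Context: $M(n;\mathbb R)$ is the space of real $n\times n$ matrices; $\langle\cdot,\cdot\rangle$ is the Euclidean inner product. A function $H:\mathbb R^d\to\mathbb R$ is homogeneous of degree $q$ if $H(\varrho s)=\varrho^qH(s)$ for all $\varrho>0$, $s\in\mathbb R^d$. With $B(x)=(b_{ij}(x))$, the left-hand side of the lower bound equals $\frac p2\langle A(x)\xi,\xi\rangle^{(p-2)/2}\langle B(x)\xi,\xi\rangle$ for $\xi\ne0$ and $x\ne x_0$; at $x=x_0$ it is read through the continuous extension of $B$. For scalar $u$, $L_{A,p}u=\mathrm{div}\big(\langle A(x)\nabla u,\nabla u\rangle^{\frac{p-2}2}A(x)\nabla u\big)$ (the vector field being $0$ where $\nabla u=0$), and for $\mathbf u=(u_1,\dots,u_d)$, $L_{A,p}\mathbf u=(L_{A,p}u_1,\dots,L_{A,p}u_d)$. A weak solution of the problem is $\mathbf u\in W_0^{1,p}(\Omega;\mathbb R^d)$ such that for each $j\in\{1,\dots,d\}$ and all $\varphi\in W_0^{1,p}(\Omega)$, $$\int_\Omega\langle A\nabla u_j,\nabla u_j\rangle^{\frac{p-2}2}\langle A\nabla u_j,\nabla\varphi\rangle\,dx=\int_\Omega\Big(\tfrac1p\partial_jF(\mathbf u)+\tfrac1{p^*}\partial_jG(\mathbf u)\Big)\varphi\,dx.$$ $M_F=\max\{F(s):s\in\mathbb R^d,\ |s_1|^p+\dots+|s_d|^p=1\}$. *)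

theory Defs
  imports "HOL-Analysis.Analysis"
begin

definition grad :: "('a::euclidean_space \<Rightarrow> real) \<Rightarrow> 'a \<Rightarrow> 'a" where
  "grad f x = (THE D. GDERIV f x :> D)"

lemma grad_eq: "GDERIV f x :> D \<Longrightarrow> grad f x = D"
  unfolding grad_def gderiv_def
  by (rule the_equality, assumption) (metis has_derivative_unique vector_eq_ldot)

primrec Ck :: "nat \<Rightarrow> ('a::euclidean_space \<Rightarrow> real) \<Rightarrow> bool" where
  "Ck 0 f \<longleftrightarrow> continuous_on UNIV f"
| "Ck (Suc k) f \<longleftrightarrow> (\<forall>x. f differentiable (at x)) \<and> (\<forall>b\<in>Basis. Ck k (\<lambda>x. grad f x \<bullet> b))"

text \<open>\<open>C1_upto U S f\<close>: \<open>f\<close> is of class \<open>C\<^sup>1\<close> on the set \<open>S\<close>, where \<open>U\<close> is open and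
  \<open>U \<subseteq> S \<subseteq> closure U\<close>. As usual for sets containing boundary points, this means that
  \<open>f\<close> is continuous on \<open>S\<close>, differentiable in \<open>U\<close>, and its gradient
  extends continuously from \<open>U\<close> to \<open>S\<close>.\<close>

definition C1_upto :: "'a::euclidean_space set \<Rightarrow> 'a set \<Rightarrow> ('a \<Rightarrow> real) \<Rightarrow> bool" where
  "C1_upto U S f \<longleftrightarrow>
     continuous_on S f \<and> (\<forall>x\<in>U. f differentiable (at x)) \<and>
     (\<exists>g. continuous_on S g \<and> (\<forall>x\<in>U. g x = grad f x))"

text \<open>Near each boundary point, \<open>\<Omega>\<close> is the strict epigraph, in some unit direction \<open>e\<close>, of a
  \<open>C\<^sup>1\<close> function on the hyperplane orthogonal to \<open>e\<close>. That function is represented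
  by a \<open>C\<^sup>1\<close> function \<open>h\<close> on the whole space, evaluated only at the orthogonal projection of
  \<open>x\<close> to the hyperplane.\<close>

definition C1_boundary :: "'a::euclidean_space set \<Rightarrow> bool" where
  "C1_boundary \<Omega> \<longleftrightarrow>
     (\<forall>z\<in>frontier \<Omega>. \<exists>e h r. norm e = 1 \<and> r > 0 \<and> Ck 1 h \<and>
        \<Omega> \<inter> ball z r = {x \<in> ball z r. h (x - (x \<bullet> e) *\<^sub>R e) < x \<bullet> e})"

definition star_shaped_wrt :: "'a::euclidean_space \<Rightarrow> 'a set \<Rightarrow> bool" where
  "star_shaped_wrt x\<^sub>0 \<Omega> \<longleftrightarrow> (\<forall>x\<in>\<Omega>. closed_segment x\<^sub>0 x \<subseteq> \<Omega>)"

definition homogeneous :: "real \<Rightarrow> ('a::real_vector \<Rightarrow> real) \<Rightarrow> bool" where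
  "homogeneous q H \<longleftrightarrow> (\<forall>\<rho>>0. \<forall>s. H (\<rho> *\<^sub>R s) = \<rho> powr q * H s)"

text \<open>The maximum over the \<open>p\<close>-unit sphere; it exists whenever \<open>F\<close> is continuous.\<close>

definition M_max :: "real \<Rightarrow> (real^'d \<Rightarrow> real) \<Rightarrow> real" where
  "M_max p F = (GREATEST m. \<exists>s. (\<Sum>j\<in>UNIV. \<bar>s $ j\<bar> powr p) = 1 \<and> m = F s)"

definition sobolev_exponent :: "real \<Rightarrow> real \<Rightarrow> real" where
  "sobolev_exponent n p = n * p / (n - p)"


definition test_function :: "'a::euclidean_space set \<Rightarrow> ('a \<Rightarrow> real) \<Rightarrow> bool" where
  "test_function \<Omega> \<phi> \<longleftrightarrow>
     (\<forall>k. Ck k \<phi>) \<and> compact (closure {x. \<phi> x \<noteq> 0}) \<and> closure {x. \<phi> x \<noteq> 0} \<subseteq> \<Omega>"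

definition in_Lp :: "'a::euclidean_space set \<Rightarrow> real \<Rightarrow> ('a \<Rightarrow> 'b::euclidean_space) \<Rightarrow> bool" where
  "in_Lp \<Omega> p f \<longleftrightarrow>
     f \<in> borel_measurable (lebesgue_on \<Omega>) \<and> integrable (lebesgue_on \<Omega>) (\<lambda>x. norm (f x) powr p)"

definition has_weak_gradient ::
    "'a::euclidean_space set \<Rightarrow> ('a \<Rightarrow> real) \<Rightarrow> ('a \<Rightarrow> 'a) \<Rightarrow> bool" where
  "has_weak_gradient \<Omega> u v \<longleftrightarrow>
     (\<forall>K. compact K \<and> K \<subseteq> \<Omega> \<longrightarrow> u absolutely_integrable_on K \<and> v absolutely_integrable_on K) \<and>
     (\<forall>\<phi>. test_function \<Omega> \<phi> \<longrightarrow> (\<forall>b\<in>Basis.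
        (LINT x|lebesgue_on \<Omega>. u x * (grad \<phi> x \<bullet> b)) = - (LINT x|lebesgue_on \<Omega>. (v x \<bullet> b) * \<phi> x)))"

text \<open>\<open>W\<^sub>0\<^sup>1\<^sup>,\<^sup>p(\<Omega>)\<close>: the closure of the test functions in \<open>W\<^sup>1\<^sup>,\<^sup>p(\<Omega>)\<close>.\<close>

definition in_W0 :: "'a::euclidean_space set \<Rightarrow> real \<Rightarrow> ('a \<Rightarrow> real) \<Rightarrow> bool" where
  "in_W0 \<Omega> p u \<longleftrightarrow>
     in_Lp \<Omega> p u \<and>
     (\<exists>v. has_weak_gradient \<Omega> u v \<and> in_Lp \<Omega> p v \<and>
        (\<exists>\<phi>. (\<forall>k::nat. test_function \<Omega> (\<phi> k)) \<and>
             (\<lambda>k. LINT x|lebesgue_on \<Omega>. \<bar>\<phi> k x - u x\<bar> powr p) \<longlonglongrightarrow> 0 \<and>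
             (\<lambda>k. LINT x|lebesgue_on \<Omega>. norm (grad (\<phi> k) x - v x) powr p) \<longlonglongrightarrow> 0))"

text \<open>Weak gradients are unique only almost everywhere, so the integral identity is stated for
  every representative \<open>U\<close> of the weak gradient of \<open>u\<^sub>j\<close> and \<open>V\<close> of that of \<open>\<phi>\<close>; such
  representatives exist by membership in \<open>W\<^sub>0\<^sup>1\<^sup>,\<^sup>p\<close>. Where \<open>U x = 0\<close> the left integrand is \<open>0\<close>,
  also for \<open>p < 2\<close>, as \<open>0 powr a = 0\<close>.\<close>

definition weak_solution ::
    "(real^'n) set \<Rightarrow> (real^'n \<Rightarrow> real^'n^'n) \<Rightarrow> real \<Rightarrow> (real^'d \<Rightarrow> real) \<Rightarrow> (real^'d \<Rightarrow> real) \<Rightarrow>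
     (real^'n \<Rightarrow> real^'d) \<Rightarrow> bool" where
  "weak_solution \<Omega> A p F G u \<longleftrightarrow>
     (\<forall>j. in_W0 \<Omega> p (\<lambda>x. u x $ j)) \<and>
     (\<forall>j \<phi> U V. in_W0 \<Omega> p \<phi> \<and> has_weak_gradient \<Omega> (\<lambda>x. u x $ j) U \<and> has_weak_gradient \<Omega> \<phi> V \<longrightarrow>
        (LINT x|lebesgue_on \<Omega>.
            ((A x *v U x) \<bullet> U x) powr ((p - 2) / 2) * ((A x *v U x) \<bullet> V x))
        = (LINT x|lebesgue_on \<Omega>.
            (1 / p * grad F (u x) $ j
             + 1 / sobolev_exponent (real CARD('n)) p * grad G (u x) $ j) * \<phi> x))"


definition b_entry :: "(real^'n \<Rightarrow> real^'n^'n) \<Rightarrow> real^'n \<Rightarrow> 'n \<Rightarrow> 'n \<Rightarrow> real^'n \<Rightarrow> real" where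
  "b_entry A x\<^sub>0 i j x = (x - x\<^sub>0) \<bullet> grad (\<lambda>y. A y $ i $ j) x"

text \<open>\<open>(x - x\<^sub>0) \<cdot> \<nabla>\<^sub>x (\<langle>A(x)\<xi>,\<xi>\<rangle>\<^sup>p\<^sup>/\<^sup>2)\<close>. As \<open>A\<close> need not be differentiable at \<open>x\<^sub>0\<close>, the value there
  is \<open>(p/2) \<langle>A(x\<^sub>0)\<xi>,\<xi>\<rangle>\<^sup>(\<^sup>p\<^sup>-\<^sup>2\<^sup>)\<^sup>/\<^sup>2 \<langle>B(x\<^sub>0)\<xi>,\<xi>\<rangle>\<close> with \<open>B(x\<^sub>0)\<close> the limit of \<open>B\<close>.\<close>

definition radial_derivative ::
    "(real^'n \<Rightarrow> real^'n^'n) \<Rightarrow> real \<Rightarrow> real^'n \<Rightarrow> real^'n \<Rightarrow> real^'n \<Rightarrow> real" where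
  "radial_derivative A p x\<^sub>0 x \<xi> =
     (if x = x\<^sub>0
      then p / 2 * ((A x\<^sub>0 *v \<xi>) \<bullet> \<xi>) powr ((p - 2) / 2)
             * (((\<chi> i j. Lim (at x\<^sub>0) (b_entry A x\<^sub>0 i j)) *v \<xi>) \<bullet> \<xi>)
      else (x - x\<^sub>0) \<bullet> grad (\<lambda>y. ((A y *v \<xi>) \<bullet> \<xi>) powr (p / 2)) x)"

end

theory Submission
  imports Defs "HOL-Analysis.Analysis"
begin

text \<open>The idea is a Pohozaev inequality obtained from convexity and dilations only, without integrating
  by parts over the boundary and without second derivatives of the solution. For \<open>t > 1\<close> let
  \<open>v\<^sub>t(x) = u(x\<^sub>0 + t (x - x\<^sub>0))\<close>, where \<open>u\<close> is extended by zero. As \<open>\<Omega>\<close> is star-shaped, \<open>v\<^sub>t\<close> is again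
  in \<open>W\<^sub>0\<^sup>1\<^sup>,\<^sup>p(\<Omega>)\<close>. Convexity of \<open>\<xi> \<mapsto> \<langle>A(x)\<xi>,\<xi>\<rangle>\<^sup>p\<^sup>/\<^sup>2\<close> and the weak equation tested with \<open>v\<^sub>t - u\<close>
  bound \<open>\<integral> \<langle>A\<nabla>v\<^sub>t,\<nabla>v\<^sub>t\<rangle>\<^sup>p\<^sup>/\<^sup>2 - \<integral> \<langle>A\<nabla>u,\<nabla>u\<rangle>\<^sup>p\<^sup>/\<^sup>2\<close> below by \<open>p \<integral> \<nabla>\<Phi>(u) \<cdot> (v\<^sub>t - u)\<close>, where
  \<open>\<Phi> = F/p + G/p\<^sup>*\<close>. A change of variables expresses the left side through \<open>A\<close> at
  \<open>x\<^sub>0 + (x - x\<^sub>0)/t\<close>, and the right side is \<open>p (t\<^sup>-\<^sup>n - 1) \<integral> \<Phi>(u) + o(t - 1)\<close>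
  because \<open>v\<^sub>t - u\<close> is of order \<open>t - 1\<close> in \<open>L\<^sup>p\<close>. Dividing by \<open>t - 1\<close> and letting \<open>t \<rightarrow> 1\<close> gives, with
  Euler's identity, \<open>C\<^sub>0 \<gamma> \<integral> |x - x\<^sub>0|\<^sup>\<gamma> |\<nabla>u|\<^sup>p \<le> p \<integral> F(u)\<close>. The difference estimate for \<open>t = 2\<close> is a
  weighted Poincare inequality, which makes this impossible for \<open>u \<noteq> 0\<close> if \<open>M\<^sub>F\<close> is small.\<close>

section \<open>Dilations and integrals\<close>

text \<open>Only t > 1 is used: such dilations shrink supports towards \<open>x\<^sub>0\<close>, so
  \<open>v_t\<close> is an admissible test function, whereas t < 1 would push it across the
  boundary. The outcome is one-sided, but with the useful sign. Let K be the integral of the p/2-th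
  power of the quadratic form at the gradients, W the weighted gradient integral. The limit t -> 1
  gives (n - p) K + C_0 \<gamma> W \<le> p n \<integral>\<Phi>(u). Testing the equation with
  \<open>u\<close> gives K = \<integral>F(u) + \<integral>G(u), and on the right G carries the
  factor p n / p^* = n - p, the same as on the left: the critical term cancels, only F survives, and
  the threshold depends neither on G nor on the size of \<open>u\<close>. In the weighted Poincare
  inequality the dilate by 2 keeps 2^(-n) of the p-th power integral and the triangle inequality
  costs 2^p; as p < n, the factor 2^(p - n) is below 1 and the term is absorbed. Its weight |x -
  x_0|^p becomes R^(p - \<gamma>) |x - x_0|^\<gamma> because \<gamma> \<le> p. Weak gradients are
  known only as limits of gradients of test functions, so difference estimates are proved for test
  functions along rays from \<open>x\<^sub>0\<close> and then passed to the limit.\<close>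

definition dil :: "'a::real_vector \<Rightarrow> real \<Rightarrow> 'a \<Rightarrow> 'a" where
  "dil a t x = a + t *\<^sub>R (x - a)"

lemma dil_1 [simp]: "dil a 1 x = x"
  by (simp add: dil_def)

lemma dil_dil_inverse [simp]: "t \<noteq> 0 \<Longrightarrow> dil a (1 / t) (dil a t x) = x"
  "t \<noteq> 0 \<Longrightarrow> dil a t (dil a (1 / t) x) = x"
  by (simp_all add: dil_def)

lemma continuous_on_dil [continuous_intros]: 
  fixes f :: "'b::topological_space \<Rightarrow> 'a::real_normed_vector"
  shows "continuous_on S f \<Longrightarrow> continuous_on S g \<Longrightarrow> continuous_on S (\<lambda>x. dil a (g x) (f x))"
  unfolding dil_def by (intro continuous_intros)

text \<open>This coordinate form, with one scaling factor per basis vector, is the shape of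
  \<open>lebesgue_affine_measurable\<close> and \<open>lebesgue_affine_euclidean\<close>; with all
  factors equal to \<open>t\<close> the Jacobian is \<open>t ^ DIM('a)\<close>.\<close>

lemma dil_affine_euclidean:
  fixes a :: "'a::euclidean_space"
  shows "dil a t = (\<lambda>x. (a - t *\<^sub>R a) + (\<Sum>j\<in>Basis. (t * (x \<bullet> j)) *\<^sub>R j))"
proof
  fix x :: 'a
  have "(\<Sum>j\<in>Basis. (t * (x \<bullet> j)) *\<^sub>R j) = t *\<^sub>R (\<Sum>j\<in>Basis. (x \<bullet> j) *\<^sub>R j)"
    by (simp add: scaleR_sum_right)
  then show "dil a t x = (a - t *\<^sub>R a) + (\<Sum>j\<in>Basis. (t * (x \<bullet> j)) *\<^sub>R j)"
    by (simp add: dil_def euclidean_representation algebra_simps)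
qed

lemma measurable_dil_lebesgue:
  fixes a :: "'a::euclidean_space"
  assumes "t \<noteq> 0"
  shows "dil a t \<in> lebesgue \<rightarrow>\<^sub>M lebesgue"
  unfolding dil_affine_euclidean using assms
  by (intro lebesgue_affine_measurable) auto

lemma borel_measurable_dil:
  fixes a :: "'a::euclidean_space"
  assumes "f \<in> borel_measurable lebesgue" "t \<noteq> 0"
  shows "(\<lambda>x. f (dil a t x)) \<in> borel_measurable lebesgue"
  using measurable_compose[OF measurable_dil_lebesgue[OF assms(2)] assms(1)] .

lemma lebesgue_eq_density_dil:
  fixes a :: "'a::euclidean_space"
  assumes "t > 0"
  shows "(lebesgue :: 'a measure) = density (distr lebesgue lebesgue (dil a t)) (\<lambda>_. ennreal (t ^ DIM('a)))"
  using lebesgue_affine_euclidean[of "\<lambda>_. t" "a - t *\<^sub>R a"] assms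
  by (simp add: dil_affine_euclidean)

text \<open>Lebesgue measure is its own push-forward under the dilation, up to the constant density
  \<open>t ^ DIM('a)\<close>. The completed measure is used throughout because weak gradients are
  only Lebesgue measurable.\<close>

lemma lebesgue_integral_dil:
  fixes a :: "'a::euclidean_space" and f :: "'a \<Rightarrow> 'b::{banach, second_countable_topology}"
  assumes f: "integrable lebesgue f" and t: "t > 0"
  shows "integrable lebesgue (\<lambda>x. f (dil a t x))"
    and "(LINT x|lebesgue. f (dil a t x)) = (1 / t ^ DIM('a)) *\<^sub>R (LINT x|lebesgue. f x)"
proof -
  have m: "dil a t \<in> lebesgue \<rightarrow>\<^sub>M lebesgue" using measurable_dil_lebesgue[of t a] t by simp
  have fm: "f \<in> borel_measurable lebesgue" using f by auto
  let ?D = "distr lebesgue lebesgue (dil a t)"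
  have fD: "f \<in> borel_measurable ?D" using fm by simp
  have "integrable (density ?D (\<lambda>_. ennreal (t ^ DIM('a)))) f"
    using f lebesgue_eq_density_dil[OF t, of a] by simp
  then have "integrable ?D (\<lambda>x. (t ^ DIM('a)) *\<^sub>R f x)"
    using t by (subst (asm) integrable_density) (auto simp: fm)
  then have *: "integrable lebesgue (\<lambda>x. (t ^ DIM('a)) *\<^sub>R f (dil a t x))"
    by (subst (asm) integrable_distr_eq[OF m]) (auto intro!: borel_measurable_scaleR fm)
  from integrable_scaleR_right[OF *, of "1 / t ^ DIM('a)"]
  show int: "integrable lebesgue (\<lambda>x. f (dil a t x))" using t by simp
  have "(LINT x|lebesgue. f x) = (LINT x|density ?D (\<lambda>_. ennreal (t ^ DIM('a))). f x)"
    using lebesgue_eq_density_dil[OF t, of a] by simp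
  also have "\<dots> = (LINT x|?D. (t ^ DIM('a)) *\<^sub>R f x)"
    using t by (subst integral_density) (auto simp: fm)
  also have "\<dots> = (LINT x|lebesgue. (t ^ DIM('a)) *\<^sub>R f (dil a t x))"
    by (subst integral_distr[OF m]) (auto intro!: borel_measurable_scaleR fm)
  also have "\<dots> = (t ^ DIM('a)) *\<^sub>R (LINT x|lebesgue. f (dil a t x))"
    by simp
  finally show "(LINT x|lebesgue. f (dil a t x)) = (1 / t ^ DIM('a)) *\<^sub>R (LINT x|lebesgue. f x)"
    using t by simp
qed

text \<open>Dilations move points across the boundary of the domain. Integrals over
  \<open>lebesgue_on S\<close> are therefore transported to the whole space, where the change of
  variables has no side conditions.\<close>

definition zero_ext :: "'a set \<Rightarrow> ('a \<Rightarrow> 'b::real_vector) \<Rightarrow> 'a \<Rightarrow> 'b" where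
  "zero_ext S f x = indicator S x *\<^sub>R f x"

lemma zero_ext_in [simp]: "x \<in> S \<Longrightarrow> zero_ext S f x = f x" and zero_ext_out [simp]: "x \<notin> S \<Longrightarrow> zero_ext S f x = 0"
  by (simp_all add: zero_ext_def)

lemma
  fixes f :: "'a::euclidean_space \<Rightarrow> 'b::{banach, second_countable_topology}"
  assumes "S \<in> sets lebesgue"
  shows integrable_ext: "integrable (lebesgue_on S) f \<longleftrightarrow> integrable lebesgue (zero_ext S f)"
    and integral_ext: "integral\<^sup>L (lebesgue_on S) f = integral\<^sup>L lebesgue (zero_ext S f)"
    and measurable_ext: "f \<in> borel_measurable (lebesgue_on S) \<longleftrightarrow> zero_ext S f \<in> borel_measurable lebesgue"
  using assms by (simp_all add: integrable_restrict_space integral_restrict_space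
      borel_measurable_restrict_space_iff zero_ext_def[abs_def])

section \<open>Lebesgue classes under sums, restriction and dilation\<close>

lemma in_Lp_UNIV:
  "in_Lp UNIV p f \<longleftrightarrow> f \<in> borel_measurable lebesgue \<and> integrable lebesgue (\<lambda>x. norm (f x) powr p)"
  by (simp add: in_Lp_def lebesgue_on_UNIV_eq)

text \<open>The sum is at most twice the larger norm. This crude constant 2^p, applied repeatedly,
  is the origin of the factors 4^p and 8^p in the difference and Poincare estimates.\<close>

lemma powr_norm_add_le:
  fixes a b :: "'a::real_normed_vector"
  assumes "p > 0"
  shows "norm (a + b) powr p \<le> 2 powr p * (norm a powr p + norm b powr p)"
proof -
  have "norm (a + b) \<le> 2 * max (norm a) (norm b)"
    using norm_triangle_ineq[of a b] by linarith
  then have "norm (a + b) powr p \<le> (2 * max (norm a) (norm b)) powr p"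
    using assms by (intro powr_mono2) auto
  also have "\<dots> = 2 powr p * max (norm a) (norm b) powr p"
    by (simp add: powr_mult)
  also have "\<dots> \<le> 2 powr p * (norm a powr p + norm b powr p)"
    by (intro mult_left_mono) (auto simp: max_def)
  finally show ?thesis .
qed

lemma in_Lp_ext:
  fixes f :: "'a::euclidean_space \<Rightarrow> 'b::euclidean_space"
  assumes "S \<in> sets lebesgue"
  shows "in_Lp S p f \<longleftrightarrow> in_Lp UNIV p (zero_ext S f)"
proof -
  have "(\<lambda>x. norm (zero_ext S f x) powr p) = zero_ext S (\<lambda>x. norm (f x) powr p)"
    by (auto simp: zero_ext_def fun_eq_iff indicator_def)
  then show ?thesis
    using assms unfolding in_Lp_UNIV by (simp add: in_Lp_def measurable_ext integrable_ext)
qed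

lemma in_Lp_bound:
  fixes f :: "'a::euclidean_space \<Rightarrow> 'b::euclidean_space"
  assumes "in_Lp S p g" "in_Lp S p h" "f \<in> borel_measurable (lebesgue_on S)"
    and "\<And>x. x \<in> S \<Longrightarrow> norm (f x) powr p \<le> C * (norm (g x) powr p + norm (h x) powr p)"
  shows "in_Lp S p f"
proof -
  have "integrable (lebesgue_on S) (\<lambda>x. C * (norm (g x) powr p + norm (h x) powr p))"
    using assms(1,2) unfolding in_Lp_def by auto
  then have "integrable (lebesgue_on S) (\<lambda>x. norm (f x) powr p)"
  proof (rule Bochner_Integration.integrable_bound)
    show "(\<lambda>x. norm (f x) powr p) \<in> borel_measurable (lebesgue_on S)"
      using assms(3) by measurable
    show "AE x in lebesgue_on S. norm (norm (f x) powr p) \<le> norm (C * (norm (g x) powr p + norm (h x) powr p))"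
    proof (rule AE_I2)
      fix x assume "x \<in> space (lebesgue_on S)"
      then have "norm (f x) powr p \<le> C * (norm (g x) powr p + norm (h x) powr p)"
        by (intro assms(4)) simp
      also have "\<dots> \<le> \<bar>C * (norm (g x) powr p + norm (h x) powr p)\<bar>" by (rule abs_ge_self)
      finally show "norm (norm (f x) powr p) \<le> norm (C * (norm (g x) powr p + norm (h x) powr p))" by simp
    qed
  qed
  then show ?thesis using assms unfolding in_Lp_def by auto
qed

lemma in_Lp_add:
  fixes f g :: "'a::euclidean_space \<Rightarrow> 'b::euclidean_space"
  assumes "in_Lp S p f" "in_Lp S p g" "p > 0"
  shows "in_Lp S p (\<lambda>x. f x + g x)"
  by (rule in_Lp_bound[OF assms(1,2)])
     (use assms powr_norm_add_le in \<open>auto simp: in_Lp_def\<close>)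

lemma in_Lp_cmult:
  fixes f :: "'a::euclidean_space \<Rightarrow> 'b::euclidean_space"
  assumes "in_Lp S p f" 
  shows "in_Lp S p (\<lambda>x. c *\<^sub>R f x)"
  using assms by (auto simp: in_Lp_def powr_mult)

lemma in_Lp_diff:
  fixes f g :: "'a::euclidean_space \<Rightarrow> 'b::euclidean_space"
  assumes "in_Lp S p f" "in_Lp S p g" "p > 0"
  shows "in_Lp S p (\<lambda>x. f x - g x)"
  using in_Lp_add[OF assms(1) in_Lp_cmult[OF assms(2), of "-1"] assms(3)] by simp

lemma in_Lp_dil:
  fixes f :: "'a::euclidean_space \<Rightarrow> 'b::euclidean_space"
  assumes "in_Lp UNIV p f" "t > 0"
  shows "in_Lp UNIV p (\<lambda>x. f (dil a t x))"
    "(LINT x|lebesgue. norm (f (dil a t x)) powr p) = (LINT x|lebesgue. norm (f x) powr p) / t ^ DIM('a)"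
  using assms lebesgue_integral_dil[of "\<lambda>x. norm (f x) powr p" t a]
  by (auto simp: in_Lp_UNIV intro: borel_measurable_dil)

lemma in_Lp_continuous_compact_support:
  fixes f :: "'a::euclidean_space \<Rightarrow> 'b::euclidean_space"
  assumes f: "continuous_on UNIV f" and K: "compact K" "\<And>x. x \<notin> K \<Longrightarrow> f x = 0"
    and S: "S \<in> sets lebesgue" and "p > 0"
  shows "in_Lp S p f"
proof -
  have m: "f \<in> borel_measurable lebesgue"
    using f by (simp add: borel_measurable_continuous_onI measurable_completion)
  have "continuous_on K (\<lambda>x. norm (f x) powr p)"
    using f \<open>p > 0\<close> by (intro continuous_intros continuous_on_powr') (auto intro: continuous_on_subset)
  then have "integrable lborel (\<lambda>x. indicator K x *\<^sub>R norm (f x) powr p)"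
    by (rule borel_integrable_compact[OF K(1)])
  then have "integrable lebesgue (\<lambda>x. indicator K x *\<^sub>R norm (f x) powr p)"
    by (subst integrable_completion) auto
  also have "(\<lambda>x. indicator K x *\<^sub>R norm (f x) powr p) = (\<lambda>x. norm (f x) powr p)"
    using K(2) by (fastforce simp: fun_eq_iff indicator_def)
  finally have i: "integrable lebesgue (\<lambda>x. norm (f x) powr p)" .
  show ?thesis unfolding in_Lp_def
  proof
    show "f \<in> borel_measurable (lebesgue_on S)" using m by (simp add: measurable_restrict_space1)
    have "integrable lebesgue (\<lambda>x. indicator S x *\<^sub>R norm (f x) powr p)"
      using S i by (rule integrable_mult_indicator)
    then show "integrable (lebesgue_on S) (\<lambda>x. norm (f x) powr p)"
      using S by (simp add: integrable_ext zero_ext_def[abs_def])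
  qed
qed

section \<open>Test functions\<close>

text \<open>The definite description in \<open>grad\<close> needs a witness: the Riesz vector of the
  derivative, whose coordinates are the values \<open>D b\<close> on the basis.\<close>

lemma gderiv_grad:
  fixes f :: "'a::euclidean_space \<Rightarrow> real"
  assumes "f differentiable (at x)"
  shows "GDERIV f x :> grad f x"
proof -
  obtain D where D: "(f has_derivative D) (at x)" using assms by (auto simp: differentiable_def)
  have lin: "linear D" using D has_derivative_linear by blast
  have "D h = h \<bullet> (\<Sum>b\<in>Basis. D b *\<^sub>R b)" for h
  proof -
    have "D h = D (\<Sum>b\<in>Basis. (h \<bullet> b) *\<^sub>R b)" by (simp add: euclidean_representation)
    also have "\<dots> = (\<Sum>b\<in>Basis. (h \<bullet> b) * D b)"
      using lin by (simp add: linear_sum linear_cmul)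
    finally show ?thesis by (simp add: inner_sum_right mult.commute)
  qed
  then have "D = (\<lambda>h. h \<bullet> (\<Sum>b\<in>Basis. D b *\<^sub>R b))" by (rule HOL.ext)
  with D have "GDERIV f x :> (\<Sum>b\<in>Basis. D b *\<^sub>R b)"
    unfolding gderiv_def by metis
  then show ?thesis using grad_eq by metis
qed

lemma Ck_Suc_continuous: "Ck (Suc k) f \<Longrightarrow> continuous_on UNIV f"
  by (auto intro!: continuous_at_imp_continuous_on differentiable_imp_continuous_within)

lemma Ck_1_continuous_grad:
  assumes "Ck 1 f"
  shows "continuous_on UNIV (grad f)"
proof -
  have "continuous_on UNIV (\<lambda>x. \<Sum>b\<in>Basis. (grad f x \<bullet> b) *\<^sub>R b)"
    using assms by (intro continuous_on_sum continuous_on_scaleR continuous_on_const) simp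
  then show ?thesis by (simp add: euclidean_representation)
qed

lemma Ck_1_gderiv: "Ck 1 f \<Longrightarrow> GDERIV f x :> grad f x"
  by (rule gderiv_grad) simp

lemma gderiv_dil:
  assumes "GDERIV f (dil a t x) :> D"
  shows "GDERIV (\<lambda>x. c * f (dil a t x)) x :> (c * t) *\<^sub>R D"
proof -
  have d: "(dil a t has_derivative (\<lambda>h. t *\<^sub>R h)) (at x)"
    unfolding dil_def[abs_def] by (auto intro!: derivative_eq_intros)
  have "((\<lambda>x. f (dil a t x)) has_derivative (\<lambda>h. (t *\<^sub>R h) \<bullet> D)) (at x)"
    using has_derivative_compose[OF d assms[unfolded gderiv_def]] by simp
  then have "((\<lambda>x. c * f (dil a t x)) has_derivative (\<lambda>h. c * ((t *\<^sub>R h) \<bullet> D))) (at x)"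
    by (rule has_derivative_mult_right)
  moreover have "(\<lambda>h. c * ((t *\<^sub>R h) \<bullet> D)) = (\<lambda>h. h \<bullet> ((c * t) *\<^sub>R D))" by (simp add: fun_eq_iff)
  ultimately show ?thesis unfolding gderiv_def by (simp only:)
qed

text \<open>The factor \<open>c\<close> is carried and generalised because each differentiation
  turns it into \<open>c * t\<close>; without it the induction would not close.\<close>

lemma Ck_dil: "Ck k f \<Longrightarrow> Ck k (\<lambda>x. c * f (dil a t x))"
proof (induction k arbitrary: f c)
  case 0
  then have "continuous_on UNIV (\<lambda>x. f (dil a t x))"
    by (intro continuous_on_compose2[where g = f and f = "dil a t" and t = UNIV] continuous_on_dil
        continuous_on_const continuous_on_id) auto
  then show ?case by (simp add: continuous_on_mult_left)
next
  case (Suc k)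
  then have g: "GDERIV (\<lambda>x. c * f (dil a t x)) x :> (c * t) *\<^sub>R grad f (dil a t x)" for x
    by (intro gderiv_dil gderiv_grad) auto
  then have eq: "grad (\<lambda>x. c * f (dil a t x)) x = (c * t) *\<^sub>R grad f (dil a t x)" for x
    by (rule grad_eq)
  have "Ck k (\<lambda>x. (c * t) * (grad f (dil a t x) \<bullet> b))" if "b \<in> Basis" for b
    using Suc.IH[of "\<lambda>x. grad f x \<bullet> b" "c * t"] Suc.prems that by simp
  then show ?case
    using g by (auto simp: eq differentiable_def gderiv_def)
qed

lemma test_function_Ck_1: "test_function \<Omega> \<phi> \<Longrightarrow> Ck 1 \<phi>"
  unfolding test_function_def by blast

lemma zero_outside_closure_support:
  assumes "x \<notin> closure {x. f x \<noteq> 0}"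
  shows "f x = 0" "grad f x = 0"
proof -
  show "f x = 0" using assms closure_subset[of "{x. f x \<noteq> 0}"] by auto
  have "((\<lambda>_. 0) has_derivative (\<lambda>h. h \<bullet> 0)) (at x)" by simp
  then have "(f has_derivative (\<lambda>h. h \<bullet> 0)) (at x)"
    by (rule has_derivative_transform_within_open[OF _ open_Compl[OF closed_closure[of "{x. f x \<noteq> 0}"]]])
       (use assms closure_subset[of "{x. f x \<noteq> 0}"] in auto)
  then show "grad f x = 0" by (intro grad_eq) (simp add: gderiv_def)
qed

lemma test_function_outside:
  assumes "test_function \<Omega> \<phi>" "x \<notin> \<Omega>"
  shows "\<phi> x = 0" "grad \<phi> x = 0"
proof -
  have "x \<notin> closure {x. \<phi> x \<noteq> 0}" using assms by (auto simp: test_function_def)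
  then show "\<phi> x = 0" "grad \<phi> x = 0"
    by (rule zero_outside_closure_support)+
qed

lemma test_function_in_Lp:
  assumes "test_function \<Omega> \<phi>" "S \<in> sets lebesgue" "p > 0"
  shows "in_Lp S p \<phi>" "in_Lp S p (grad \<phi>)"
proof -
  let ?K = "closure {x. \<phi> x \<noteq> 0}"
  have K: "compact ?K" using assms by (simp add: test_function_def)
  note z = zero_outside_closure_support[of _ \<phi>]
  have C: "Ck 1 \<phi>" using assms test_function_Ck_1 by blast
  then have c: "continuous_on UNIV \<phi>" using Ck_Suc_continuous[of 0 \<phi>] by simp
  show "in_Lp S p \<phi>"
    using in_Lp_continuous_compact_support[OF c K z(1) assms(2,3)] .
  show "in_Lp S p (grad \<phi>)"
    using in_Lp_continuous_compact_support[OF Ck_1_continuous_grad[OF C] K z(2) assms(2,3)] .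
qed

lemma continuous_compact_support_bounded:
  fixes f :: "'a::euclidean_space \<Rightarrow> 'b::real_normed_vector"
  assumes f: "continuous_on UNIV f" and K: "compact K" "\<And>x. x \<notin> K \<Longrightarrow> f x = 0"
  obtains C where "C > 0" "\<And>x. norm (f x) \<le> C"
proof -
  have "bounded (f ` K)"
    by (intro compact_imp_bounded compact_continuous_image K(1) continuous_on_subset[OF f]) simp
  then obtain C where C: "C > 0" "\<And>y. y \<in> f ` K \<Longrightarrow> norm y \<le> C" by (auto simp: bounded_pos)
  have "norm (f x) \<le> C" for x using C K(2)[of x] by (cases "x \<in> K") auto
  then show ?thesis using that C(1) by blast
qed

lemma test_function_bounded:
  assumes "test_function \<Omega> \<phi>"
  obtains C where "C > 0" "\<And>x. \<bar>\<phi> x\<bar> \<le> C" "\<And>x. norm (grad \<phi> x) \<le> C"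
proof -
  let ?K = "closure {x. \<phi> x \<noteq> 0}"
  have K: "compact ?K" using assms by (simp add: test_function_def)
  note z = zero_outside_closure_support[of _ \<phi>]
  have C: "Ck 1 \<phi>" using assms test_function_Ck_1 by blast
  then have c: "continuous_on UNIV \<phi>" using Ck_Suc_continuous[of 0 \<phi>] by simp
  obtain C1 where C1: "C1 > 0" "\<And>x. norm (\<phi> x) \<le> C1"
    using continuous_compact_support_bounded[OF c K z(1)] by blast
  obtain C2 where C2: "C2 > 0" "\<And>x. norm (grad \<phi> x) \<le> C2"
    using continuous_compact_support_bounded[OF Ck_1_continuous_grad[OF C] K z(2)] by blast
  show ?thesis
  proof (rule that[of "max C1 C2"])
    show "\<bar>\<phi> x\<bar> \<le> max C1 C2" "norm (grad \<phi> x) \<le> max C1 C2" for x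
      using C1(2)[of x] C2(2)[of x] by auto
  qed (use C1 in simp)
qed

section \<open>Star-shaped sets and dilated test functions\<close>

lemma star_shaped_wrt_dil:
  assumes "star_shaped_wrt a \<Omega>" "x \<in> \<Omega>" "0 \<le> s" "s \<le> 1"
  shows "dil a s x \<in> \<Omega>"
proof -
  have "dil a s x \<in> closed_segment a x"
    using assms(3,4) by (auto simp: dil_def in_segment algebra_simps intro!: exI[of _ s])
  then show ?thesis using assms(1,2) by (auto simp: star_shaped_wrt_def)
qed

text \<open>Contracting \<open>dil a t x\<close> by \<open>1 / t\<close> gives back
  \<open>x\<close>. Read contrapositively, expansions keep the exterior of the domain outside it, so
  a zero extension composed with \<open>dil a t\<close> still vanishes off the domain. This fixes
  the direction of all dilations below.\<close>

lemma star_shaped_wrt_dil_inverse: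
  assumes "star_shaped_wrt a \<Omega>" "dil a t x \<in> \<Omega>" "t \<ge> 1"
  shows "x \<in> \<Omega>"
  using star_shaped_wrt_dil[OF assms(1,2), of "1 / t"] assms(3) by simp

lemma grad_dil:
  assumes "Ck 1 f"
  shows "grad (\<lambda>x. f (dil a t x)) x = t *\<^sub>R grad f (dil a t x)"
  using grad_eq[OF gderiv_dil[OF Ck_1_gderiv[OF assms], where c = 1]] by simp

text \<open>The support of the dilated function lies in the image of the old support under the
  contraction by \<open>1 / t\<close>. That image is compact, and star-shapedness keeps it inside
  the domain.\<close>

lemma test_function_dil:
  assumes "test_function \<Omega> \<phi>" "star_shaped_wrt a \<Omega>" "t \<ge> 1"
  shows "test_function \<Omega> (\<lambda>x. \<phi> (dil a t x))"
proof -
  let ?K = "closure {x. \<phi> x \<noteq> 0}" and ?L = "closure {x. \<phi> (dil a t x) \<noteq> 0}"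
  have K: "compact ?K" "?K \<subseteq> \<Omega>" using assms by (simp_all add: test_function_def)
  have c: "compact (dil a (1 / t) ` ?K)"
    by (intro compact_continuous_image K) (auto intro!: continuous_intros)
  have "{x. \<phi> (dil a t x) \<noteq> 0} \<subseteq> dil a (1 / t) ` ?K"
  proof
    fix x assume "x \<in> {x. \<phi> (dil a t x) \<noteq> 0}"
    then have "dil a t x \<in> ?K" using closure_subset[of "{x. \<phi> x \<noteq> 0}"] by auto
    then show "x \<in> dil a (1 / t) ` ?K" using assms(3) by (intro image_eqI[of _ _ "dil a t x"]) auto
  qed
  then have L: "?L \<subseteq> dil a (1 / t) ` ?K"
    by (simp add: c closure_minimal compact_imp_closed)
  have "dil a (1 / t) ` ?K \<subseteq> \<Omega>"
    using K(2) star_shaped_wrt_dil[OF assms(2), of _ "1/t"] assms(3) by auto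
  moreover have "compact ?L"
    using L c by (meson closed_closure compact_closure bounded_subset compact_imp_bounded bounded_closure closure_closure compact_eq_bounded_closed)
  moreover have "Ck k (\<lambda>x. \<phi> (dil a t x))" for k
    using Ck_dil[of k \<phi> 1] assms(1) by (simp add: test_function_def)
  ultimately show ?thesis using L unfolding test_function_def by blast
qed

text \<open>A translation by \<open>c\<close> is the dilation by 2 about 0 followed by the dilation
  by 1/2 about \<open>2 *\<^sub>R c\<close>; the two Jacobians cancel.\<close>

lemma lebesgue_integral_translation:
  fixes f :: "'a::euclidean_space \<Rightarrow> 'b::{banach, second_countable_topology}"
  assumes "integrable lebesgue f"
  shows "integrable lebesgue (\<lambda>x. f (x + c))" "(LINT x|lebesgue. f (x + c)) = (LINT x|lebesgue. f x)"
proof -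
  have eq: "dil (2 *\<^sub>R c) (1 / 2) (dil 0 2 x) = x + c" for x :: 'a
    by (simp add: dil_def scaleR_right_diff_distrib) (simp add: scaleR_2)
  note 1 = lebesgue_integral_dil[OF assms, of "1/2" "2 *\<^sub>R c"]
  note 2 = lebesgue_integral_dil[OF 1(1), of 2 0]
  show "integrable lebesgue (\<lambda>x. f (x + c))" "(LINT x|lebesgue. f (x + c)) = (LINT x|lebesgue. f x)"
    using 1 2 by (auto simp: eq power_divide)
qed

lemma integrable_compact_support:
  fixes f :: "'a::euclidean_space \<Rightarrow> real"
  assumes "continuous_on UNIV f" "compact K" "\<And>x. x \<notin> K \<Longrightarrow> f x = 0"
  shows "integrable lebesgue f"
proof -
  have "in_Lp UNIV 1 f"
    by (rule in_Lp_continuous_compact_support[OF assms]) auto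
  then have "integrable lebesgue (\<lambda>x. norm (f x))" "f \<in> borel_measurable lebesgue"
    by (auto simp: in_Lp_UNIV)
  then show ?thesis using integrable_norm_cancel by blast
qed

text \<open>By translation invariance every difference quotient of \<open>g\<close> in direction
  \<open>b\<close> has integral zero. These quotients converge pointwise to the directional
  derivative and are dominated through the Lipschitz constant of \<open>g\<close>, so the limit has
  integral zero too.\<close>

lemma integral_grad_compact_support:
  fixes g :: "'a::euclidean_space \<Rightarrow> real"
  assumes g: "\<And>x. GDERIV g x :> D x" "continuous_on UNIV D"
    and K: "compact K" "\<And>x. x \<notin> K \<Longrightarrow> g x = 0" "\<And>x. x \<notin> K \<Longrightarrow> D x = 0"
    and b: "b \<in> Basis"
  shows "(LINT x|lebesgue. D x \<bullet> b) = 0"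
proof -
  have der: "(g has_derivative (\<lambda>h. h \<bullet> D x)) (at x)" for x
    using g(1) by (simp add: gderiv_def)
  have gc: "continuous_on UNIV g"
    by (intro continuous_at_imp_continuous_on ballI has_derivative_continuous[OF der])
  obtain C where C: "C > 0" "\<And>x. norm (D x) \<le> C"
    using continuous_compact_support_bounded[OF g(2) K(1,3)] by blast
  obtain r where "\<forall>x\<in>K. norm x \<le> r"
    using compact_imp_bounded[OF K(1)] unfolding bounded_iff ..
  then have r: "K \<subseteq> cball 0 r" by auto
  have gi: "integrable lebesgue g" by (rule integrable_compact_support[OF gc K(1,2)])
  define q where "q n x = real (Suc n) * (g (x + (1 / real (Suc n)) *\<^sub>R b) - g x)" for n x
  have q0: "(LINT x|lebesgue. q n x) = 0" for n
    unfolding q_def using lebesgue_integral_translation[OF gi] gi by simp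
  have lip: "\<bar>g (x + h) - g x\<bar> \<le> C * norm h" for x h
  proof -
    have "norm (g (x + h) - g x) \<le> C * norm (x + h - x)"
    proof (rule differentiable_bound[where S = UNIV and f' = "\<lambda>x h. h \<bullet> D x"])
      show "onorm (\<lambda>h. h \<bullet> D y) \<le> C" for y
      proof (rule onorm_le)
        show "norm (h \<bullet> D y) \<le> C * norm h" for h
          using Cauchy_Schwarz_ineq2[of h "D y"] C(2)[of y] mult_left_mono[OF C(2)[of y], of "norm h"]
          by (simp add: mult.commute) 
      qed
    qed (use der in auto)
    then show ?thesis by (simp add: mult.commute)
  qed
  have "(\<lambda>n. LINT x|lebesgue. q n x) \<longlonglongrightarrow> (LINT x|lebesgue. D x \<bullet> b)"
  \<comment> \<open>All shifts have length at most 1, so the ball of radius r + 1 contains the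
    supports of all quotients; on it they are bounded by the Lipschitz constant
    \<open>C\<close>.\<close>
  proof (rule integral_dominated_convergence[where w = "\<lambda>x. indicator (cball 0 (r + 1)) x * C"])
    show "(\<lambda>x. D x \<bullet> b) \<in> borel_measurable lebesgue"
      by (simp add: measurable_completion borel_measurable_continuous_onI continuous_on_inner g(2))
    show "q n \<in> borel_measurable lebesgue" for n
      unfolding q_def[abs_def]
      using lebesgue_integral_translation(1)[OF gi] gi by (intro borel_measurable_times borel_measurable_diff) auto
    show "integrable lebesgue (\<lambda>x. indicator (cball 0 (r + 1)) x * C)"
      by (intro integrable_mult_left) (auto simp: integrable_indicator_iff emeasure_lborel_cball_finite[unfolded infinity_ennreal_def])
    show "AE x in lebesgue. (\<lambda>n. q n x) \<longlonglongrightarrow> D x \<bullet> b"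
    proof (rule AE_I2)
      fix x
      have "((\<lambda>t. g (x + t *\<^sub>R b)) has_derivative (\<lambda>h. (h *\<^sub>R b) \<bullet> D x)) (at 0)"
        by (rule has_derivative_compose[where g = g and f = "\<lambda>t. x + t *\<^sub>R b"])
           (use der in \<open>auto intro!: derivative_eq_intros\<close>)
      then have "((\<lambda>t. g (x + t *\<^sub>R b)) has_real_derivative (D x \<bullet> b)) (at 0)"
        by (simp add: has_field_derivative_def mult_commute_abs inner_commute)
      then have "((\<lambda>t. (g (x + t *\<^sub>R b) - g x) / t) \<longlongrightarrow> D x \<bullet> b) (at 0)"
        by (simp add: has_field_derivative_iff)
      moreover have "filterlim (\<lambda>n. 1 / real (Suc n)) (at 0) sequentially"
        unfolding filterlim_at using LIMSEQ_inverse_real_of_nat by (auto simp: inverse_eq_divide)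
      ultimately have "(\<lambda>n. (g (x + (1 / real (Suc n)) *\<^sub>R b) - g x) / (1 / real (Suc n))) \<longlonglongrightarrow> D x \<bullet> b"
        by (rule filterlim_compose)
      then show "(\<lambda>n. q n x) \<longlonglongrightarrow> D x \<bullet> b"
        by (simp add: q_def mult.commute)
    qed
    show "AE x in lebesgue. norm (q n x) \<le> indicator (cball 0 (r + 1)) x * C" for n
    proof (rule AE_I2)
      fix x
      show "norm (q n x) \<le> indicator (cball 0 (r + 1)) x * C"
      proof (cases "x \<in> cball 0 (r + 1)")
        case True
        have "\<bar>g (x + (1 / real (Suc n)) *\<^sub>R b) - g x\<bar> \<le> C * (1 / real (Suc n))"
          using lip[of x "(1 / real (Suc n)) *\<^sub>R b"] b by simp
        then have "real (Suc n) * \<bar>g (x + (1 / real (Suc n)) *\<^sub>R b) - g x\<bar> \<le> C"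
          by (simp add: field_simps)
        then show ?thesis using True by (simp add: q_def abs_mult)
      next
        case False
        have "norm ((1 / real (Suc n)) *\<^sub>R b) \<le> 1" using b by simp
        moreover have "norm x \<le> norm (x + (1 / real (Suc n)) *\<^sub>R b) + norm ((1 / real (Suc n)) *\<^sub>R b)"
          using norm_triangle_ineq4[of "x + (1 / real (Suc n)) *\<^sub>R b" "(1 / real (Suc n)) *\<^sub>R b"]
          unfolding add_diff_cancel_right' .
        moreover have "norm x > r + 1" using False by simp
        ultimately have "norm (x + (1 / real (Suc n)) *\<^sub>R b) > r" "norm x > r" by linarith+
        then have "x \<notin> K" "x + (1 / real (Suc n)) *\<^sub>R b \<notin> K" using r by auto
        then show ?thesis using K(2) by (simp add: q_def C less_imp_le)
      qed
    qed
  qed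
  then show ?thesis using q0 by (simp add: LIMSEQ_const_iff)
qed

text \<open>The product \<phi>\<psi> has a gradient with vanishing integral. Every term contains
  \<phi> or its gradient, so the support of \<phi> serves as the compact set throughout.\<close>

lemma test_function_integration_by_parts:
  fixes \<phi> \<psi> :: "'a::euclidean_space \<Rightarrow> real"
  assumes "test_function \<Omega> \<phi>" "test_function \<Omega> \<psi>" "b \<in> Basis"
  shows "(LINT x|lebesgue. \<phi> x * (grad \<psi> x \<bullet> b)) = - (LINT x|lebesgue. (grad \<phi> x \<bullet> b) * \<psi> x)"
proof -
  let ?K = "closure {x. \<phi> x \<noteq> 0}"
  have K: "compact ?K" using assms by (simp add: test_function_def)
  note z = zero_outside_closure_support[of _ \<phi>]
  have C: "Ck 1 \<phi>" "Ck 1 \<psi>" using assms test_function_Ck_1 by blast+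
  have c: "continuous_on UNIV \<phi>" "continuous_on UNIV \<psi>"
    using C Ck_Suc_continuous[of 0] by simp_all
  note g = C[THEN Ck_1_continuous_grad]
  have "(LINT x|lebesgue. (\<phi> x *\<^sub>R grad \<psi> x + \<psi> x *\<^sub>R grad \<phi> x) \<bullet> b) = 0"
  proof (rule integral_grad_compact_support[OF _ _ K _ _ assms(3)])
    show "GDERIV (\<lambda>x. \<phi> x * \<psi> x) x :> \<phi> x *\<^sub>R grad \<psi> x + \<psi> x *\<^sub>R grad \<phi> x" for x
      by (rule GDERIV_mult) (use C in \<open>auto intro: Ck_1_gderiv\<close>)
    show "continuous_on UNIV (\<lambda>x. \<phi> x *\<^sub>R grad \<psi> x + \<psi> x *\<^sub>R grad \<phi> x)"
      by (intro continuous_on_add continuous_on_scaleR c g)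
    show "\<phi> x * \<psi> x = 0" "\<phi> x *\<^sub>R grad \<psi> x + \<psi> x *\<^sub>R grad \<phi> x = 0" if "x \<notin> ?K" for x
      using z[OF that] by simp_all
  qed
  moreover have "integrable lebesgue (\<lambda>x. \<phi> x * (grad \<psi> x \<bullet> b))"
  proof (rule integrable_compact_support[OF _ K])
    show "continuous_on UNIV (\<lambda>x. \<phi> x * (grad \<psi> x \<bullet> b))"
      by (intro continuous_on_mult continuous_on_inner continuous_on_const c g)
    show "\<phi> x * (grad \<psi> x \<bullet> b) = 0" if "x \<notin> ?K" for x
      using z[OF that] by simp
  qed
  moreover have "integrable lebesgue (\<lambda>x. (grad \<phi> x \<bullet> b) * \<psi> x)"
  proof (rule integrable_compact_support[OF _ K])
    show "continuous_on UNIV (\<lambda>x. (grad \<phi> x \<bullet> b) * \<psi> x)"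
      by (intro continuous_on_mult continuous_on_inner continuous_on_const c g)
    show "(grad \<phi> x \<bullet> b) * \<psi> x = 0" if "x \<notin> ?K" for x
      using z[OF that] by simp
  qed
  ultimately show ?thesis by (simp add: inner_add_left mult.commute)
qed

text \<open>If a > \<epsilon>, then (a / \<epsilon>) to the power p - 1 exceeds or equals 1. On sets
  of finite measure this takes the place of Hoelder's inequality: first powers are controlled by
  p-th powers at the cost of a freely chosen \<epsilon>.\<close>

lemma le_eps_powr:
  fixes a :: real
  assumes "a \<ge> 0" "\<epsilon> > 0" "p \<ge> 1"
  shows "a \<le> \<epsilon> + \<epsilon> powr (1 - p) * a powr p"
proof (cases "a \<le> \<epsilon>")
  case True
  then show ?thesis by (smt (verit) mult_nonneg_nonneg powr_ge_zero)
next
  case False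
  then have "a = a powr (1 - p) * a powr p"
    using assms by (simp flip: powr_add)
  also have "\<dots> \<le> \<epsilon> powr (1 - p) * a powr p"
    using False assms by (intro mult_right_mono powr_mono2') auto
  finally show ?thesis using assms by linarith
qed

lemma in_Lp_imp_integrable:
  fixes f :: "'a::euclidean_space \<Rightarrow> 'b::euclidean_space"
  assumes f: "in_Lp S p f" and p: "p \<ge> 1" and S: "S \<in> lmeasurable"
  shows "integrable (lebesgue_on S) f"
proof (rule Bochner_Integration.integrable_bound)
  interpret finite_measure "lebesgue_on S"
    using S by (rule finite_measure_lebesgue_on)
  show "integrable (lebesgue_on S) (\<lambda>x. 1 + norm (f x) powr p)"
    using f by (auto simp: in_Lp_def)
  show "f \<in> borel_measurable (lebesgue_on S)" using f by (simp add: in_Lp_def)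
  have "norm (f x) \<le> 1 + norm (f x) powr p" for x
    using le_eps_powr[of "norm (f x)" 1 p] p by simp
  then show "AE x in lebesgue_on S. norm (f x) \<le> norm (1 + norm (f x) powr p)"
    by (intro AE_I2) (smt (verit) norm_ge_zero powr_ge_zero real_norm_def)
qed

text \<open>Splitting |h| by \<open>le_eps_powr\<close> bounds the integral by a multiple of e times
  the measure of \<open>S\<close> plus an e-dependent multiple of the p-th power integral. The first
  part is made small by the choice of e, the second then by the choice of k.\<close>

lemma Lp_tendsto_imp_integral_tendsto:
  fixes h :: "nat \<Rightarrow> 'a::euclidean_space \<Rightarrow> real"
  assumes h: "\<And>k. in_Lp S p (h k)" and p: "p \<ge> 1" and S: "S \<in> lmeasurable"
    and lim: "(\<lambda>k. LINT x|lebesgue_on S. norm (h k x) powr p) \<longlonglongrightarrow> 0"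
    and \<psi>: "\<psi> \<in> borel_measurable (lebesgue_on S)" "\<And>x. x \<in> S \<Longrightarrow> \<bar>\<psi> x\<bar> \<le> C"
  shows "(\<lambda>k. LINT x|lebesgue_on S. h k x * \<psi> x) \<longlonglongrightarrow> 0"
proof -
  interpret finite_measure "lebesgue_on S"
    using S by (rule finite_measure_lebesgue_on)
  have int: "integrable (lebesgue_on S) (\<lambda>x. \<bar>h k x\<bar>)" for k
    using in_Lp_imp_integrable[OF h p S] by auto
  have hp: "integrable (lebesgue_on S) (\<lambda>x. norm (h k x) powr p)" for k
    using h by (auto simp: in_Lp_def)
  define B where "B = \<bar>C\<bar> + 1"
  have B: "B > 0" "\<And>x. x \<in> S \<Longrightarrow> \<bar>\<psi> x\<bar> \<le> B" using \<psi>(2) by (fastforce simp: B_def)+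
  have main: "\<bar>LINT x|lebesgue_on S. h k x * \<psi> x\<bar>
      \<le> B * (e * measure lebesgue S + e powr (1 - p) * (LINT x|lebesgue_on S. norm (h k x) powr p))"
    if e: "e > 0" for e k
  proof -
    have "\<bar>LINT x|lebesgue_on S. h k x * \<psi> x\<bar> \<le> (LINT x|lebesgue_on S. B * (e + e powr (1 - p) * norm (h k x) powr p))"
    proof (rule integral_abs_bound_integral)
      show "integrable (lebesgue_on S) (\<lambda>x. B * (e + e powr (1 - p) * norm (h k x) powr p))"
        using hp by auto
      show le: "\<bar>h k x * \<psi> x\<bar> \<le> B * (e + e powr (1 - p) * norm (h k x) powr p)"
        if "x \<in> space (lebesgue_on S)" for x
      proof -
        have "\<bar>h k x\<bar> * \<bar>\<psi> x\<bar> \<le> \<bar>h k x\<bar> * B"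
          using that B(2)[of x] by (intro mult_left_mono) auto
        also have "\<dots> \<le> (e + e powr (1 - p) * norm (h k x) powr p) * B"
          using le_eps_powr[OF _ e p, of "\<bar>h k x\<bar>"] B by (intro mult_right_mono) auto
        finally show ?thesis by (simp add: abs_mult mult.commute)
      qed
      show "integrable (lebesgue_on S) (\<lambda>x. h k x * \<psi> x)"
      proof (rule Bochner_Integration.integrable_bound)
        show "integrable (lebesgue_on S) (\<lambda>x. B * (e + e powr (1 - p) * norm (h k x) powr p))"
          using hp by auto
        show "(\<lambda>x. h k x * \<psi> x) \<in> borel_measurable (lebesgue_on S)"
          using h[of k] \<psi>(1) by (intro borel_measurable_times) (simp_all add: in_Lp_def)
        show "AE x in lebesgue_on S. norm (h k x * \<psi> x) \<le> norm (B * (e + e powr (1 - p) * norm (h k x) powr p))"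
        proof (rule AE_I2)
          fix x assume "x \<in> space (lebesgue_on S)"
          from le[OF this] show "norm (h k x * \<psi> x) \<le> norm (B * (e + e powr (1 - p) * norm (h k x) powr p))"
            by (metis abs_ge_self order_trans real_norm_def)
        qed
      qed
    qed
    also have "\<dots> = B * (e * measure lebesgue S + e powr (1 - p) * (LINT x|lebesgue_on S. norm (h k x) powr p))"
      using hp S by (simp add: measure_restrict_space space_restrict_space fmeasurableD mult.commute)
    finally show ?thesis .
  qed
  show ?thesis
  proof (rule LIMSEQ_I)
    fix r :: real assume r: "r > 0"
    \<comment> \<open>Chosen so that the part not depending on k is at most r / 2; the summand 1
      keeps the denominator positive when \<open>S\<close> is a null set.\<close>
    define e where "e = r / (2 * B * (measure lebesgue S + 1))"
    have m: "measure lebesgue S \<ge> 0" by simp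
    have e: "e > 0" using r B m by (simp add: e_def add_nonneg_pos)
    have "e * measure lebesgue S \<le> e * (measure lebesgue S + 1)" using e by simp
    also have "\<dots> = r / (2 * B)" using m B by (simp add: e_def field_simps add_nonneg_eq_0_iff)
    finally have BE: "B * (e * measure lebesgue S) \<le> r / 2" using B by (simp add: field_simps)
    have "(\<lambda>k. B * (e powr (1 - p) * (LINT x|lebesgue_on S. norm (h k x) powr p))) \<longlonglongrightarrow> 0"
      using lim by (auto intro!: tendsto_mult_right_zero)
    from LIMSEQ_D[OF this, of "r / 2"] r obtain N where
      N: "\<And>k. k \<ge> N \<Longrightarrow> \<bar>B * (e powr (1 - p) * (LINT x|lebesgue_on S. norm (h k x) powr p))\<bar> < r / 2"
      by auto
    have "norm ((LINT x|lebesgue_on S. h k x * \<psi> x) - 0) < r" if "k \<ge> N" for k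
    proof -
      have "\<bar>B * (e powr (1 - p) * (LINT x|lebesgue_on S. norm (h k x) powr p))\<bar> < r / 2"
        using N that by blast
      then show ?thesis
        using main[OF e, of k] BE unfolding distrib_left diff_zero real_norm_def by linarith
    qed
    then show "\<exists>N. \<forall>k\<ge>N. norm ((LINT x|lebesgue_on S. h k x * \<psi> x) - 0) < r" by blast
  qed
qed

section \<open>Limits of test functions\<close>

lemma in_Lp_absolutely_integrable_compact:
  fixes f :: "'a::euclidean_space \<Rightarrow> 'b::euclidean_space"
  assumes f: "in_Lp \<Omega> p f" and p: "p \<ge> 1" and \<Omega>: "\<Omega> \<in> lmeasurable" and K: "compact K" "K \<subseteq> \<Omega>"
  shows "f absolutely_integrable_on K"
proof -
  have "integrable (lebesgue_on \<Omega>) f" using in_Lp_imp_integrable[OF f p \<Omega>] .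
  then have "f absolutely_integrable_on \<Omega>"
    using \<Omega> by (simp add: set_integrable_def integrable_restrict_space fmeasurableD)
  then show ?thesis
    by (rule set_integrable_subset) (use K in \<open>auto simp: compact_imp_closed\<close>)
qed

text \<open>For test functions the identity is integration by parts, and both sides pass to the
  limit because \<psi> and its gradient are bounded. Hence a dilated function receives its weak
  gradient merely by dilating an approximating sequence.\<close>

lemma has_weak_gradient_limit:
  fixes g :: "'a::euclidean_space \<Rightarrow> real"
  assumes p: "p \<ge> 1" and \<Omega>: "\<Omega> \<in> lmeasurable" and L: "in_Lp \<Omega> p g" "in_Lp \<Omega> p W"
    and t: "\<And>k::nat. test_function \<Omega> (\<phi> k)"
    and lim: "(\<lambda>k. LINT x|lebesgue_on \<Omega>. \<bar>\<phi> k x - g x\<bar> powr p) \<longlonglongrightarrow> 0"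
      "(\<lambda>k. LINT x|lebesgue_on \<Omega>. norm (grad (\<phi> k) x - W x) powr p) \<longlonglongrightarrow> 0"
  shows "has_weak_gradient \<Omega> g W"
  unfolding has_weak_gradient_def
proof (intro conjI allI impI ballI)
  fix K assume "compact K \<and> K \<subseteq> \<Omega>"
  then show "g absolutely_integrable_on K" "W absolutely_integrable_on K"
    using in_Lp_absolutely_integrable_compact[OF _ p \<Omega>] L by blast+
next
  have \<Omega>s: "\<Omega> \<in> sets lebesgue" using \<Omega> by blast
  fix \<psi> and b :: 'a assume \<psi>: "test_function \<Omega> \<psi>" and b: "b \<in> Basis"
  obtain C where C: "C > 0" "\<And>x. \<bar>\<psi> x\<bar> \<le> C" "\<And>x. norm (grad \<psi> x) \<le> C"
    using test_function_bounded[OF \<psi>] by metis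
  have Cb: "\<bar>grad \<psi> x \<bullet> b\<bar> \<le> C" for x
    using Basis_le_norm[OF b, of "grad \<psi> x"] C(3)[of x] by linarith
  have p0: "p > 0" using p by simp
  have tL: "in_Lp \<Omega> p (\<phi> k)" "in_Lp \<Omega> p (grad (\<phi> k))" for k
    using test_function_in_Lp[OF t \<Omega>s p0] by auto
  have m: "\<psi> \<in> borel_measurable (lebesgue_on \<Omega>)" "(\<lambda>x. grad \<psi> x \<bullet> b) \<in> borel_measurable (lebesgue_on \<Omega>)"
    using test_function_in_Lp[OF \<psi> \<Omega>s p0] by (auto simp: in_Lp_def intro!: borel_measurable_inner)
  have bcomp: "in_Lp \<Omega> p (\<lambda>x. f x \<bullet> b)" 
    if "in_Lp \<Omega> p f" for f :: "'a \<Rightarrow> 'a"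
  proof (rule in_Lp_bound[OF that that, where C = 1])
    show "(\<lambda>x. f x \<bullet> b) \<in> borel_measurable (lebesgue_on \<Omega>)" using that by (auto simp: in_Lp_def intro!: borel_measurable_inner)
    show "norm (f x \<bullet> b) powr p \<le> 1 * (norm (f x) powr p + norm (f x) powr p)" for x
    proof -
      have "norm (f x \<bullet> b) powr p \<le> norm (f x) powr p"
        using Basis_le_norm[OF b, of "f x"] p by (intro powr_mono2) auto
      also have "\<dots> \<le> 1 * (norm (f x) powr p + norm (f x) powr p)" by simp
      finally show ?thesis .
    qed
  qed
  have d1: "in_Lp \<Omega> p (\<lambda>x. \<phi> k x - g x)" for k by (rule in_Lp_diff[OF tL(1) L(1) p0])
  have d2: "in_Lp \<Omega> p (\<lambda>x. grad (\<phi> k) x - W x)" for k by (rule in_Lp_diff[OF tL(2) L(2) p0])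
  have lim2: "(\<lambda>k. LINT x|lebesgue_on \<Omega>. norm ((grad (\<phi> k) x - W x) \<bullet> b) powr p) \<longlonglongrightarrow> 0"
  proof (rule tendsto_sandwich[OF _ _ tendsto_const lim(2)])
    show "\<forall>\<^sub>F k in sequentially. (LINT x|lebesgue_on \<Omega>. norm ((grad (\<phi> k) x - W x) \<bullet> b) powr p)
        \<le> (LINT x|lebesgue_on \<Omega>. norm (grad (\<phi> k) x - W x) powr p)"
    proof (rule always_eventually, rule allI, rule integral_mono)
      fix k
      show "integrable (lebesgue_on \<Omega>) (\<lambda>x. norm ((grad (\<phi> k) x - W x) \<bullet> b) powr p)"
        using bcomp[OF d2] by (simp add: in_Lp_def)
      show "integrable (lebesgue_on \<Omega>) (\<lambda>x. norm (grad (\<phi> k) x - W x) powr p)"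
        using d2 by (simp add: in_Lp_def)
      show "norm ((grad (\<phi> k) x - W x) \<bullet> b) powr p \<le> norm (grad (\<phi> k) x - W x) powr p" for x
        using Basis_le_norm[OF b, of "grad (\<phi> k) x - W x"] p by (intro powr_mono2) auto
    qed
  qed simp
  have A: "(\<lambda>k. LINT x|lebesgue_on \<Omega>. (\<phi> k x - g x) * (grad \<psi> x \<bullet> b)) \<longlonglongrightarrow> 0"
    using lim(1) by (intro Lp_tendsto_imp_integral_tendsto[OF d1 p \<Omega> _ m(2) Cb]) simp
  have B: "(\<lambda>k. LINT x|lebesgue_on \<Omega>. ((grad (\<phi> k) x - W x) \<bullet> b) * \<psi> x) \<longlonglongrightarrow> 0"
    by (intro Lp_tendsto_imp_integral_tendsto[OF bcomp[OF d2] p \<Omega> lim2 m(1) C(2)])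
  have int: "integrable (lebesgue_on \<Omega>) (\<lambda>x. f x * h x)"
    if f: "in_Lp \<Omega> p f" and h: "h \<in> borel_measurable (lebesgue_on \<Omega>)" "\<And>x. \<bar>h x\<bar> \<le> C" for f h :: "'a \<Rightarrow> real"
  proof (rule Bochner_Integration.integrable_bound)
    show "integrable (lebesgue_on \<Omega>) (\<lambda>x. f x * C)"
      using in_Lp_imp_integrable[OF f p \<Omega>] by simp
    show "(\<lambda>x. f x * h x) \<in> borel_measurable (lebesgue_on \<Omega>)"
      using f h by (intro borel_measurable_times) (simp_all add: in_Lp_def)
    show "AE x in lebesgue_on \<Omega>. norm (f x * h x) \<le> norm (f x * C)"
      using h(2) C(1) by (intro AE_I2) (auto simp: abs_mult intro!: mult_left_mono)
  qed
  have eqA: "(LINT x|lebesgue_on \<Omega>. (\<phi> k x - g x) * (grad \<psi> x \<bullet> b)) =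
    (LINT x|lebesgue_on \<Omega>. \<phi> k x * (grad \<psi> x \<bullet> b)) - (LINT x|lebesgue_on \<Omega>. g x * (grad \<psi> x \<bullet> b))" for k
    using int[OF tL(1) m(2) Cb] int[OF L(1) m(2) Cb] by (simp add: left_diff_distrib)
  have eqB: "(LINT x|lebesgue_on \<Omega>. ((grad (\<phi> k) x - W x) \<bullet> b) * \<psi> x) =
    (LINT x|lebesgue_on \<Omega>. (grad (\<phi> k) x \<bullet> b) * \<psi> x) - (LINT x|lebesgue_on \<Omega>. (W x \<bullet> b) * \<psi> x)" for k
    using int[OF bcomp[OF tL(2)] m(1) C(2)] int[OF bcomp[OF L(2)] m(1) C(2)]
    by (simp add: left_diff_distrib inner_diff_left)
  have parts: "(LINT x|lebesgue_on \<Omega>. \<phi> k x * (grad \<psi> x \<bullet> b)) = - (LINT x|lebesgue_on \<Omega>. (grad (\<phi> k) x \<bullet> b) * \<psi> x)" for k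
  proof -
    have "zero_ext \<Omega> (\<lambda>x. \<phi> k x * (grad \<psi> x \<bullet> b)) = (\<lambda>x. \<phi> k x * (grad \<psi> x \<bullet> b))"
      "zero_ext \<Omega> (\<lambda>x. (grad (\<phi> k) x \<bullet> b) * \<psi> x) = (\<lambda>x. (grad (\<phi> k) x \<bullet> b) * \<psi> x)"
      using test_function_outside[OF \<psi>] by (auto simp: fun_eq_iff zero_ext_def indicator_def)
    then show ?thesis
      using test_function_integration_by_parts[OF t \<psi> b, of k] by (simp add: integral_ext \<Omega>s)
  qed
  from tendsto_add[OF A B]
  have "(\<lambda>k. - (LINT x|lebesgue_on \<Omega>. g x * (grad \<psi> x \<bullet> b)) - (LINT x|lebesgue_on \<Omega>. (W x \<bullet> b) * \<psi> x)) \<longlonglongrightarrow> 0"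
    by (simp add: eqA eqB parts)
  then show "(LINT x|lebesgue_on \<Omega>. g x * (grad \<psi> x \<bullet> b)) = - (LINT x|lebesgue_on \<Omega>. (W x \<bullet> b) * \<psi> x)"
    by (simp add: LIMSEQ_const_iff)
qed

text \<open>Names the gradient and the approximating sequence that \<open>in_W0\<close> hides behind
  existential quantifiers. The weak gradient property is left out because the convergence forces it,
  see \<open>W0_approx_imp\<close>.\<close>

definition W0_approx :: "'a::euclidean_space set \<Rightarrow> real \<Rightarrow> ('a \<Rightarrow> real) \<Rightarrow> ('a \<Rightarrow> 'a) \<Rightarrow> (nat \<Rightarrow> 'a \<Rightarrow> real) \<Rightarrow> bool" where
  "W0_approx \<Omega> p u v \<phi> \<longleftrightarrow> in_Lp \<Omega> p u \<and> in_Lp \<Omega> p v \<and> (\<forall>k. test_function \<Omega> (\<phi> k)) \<and>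
     (\<lambda>k. LINT x|lebesgue_on \<Omega>. \<bar>\<phi> k x - u x\<bar> powr p) \<longlonglongrightarrow> 0 \<and>
     (\<lambda>k. LINT x|lebesgue_on \<Omega>. norm (grad (\<phi> k) x - v x) powr p) \<longlonglongrightarrow> 0"

lemma W0_approx_imp:
  assumes "W0_approx \<Omega> p u v \<phi>" "p \<ge> 1" "\<Omega> \<in> lmeasurable"
  shows "in_W0 \<Omega> p u" "has_weak_gradient \<Omega> u v"
proof -
  show "has_weak_gradient \<Omega> u v"
    using has_weak_gradient_limit[of p \<Omega> u v \<phi>] assms by (simp add: W0_approx_def)
  then show "in_W0 \<Omega> p u" using assms(1) unfolding in_W0_def W0_approx_def by blast
qed

lemma in_W0_E:
  assumes "in_W0 \<Omega> p u"
  obtains v \<phi> where "has_weak_gradient \<Omega> u v" "W0_approx \<Omega> p u v \<phi>"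
  using assms unfolding in_W0_def W0_approx_def by blast

lemma W0_approx_ext:
  assumes "W0_approx \<Omega> p u v \<phi>" "\<Omega> \<in> sets lebesgue"
  shows "(\<lambda>k. LINT x|lebesgue. norm (\<phi> k x - zero_ext \<Omega> u x) powr p) \<longlonglongrightarrow> 0"
    "(\<lambda>k. LINT x|lebesgue. norm (grad (\<phi> k) x - zero_ext \<Omega> v x) powr p) \<longlonglongrightarrow> 0"
proof -
  have "zero_ext \<Omega> (\<lambda>x. \<bar>\<phi> k x - u x\<bar> powr p) = (\<lambda>x. norm (\<phi> k x - zero_ext \<Omega> u x) powr p)"
    "zero_ext \<Omega> (\<lambda>x. norm (grad (\<phi> k) x - v x) powr p) = (\<lambda>x. norm (grad (\<phi> k) x - zero_ext \<Omega> v x) powr p)" for k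
    using test_function_outside[of \<Omega> "\<phi> k"] assms(1)
    by (auto simp: fun_eq_iff zero_ext_def indicator_def W0_approx_def)
  then show "(\<lambda>k. LINT x|lebesgue. norm (\<phi> k x - zero_ext \<Omega> u x) powr p) \<longlonglongrightarrow> 0"
    "(\<lambda>k. LINT x|lebesgue. norm (grad (\<phi> k) x - zero_ext \<Omega> v x) powr p) \<longlonglongrightarrow> 0"
    using assms by (simp_all add: W0_approx_def integral_ext)
qed

text \<open>The approximating sequence is dilated as well. By the change of variables the errors are
  only multiplied by constants, t^(-n) for the functions and t^(p - n) for the gradients, so they
  still tend to 0.\<close>

lemma W0_approx_dil:
  fixes \<Omega> :: "'a::euclidean_space set"
  assumes W: "W0_approx \<Omega> p u v \<phi>" and star: "star_shaped_wrt a \<Omega>" and t: "t \<ge> 1"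
    and p: "p > 0" and \<Omega>: "\<Omega> \<in> sets lebesgue"
  shows "W0_approx \<Omega> p (\<lambda>x. zero_ext \<Omega> u (dil a t x)) (\<lambda>x. t *\<^sub>R zero_ext \<Omega> v (dil a t x)) (\<lambda>k x. \<phi> k (dil a t x))"
proof -
  have uL: "in_Lp UNIV p (zero_ext \<Omega> u)" and vL: "in_Lp UNIV p (zero_ext \<Omega> v)"
    using W in_Lp_ext[OF \<Omega>] by (auto simp: W0_approx_def)
  have tf: "test_function \<Omega> (\<phi> k)" for k using W by (simp add: W0_approx_def)
  have out: "dil a t x \<notin> \<Omega>" if "x \<notin> \<Omega>" for x
    using star_shaped_wrt_dil_inverse[OF star _ t] that by blast
  have ext_eq: "zero_ext \<Omega> (\<lambda>x. f (dil a t x)) = (\<lambda>x. f (dil a t x))" if "\<And>y. y \<notin> \<Omega> \<Longrightarrow> f y = 0" for f :: "'a \<Rightarrow> 'b::real_vector"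
    using that out by (auto simp: fun_eq_iff zero_ext_def indicator_def)
  have t0: "t > 0" using t by simp
  have gr: "grad (\<lambda>x. \<phi> k (dil a t x)) = (\<lambda>x. t *\<^sub>R grad (\<phi> k) (dil a t x))" for k
    using grad_dil[OF test_function_Ck_1[OF tf]] by (simp add: fun_eq_iff)
  have tfo: "\<phi> k x = 0" "grad (\<phi> k) x = 0" if "x \<notin> \<Omega>" for k x
    using test_function_outside[OF tf that] by auto
  have d1: "in_Lp UNIV p (\<lambda>x. \<phi> k x - zero_ext \<Omega> u x)" for k
    using test_function_in_Lp[OF tf _ p] uL p by (intro in_Lp_diff) auto
  have d2: "in_Lp UNIV p (\<lambda>x. grad (\<phi> k) x - zero_ext \<Omega> v x)" for k
    using test_function_in_Lp[OF tf _ p] vL p by (intro in_Lp_diff) auto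
  show ?thesis
    unfolding W0_approx_def
  proof (intro conjI allI)
    show "in_Lp \<Omega> p (\<lambda>x. zero_ext \<Omega> u (dil a t x))"
      unfolding in_Lp_ext[OF \<Omega>] by (subst ext_eq) (auto intro: in_Lp_dil[OF uL t0])
    show "in_Lp \<Omega> p (\<lambda>x. t *\<^sub>R zero_ext \<Omega> v (dil a t x))"
      by (rule in_Lp_cmult, unfold in_Lp_ext[OF \<Omega>], subst ext_eq) (auto intro: in_Lp_dil[OF vL t0])
    show "test_function \<Omega> (\<lambda>x. \<phi> k (dil a t x))" for k
      by (rule test_function_dil[OF tf star t])
    have "(LINT x|lebesgue_on \<Omega>. \<bar>\<phi> k (dil a t x) - zero_ext \<Omega> u (dil a t x)\<bar> powr p) =
        (LINT x|lebesgue. norm (\<phi> k x - zero_ext \<Omega> u x) powr p) / t ^ DIM('a)" for k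
      using in_Lp_dil(2)[OF d1 t0, of k a]
      by (simp add: integral_ext[OF \<Omega>] ext_eq[of "\<lambda>y. \<bar>\<phi> k y - zero_ext \<Omega> u y\<bar> powr p"] tfo)
    then show "(\<lambda>k. LINT x|lebesgue_on \<Omega>. \<bar>\<phi> k (dil a t x) - zero_ext \<Omega> u (dil a t x)\<bar> powr p) \<longlonglongrightarrow> 0"
      using tendsto_divide_zero[OF W0_approx_ext(1)[OF W \<Omega>], of "t ^ DIM('a)"] t0 by simp
    have "(LINT x|lebesgue_on \<Omega>. norm (grad (\<lambda>x. \<phi> k (dil a t x)) x - t *\<^sub>R zero_ext \<Omega> v (dil a t x)) powr p) =
        t powr p * ((LINT x|lebesgue. norm (grad (\<phi> k) x - zero_ext \<Omega> v x) powr p) / t ^ DIM('a))" for k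
    proof -
      have "(LINT x|lebesgue_on \<Omega>. norm (grad (\<lambda>x. \<phi> k (dil a t x)) x - t *\<^sub>R zero_ext \<Omega> v (dil a t x)) powr p) =
        (LINT x|lebesgue_on \<Omega>. t powr p * norm (grad (\<phi> k) (dil a t x) - zero_ext \<Omega> v (dil a t x)) powr p)"
        using t0 by (simp add: gr powr_mult flip: scaleR_diff_right)
      also have "\<dots> = t powr p * (LINT x|lebesgue. norm (grad (\<phi> k) (dil a t x) - zero_ext \<Omega> v (dil a t x)) powr p)"
        by (simp add: integral_ext[OF \<Omega>] ext_eq[of "\<lambda>y. norm (grad (\<phi> k) y - zero_ext \<Omega> v y) powr p"] tfo)
      finally show ?thesis using in_Lp_dil(2)[OF d2 t0, of k a] by simp
    qed
    then show "(\<lambda>k. LINT x|lebesgue_on \<Omega>. norm (grad (\<lambda>x. \<phi> k (dil a t x)) x - t *\<^sub>R zero_ext \<Omega> v (dil a t x)) powr p) \<longlonglongrightarrow> 0"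
      using tendsto_mult_right_zero[OF tendsto_divide_zero[OF W0_approx_ext(2)[OF W \<Omega>], of "t ^ DIM('a)"], of "t powr p"] t0 by simp
  qed
qed

section \<open>Dilation differences\<close>

text \<open>The graph of a convex power lies above its tangent at \<open>m\<close>. Young's
  inequality with the conjugate exponent q = p / (p - 1) gives this directly and includes m =
  0.\<close>

lemma powr_tangent_line:
  fixes m g p :: real
  assumes "p > 1" "m \<ge> 0" "g \<ge> 0"
  shows "m powr p + p * m powr (p - 1) * (g - m) \<le> g powr p"
proof -
  define q where "q = p / (p - 1)"
  have q: "q > 1" "1 / q + 1 / p = 1" "p / q = p - 1" using assms by (simp_all add: q_def field_simps)
  have "m powr (p - 1) * g \<le> (m powr (p - 1)) powr q / q + g powr p / p"
    using Youngs_inequality[of q p "m powr (p - 1)" g] q assms by simp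
  also have "(m powr (p - 1)) powr q = m powr p"
    using assms by (simp add: powr_powr q_def)
  finally have "p * (m powr (p - 1) * g) \<le> p * (m powr p / q + g powr p / p)"
    using assms by (intro mult_left_mono) auto
  also have "\<dots> = (p / q) * m powr p + g powr p" using assms by (simp add: field_simps)
  finally have *: "p * (m powr (p - 1) * g) \<le> (p - 1) * m powr p + g powr p" by (simp add: q)
  have "m powr (p - 1) * m = m powr p"
    using assms by (cases "m = 0") (auto simp: powr_diff)
  with * show ?thesis by (simp add: algebra_simps)
qed

text \<open>Jensen's inequality by a supporting line: the tangent of the p-th power at
  \<open>m\<close> is integrated over the interval.\<close>

lemma integral_powr_Jensen:
  fixes f :: "real \<Rightarrow> real"
  assumes f: "continuous_on {c..d} f" and cd: "c < d" and p: "p > 1"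
    and D: "\<bar>D\<bar> \<le> (LINT s|lborel. indicator {c..d} s *\<^sub>R \<bar>f s\<bar>)"
  shows "\<bar>D\<bar> powr p \<le> (d - c) powr (p - 1) * (LINT s|lborel. indicator {c..d} s *\<^sub>R \<bar>f s\<bar> powr p)"
proof -
  \<comment> \<open>This is the mean belonging to |D|, which may be smaller than the mean of |f|.
    The slope of the tangent is nonnegative, so the excess of the integral of |f| over |D| only
    helps.\<close>
  define m where "m = \<bar>D\<bar> / (d - c)"
  have m: "m \<ge> 0" "\<bar>D\<bar> = (d - c) * m" using cd by (simp_all add: m_def)
  have i1: "integrable lborel (\<lambda>s. indicator {c..d} s *\<^sub>R \<bar>f s\<bar>)"
    by (intro borel_integrable_compact continuous_on_rabs f) simp
  have i2: "integrable lborel (\<lambda>s. indicator {c..d} s *\<^sub>R \<bar>f s\<bar> powr p)"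
    using p by (intro borel_integrable_compact continuous_on_powr' continuous_on_rabs f continuous_on_const) auto
  have i0: "integrable lborel (\<lambda>s. indicator {c..d} s *\<^sub>R (1::real))"
    by (intro borel_integrable_compact) auto
  have v: "(LINT s|lborel. indicator {c..d} s *\<^sub>R (1::real)) = d - c" using cd by simp
  define k where "k = p * m powr (p - 1)"
  have k: "k \<ge> 0" using p by (simp add: k_def)
  have "(d - c) * m powr p \<le> (d - c) * m powr p + k * ((LINT s|lborel. indicator {c..d} s *\<^sub>R \<bar>f s\<bar>) - (d - c) * m)"
    using D m k by simp
  also have "\<dots> = (LINT s|lborel. (m powr p - k * m) * (indicator {c..d} s *\<^sub>R 1) + k * (indicator {c..d} s *\<^sub>R \<bar>f s\<bar>))"
    using i0 i1 v cd by (simp add: algebra_simps)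
  also have "\<dots> \<le> (LINT s|lborel. indicator {c..d} s *\<^sub>R \<bar>f s\<bar> powr p)"
  proof (rule integral_mono)
    fix s
    show "(m powr p - k * m) * (indicator {c..d} s *\<^sub>R 1) + k * (indicator {c..d} s *\<^sub>R \<bar>f s\<bar>) \<le> indicator {c..d} s *\<^sub>R \<bar>f s\<bar> powr p"
      using powr_tangent_line[OF p m(1), of "\<bar>f s\<bar>"] by (simp add: indicator_def k_def algebra_simps)
  qed (use i0 i1 i2 in auto)
  finally have "(d - c) * m powr p \<le> (LINT s|lborel. indicator {c..d} s *\<^sub>R \<bar>f s\<bar> powr p)" .
  then have "(d - c) powr (p - 1) * ((d - c) * m powr p) \<le> (d - c) powr (p - 1) * (LINT s|lborel. indicator {c..d} s *\<^sub>R \<bar>f s\<bar> powr p)"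
    by (intro mult_left_mono) auto
  moreover have "(d - c) powr (p - 1) * ((d - c) * m powr p) = \<bar>D\<bar> powr p"
    using cd m by (simp add: powr_mult powr_diff)
  ultimately show ?thesis by simp
qed

text \<open>The difference is the integral of the radial derivative along the ray from
  \<open>x\<close> to \<open>dil a t x\<close>; Jensen's inequality on an interval of length t - 1
  supplies the factor (t - 1)^(p - 1).\<close>

lemma test_function_dil_difference_pointwise:
  fixes \<phi> :: "'a::euclidean_space \<Rightarrow> real"
  assumes \<phi>: "Ck 1 \<phi>" and t: "t > 1" and p: "p > 1"
  shows "\<bar>\<phi> (dil a t x) - \<phi> x\<bar> powr p \<le> (t - 1) powr (p - 1) *
    (LINT s|lborel. indicator {1..t} s *\<^sub>R (norm (grad \<phi> (dil a s x)) powr p * norm (dil a s x - a) powr p))"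
proof -
  define f where "f s = (x - a) \<bullet> grad \<phi> (dil a s x)" for s
  have gc: "continuous_on UNIV (\<lambda>s. grad \<phi> (dil a s x))"
    by (rule continuous_on_compose2[OF Ck_1_continuous_grad[OF \<phi>]])
       (auto intro!: continuous_on_dil continuous_on_const continuous_on_id)
  have fc: "continuous_on UNIV f"
    unfolding f_def[abs_def] by (intro continuous_on_inner continuous_on_const gc)
  have der: "DERIV (\<lambda>s. \<phi> (dil a s x)) s :> f s" for s
  proof -
    have d: "((\<lambda>s. dil a s x) has_derivative (\<lambda>h. h *\<^sub>R (x - a))) (at s)"
      unfolding dil_def[abs_def] by (auto intro!: derivative_eq_intros)
    have "((\<lambda>s. \<phi> (dil a s x)) has_derivative (\<lambda>h. (h *\<^sub>R (x - a)) \<bullet> grad \<phi> (dil a s x))) (at s)"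
      using has_derivative_compose[OF d Ck_1_gderiv[OF \<phi>, unfolded gderiv_def]] by simp
    then show ?thesis by (simp add: has_field_derivative_def f_def mult_commute_abs)
  qed
  have "has_bochner_integral lborel (\<lambda>s. f s * indicator {1..t} s) (\<phi> (dil a t x) - \<phi> (dil a 1 x))"
    using t der fc by (intro has_bochner_integral_FTC_Icc_real) (auto simp: continuous_on_eq_continuous_at)
  then have "\<phi> (dil a t x) - \<phi> x = (LINT s|lborel. f s * indicator {1..t} s)"
    by (simp add: has_bochner_integral_integral_eq)
  also have "\<bar>\<dots>\<bar> \<le> (LINT s|lborel. \<bar>f s * indicator {1..t} s\<bar>)" by (rule integral_abs_bound)
  also have "\<dots> = (LINT s|lborel. indicator {1..t} s *\<^sub>R \<bar>f s\<bar>)"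
    by (intro Bochner_Integration.integral_cong) (auto simp: indicator_def)
  finally have "\<bar>\<phi> (dil a t x) - \<phi> x\<bar> powr p \<le> (t - 1) powr (p - 1) * (LINT s|lborel. indicator {1..t} s *\<^sub>R \<bar>f s\<bar> powr p)"
    using t p fc by (intro integral_powr_Jensen) (auto intro: continuous_on_subset)
  also have "\<dots> \<le> (t - 1) powr (p - 1) *
    (LINT s|lborel. indicator {1..t} s *\<^sub>R (norm (grad \<phi> (dil a s x)) powr p * norm (dil a s x - a) powr p))"
  proof (intro mult_left_mono integral_mono)
    have fc': "continuous_on {1..t} f" using fc continuous_on_subset by blast
    show "integrable lborel (\<lambda>s. indicator {1..t} s *\<^sub>R \<bar>f s\<bar> powr p)"
      using p by (intro borel_integrable_compact continuous_on_powr' continuous_on_rabs fc' continuous_on_const) auto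
    have "continuous_on {1..t} (\<lambda>s. dil a s x - a)"
      by (intro continuous_on_diff continuous_on_dil continuous_on_const continuous_on_id)
    then show "integrable lborel (\<lambda>s. indicator {1..t} s *\<^sub>R (norm (grad \<phi> (dil a s x)) powr p * norm (dil a s x - a) powr p))"
      using p by (intro borel_integrable_compact continuous_on_mult continuous_on_powr' continuous_on_norm
        continuous_on_subset[OF gc] continuous_on_const) auto
    fix s
    show "indicator {1..t} s *\<^sub>R \<bar>f s\<bar> powr p \<le>
      indicator {1..t} s *\<^sub>R (norm (grad \<phi> (dil a s x)) powr p * norm (dil a s x - a) powr p)"
    proof (cases "s \<in> {1..t}")
      case True
      have "\<bar>f s\<bar> \<le> norm (x - a) * norm (grad \<phi> (dil a s x))"
        unfolding f_def by (rule Cauchy_Schwarz_ineq2)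
      \<comment> \<open>Since s \<ge> 1, the distance from \<open>a\<close> is replaced by that of
        the dilated point. The integrand then depends on \<open>dil a s x\<close> alone, which makes
        the change of variables applicable for each s.\<close>
      also have "\<dots> \<le> norm (dil a s x - a) * norm (grad \<phi> (dil a s x))"
      proof (rule mult_right_mono)
        have "norm (dil a s x - a) = s * norm (x - a)" using True by (simp add: dil_def)
        then show "norm (x - a) \<le> norm (dil a s x - a)"
          using mult_right_mono[of 1 s "norm (x - a)"] True by simp
      qed simp
      finally have "\<bar>f s\<bar> powr p \<le> (norm (dil a s x - a) * norm (grad \<phi> (dil a s x))) powr p"
        using p by (intro powr_mono2) auto
      then show ?thesis using True by (simp add: powr_mult mult.commute)
    qed simp
  qed simp
  finally show ?thesis .
qed

text \<open>The pointwise bound is integrated over x first. For each s \<ge> 1 the dilated weight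
  has integral at most that of \<open>w\<close>, as the Jacobian factor s^(-n) is at most 1, and the
  integration over s supplies the missing power of t - 1. Nonnegative integrals are used so that the
  exchange of order is Tonelli's theorem and needs measurability alone.\<close>

lemma test_function_dil_difference:
  fixes \<phi> :: "'a::euclidean_space \<Rightarrow> real"
  assumes \<phi>: "test_function \<Omega> \<phi>" and t: "t > 1" and p: "p > 1"
  shows "(LINT x|lebesgue. \<bar>\<phi> (dil a t x) - \<phi> x\<bar> powr p)
    \<le> (t - 1) powr p * (LINT x|lebesgue. norm (grad \<phi> x) powr p * norm (x - a) powr p)"
proof -
  define w where "w x = norm (grad \<phi> x) powr p * norm (x - a) powr p" for x
  let ?K = "closure {x. \<phi> x \<noteq> 0}"
  have K: "compact ?K" using \<phi> by (simp add: test_function_def)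
  have C: "Ck 1 \<phi>" using \<phi> test_function_Ck_1 by blast
  have wc: "continuous_on UNIV w"
    unfolding w_def[abs_def] using p
    by (intro continuous_on_mult continuous_on_powr' continuous_on_norm continuous_on_diff
      Ck_1_continuous_grad[OF C] continuous_on_const continuous_on_id) auto
  have w0: "w x \<ge> 0" for x by (simp add: w_def)
  have wi: "integrable lebesgue w"
    by (rule integrable_compact_support[OF wc K]) (simp add: w_def zero_outside_closure_support(2))
  have wm: "w \<in> borel_measurable borel" using wc by (rule borel_measurable_continuous_onI)
  have dm: "(\<lambda>(s, x). dil a s x) \<in> borel_measurable (borel \<Otimes>\<^sub>M borel)"
    unfolding dil_def by measurable
  have [measurable]: "(\<lambda>(s, x). w (dil a s x)) \<in> borel_measurable (borel \<Otimes>\<^sub>M borel)"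
    using measurable_compose[OF dm wm] by (simp add: case_prod_unfold)
  let ?d = "\<lambda>x. \<bar>\<phi> (dil a t x) - \<phi> x\<bar> powr p"
  have \<phi>c: "continuous_on UNIV \<phi>" using C Ck_Suc_continuous[of 0 \<phi>] by simp
  have dtc: "continuous_on UNIV (\<lambda>x. \<phi> (dil a t x))"
    by (rule continuous_on_compose2[OF \<phi>c]) (auto intro!: continuous_on_dil continuous_on_const continuous_on_id)
  have dc: "continuous_on UNIV ?d"
    using p by (intro continuous_on_powr' continuous_on_rabs continuous_on_diff \<phi>c dtc continuous_on_const) auto
  have dmeas: "?d \<in> borel_measurable borel" using dc by (rule borel_measurable_continuous_onI)
  have I: "(LINT x|lebesgue. w x) \<ge> 0" using w0 by (intro integral_nonneg_AE) auto
  have nnw: "(\<integral>\<^sup>+x. ennreal (w (dil a s x)) \<partial>lborel) \<le> ennreal (LINT x|lebesgue. w x)" if "s \<ge> 1" for s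
  proof -
    have s: "s > 0" using that by simp
    have "(\<integral>\<^sup>+x. ennreal (w (dil a s x)) \<partial>lborel) = (\<integral>\<^sup>+x. ennreal (w (dil a s x)) \<partial>lebesgue)"
      by (subst nn_integral_completion) simp
    also have "\<dots> = ennreal (LINT x|lebesgue. w (dil a s x))"
      using lebesgue_integral_dil(1)[OF wi s] w0 by (intro nn_integral_eq_integral) auto
    also have "\<dots> = ennreal ((LINT x|lebesgue. w x) / s ^ DIM('a))"
      by (subst lebesgue_integral_dil(2)[OF wi s]) simp
    also have "\<dots> \<le> ennreal (LINT x|lebesgue. w x)"
      using I that by (intro ennreal_leI) (simp add: divide_le_eq mult_le_cancel_left1 one_le_power)
    finally show ?thesis .
  qed
  have pw: "ennreal (?d x) \<le> ennreal ((t - 1) powr (p - 1)) * (\<integral>\<^sup>+s. indicator {1..t} s * ennreal (w (dil a s x)) \<partial>lborel)" for x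
  proof -
    have "continuous_on {1..t} (\<lambda>s. w (dil a s x))"
      by (rule continuous_on_compose2[OF wc]) (auto intro!: continuous_on_dil continuous_on_const continuous_on_id)
    then have "integrable lborel (\<lambda>s. indicator {1..t} s *\<^sub>R w (dil a s x))"
      by (intro borel_integrable_compact) auto
    then have "(\<integral>\<^sup>+s. ennreal (indicator {1..t} s *\<^sub>R w (dil a s x)) \<partial>lborel) = ennreal (LINT s|lborel. indicator {1..t} s *\<^sub>R w (dil a s x))"
      using w0 by (intro nn_integral_eq_integral) auto
    also have "(\<integral>\<^sup>+s. ennreal (indicator {1..t} s *\<^sub>R w (dil a s x)) \<partial>lborel) = (\<integral>\<^sup>+s. indicator {1..t} s * ennreal (w (dil a s x)) \<partial>lborel)"
      by (intro nn_integral_cong) (auto simp: indicator_def)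
    finally have eq: "(\<integral>\<^sup>+s. indicator {1..t} s * ennreal (w (dil a s x)) \<partial>lborel) = ennreal (LINT s|lborel. indicator {1..t} s *\<^sub>R w (dil a s x))" .
    have "ennreal (?d x) \<le> ennreal ((t - 1) powr (p - 1) * (LINT s|lborel. indicator {1..t} s *\<^sub>R w (dil a s x)))"
      using test_function_dil_difference_pointwise[OF C t p, of a x] by (intro ennreal_leI) (simp add: w_def)
    then show ?thesis unfolding eq by (simp add: ennreal_mult')
  qed
  have "(\<integral>\<^sup>+x. ennreal (?d x) \<partial>lborel) \<le>
     (\<integral>\<^sup>+x. ennreal ((t - 1) powr (p - 1)) * (\<integral>\<^sup>+s. indicator {1..t} s * ennreal (w (dil a s x)) \<partial>lborel) \<partial>lborel)"
    by (intro nn_integral_mono pw)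
  also have "\<dots> = ennreal ((t - 1) powr (p - 1)) * (\<integral>\<^sup>+x. (\<integral>\<^sup>+s. indicator {1..t} s * ennreal (w (dil a s x)) \<partial>lborel) \<partial>lborel)"
    by (intro nn_integral_cmult) measurable
  also have "(\<integral>\<^sup>+x. (\<integral>\<^sup>+s. indicator {1..t} s * ennreal (w (dil a s x)) \<partial>lborel) \<partial>lborel) =
     (\<integral>\<^sup>+s. (\<integral>\<^sup>+x. indicator {1..t} s * ennreal (w (dil a s x)) \<partial>lborel) \<partial>lborel)"
    by (rule lborel_pair.Fubini'[symmetric]) measurable
  also have "\<dots> \<le> (\<integral>\<^sup>+s. ennreal (LINT x|lebesgue. w x) * indicator {1..t} s \<partial>lborel)"
    by (intro nn_integral_mono) (auto simp: indicator_def nnw)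
  also have "\<dots> = ennreal ((LINT x|lebesgue. w x) * (t - 1))"
    using t I by (subst nn_integral_cmult_indicator) (auto simp: ennreal_mult')
  finally have "(\<integral>\<^sup>+x. ennreal (?d x) \<partial>lborel) \<le> ennreal ((t - 1) powr (p - 1) * ((LINT x|lebesgue. w x) * (t - 1)))"
    by (simp add: ennreal_mult' mult_left_mono)
  also have "(t - 1) powr (p - 1) * ((LINT x|lebesgue. w x) * (t - 1)) = (t - 1) powr p * (LINT x|lebesgue. w x)"
    using t by (simp add: powr_diff)
  finally have *: "(\<integral>\<^sup>+x. ennreal (?d x) \<partial>lborel) \<le> ennreal ((t - 1) powr p * (LINT x|lebesgue. w x))" .
  have "(LINT x|lebesgue. ?d x) = enn2real (\<integral>\<^sup>+x. ennreal (?d x) \<partial>lebesgue)"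
    using dmeas by (intro integral_eq_nn_integral) (auto simp: measurable_completion)
  also have "(\<integral>\<^sup>+x. ennreal (?d x) \<partial>lebesgue) = (\<integral>\<^sup>+x. ennreal (?d x) \<partial>lborel)"
    using dmeas by (subst nn_integral_completion) auto
  also have "enn2real (\<integral>\<^sup>+x. ennreal (?d x) \<partial>lborel) \<le> (t - 1) powr p * (LINT x|lebesgue. w x)"
    using enn2real_mono[OF *] I by simp
  finally show ?thesis by (simp add: w_def)
qed

lemma integrable_weighted_powr:
  fixes f :: "'a::euclidean_space \<Rightarrow> 'b::euclidean_space"
  assumes f: "in_Lp UNIV p f" and R: "\<And>x. f x \<noteq> 0 \<Longrightarrow> norm (x - a) \<le> R" and q: "q \<ge> 0"
  shows "integrable lebesgue (\<lambda>x. norm (f x) powr p * norm (x - a) powr q)"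
    "(LINT x|lebesgue. norm (f x) powr p * norm (x - a) powr q) \<le> (LINT x|lebesgue. norm (f x) powr p) * R powr q"
proof -
  have fi: "integrable lebesgue (\<lambda>x. norm (f x) powr p * R powr q)" and fm: "f \<in> borel_measurable lebesgue"
    using f by (auto simp: in_Lp_UNIV)
  have am: "(\<lambda>x. norm (x - a) powr q) \<in> borel_measurable lebesgue"
    by (intro measurable_completion) simp
  have le: "norm (f x) powr p * norm (x - a) powr q \<le> norm (f x) powr p * R powr q" for x
    using R[of x] q by (cases "f x = 0") (auto intro!: mult_left_mono powr_mono2)
  show i: "integrable lebesgue (\<lambda>x. norm (f x) powr p * norm (x - a) powr q)"
    by (rule Bochner_Integration.integrable_bound[OF fi]) (use fm am le in \<open>auto intro!: AE_I2\<close>)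
  show "(LINT x|lebesgue. norm (f x) powr p * norm (x - a) powr q) \<le> (LINT x|lebesgue. norm (f x) powr p) * R powr q"
    using integral_mono[OF i fi le] by simp
qed

text \<open>The constant 4^p arises from splitting twice with cost 2^p: once for replacing the
  function by \<phi>_k, once for replacing the gradient of \<phi>_k by \<open>v\<close>. The weight
  is bounded on the domain, so both errors vanish as k grows.\<close>

lemma W0_approx_dil_difference:
  fixes \<Omega> :: "'a::euclidean_space set"
  assumes W: "W0_approx \<Omega> p u v \<phi>" and t: "t > 1" and p: "p > 1" and \<Omega>: "\<Omega> \<in> sets lebesgue"
    and R: "\<And>x. x \<in> \<Omega> \<Longrightarrow> norm (x - a) \<le> R"
  shows "(LINT x|lebesgue. \<bar>zero_ext \<Omega> u (dil a t x) - zero_ext \<Omega> u x\<bar> powr p) \<le>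
    4 powr p * (t - 1) powr p * (LINT x|lebesgue. norm (zero_ext \<Omega> v x) powr p * norm (x - a) powr p)"
proof -
  have p0: "p > 0" "p \<ge> 0" using p by auto
  have t0: "t > 0" using t by simp
  have tf: "test_function \<Omega> (\<phi> k)" for k using W by (simp add: W0_approx_def)
  have uL: "in_Lp UNIV p (zero_ext \<Omega> u)" and vL: "in_Lp UNIV p (zero_ext \<Omega> v)"
    using W in_Lp_ext[OF \<Omega>] by (auto simp: W0_approx_def)
  have \<phi>L: "in_Lp UNIV p (\<phi> k)" "in_Lp UNIV p (grad (\<phi> k))" for k
    using test_function_in_Lp[OF tf _ p0(1)] by auto
  define e where "e k x = zero_ext \<Omega> u x - \<phi> k x" for k x
  define E where "E k x = grad (\<phi> k) x - zero_ext \<Omega> v x" for k x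
  have eL: "in_Lp UNIV p (e k)" for k unfolding e_def[abs_def] using uL \<phi>L p0 by (intro in_Lp_diff) auto
  have EL: "in_Lp UNIV p (E k)" for k unfolding E_def[abs_def] using vL \<phi>L p0 by (intro in_Lp_diff) auto
  note edL = in_Lp_dil[OF eL t0, of _ a]
  have pd: "in_Lp UNIV p (\<lambda>x. \<phi> k (dil a t x) - \<phi> k x)" for k
    using in_Lp_dil(1)[OF \<phi>L(1) t0, of k a] \<phi>L p0 by (intro in_Lp_diff) auto
  have ud: "in_Lp UNIV p (\<lambda>x. zero_ext \<Omega> u (dil a t x) - zero_ext \<Omega> u x)"
    using in_Lp_dil(1)[OF uL t0, of a] uL p0 by (intro in_Lp_diff) auto
  have int: "integrable lebesgue (\<lambda>x. norm (f x) powr p)" if "in_Lp UNIV p f" for f :: "'a \<Rightarrow> 'b::euclidean_space"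
    using that by (simp add: in_Lp_UNIV)
  define Z where "Z = (LINT x|lebesgue. norm (zero_ext \<Omega> v x) powr p * norm (x - a) powr p)"
  define \<alpha> where "\<alpha> k = (LINT x|lebesgue. norm (\<phi> k x - zero_ext \<Omega> u x) powr p)" for k
  define \<beta> where "\<beta> k = (LINT x|lebesgue. norm (grad (\<phi> k) x - zero_ext \<Omega> v x) powr p)" for k
  have ea: "(LINT x|lebesgue. norm (e k x) powr p) = \<alpha> k" for k
    by (simp add: e_def \<alpha>_def abs_minus_commute)
  have vR: "norm (x - a) \<le> R" if "zero_ext \<Omega> v x \<noteq> 0" for x
    using that R by (cases "x \<in> \<Omega>") auto
  have gR: "norm (x - a) \<le> R" if "grad (\<phi> k) x \<noteq> 0" for x k
    using that R test_function_outside(2)[OF tf] by blast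
  have ER: "norm (x - a) \<le> R" if "E k x \<noteq> 0" for x k
    using that R test_function_outside(2)[OF tf, of x k] by (cases "x \<in> \<Omega>") (auto simp: E_def)
  note vi = integrable_weighted_powr[OF vL vR p0(2)]
  note gi = integrable_weighted_powr[OF \<phi>L(2) gR p0(2)]
  note Ei = integrable_weighted_powr[OF EL ER p0(2)]
  have main: "(LINT x|lebesgue. \<bar>zero_ext \<Omega> u (dil a t x) - zero_ext \<Omega> u x\<bar> powr p) \<le>
      2 powr p * ((t - 1) powr p * (2 powr p * (Z + R powr p * \<beta> k)) + 2 powr p * (\<alpha> k / t ^ DIM('a) + \<alpha> k))" for k
  proof -
    have "(LINT x|lebesgue. \<bar>zero_ext \<Omega> u (dil a t x) - zero_ext \<Omega> u x\<bar> powr p) \<le>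
      (LINT x|lebesgue. 2 powr p * (norm (\<phi> k (dil a t x) - \<phi> k x) powr p + 2 powr p * (norm (e k (dil a t x)) powr p + norm (e k x) powr p)))"
    proof (rule integral_mono)
      show "integrable lebesgue (\<lambda>x. \<bar>zero_ext \<Omega> u (dil a t x) - zero_ext \<Omega> u x\<bar> powr p)"
        using int[OF ud] by simp
      show "integrable lebesgue (\<lambda>x. 2 powr p * (norm (\<phi> k (dil a t x) - \<phi> k x) powr p + 2 powr p * (norm (e k (dil a t x)) powr p + norm (e k x) powr p)))"
        using int[OF pd, of k] int[OF eL, of k] int[OF edL(1), of k] by (intro integrable_mult_right integrable_add) auto
      fix x
      have "\<bar>zero_ext \<Omega> u (dil a t x) - zero_ext \<Omega> u x\<bar> powr p = norm ((\<phi> k (dil a t x) - \<phi> k x) + (e k (dil a t x) + - e k x)) powr p"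
        by (simp add: e_def)
      also have "\<dots> \<le> 2 powr p * (norm (\<phi> k (dil a t x) - \<phi> k x) powr p + norm (e k (dil a t x) + - e k x) powr p)"
        by (rule powr_norm_add_le[OF p0(1)])
      also have "\<dots> \<le> 2 powr p * (norm (\<phi> k (dil a t x) - \<phi> k x) powr p + 2 powr p * (norm (e k (dil a t x)) powr p + norm (- e k x) powr p))"
        using powr_norm_add_le[OF p0(1), of "e k (dil a t x)" "- e k x"] by (intro mult_left_mono add_left_mono) auto
      finally show "\<bar>zero_ext \<Omega> u (dil a t x) - zero_ext \<Omega> u x\<bar> powr p \<le> 2 powr p * (norm (\<phi> k (dil a t x) - \<phi> k x) powr p + 2 powr p * (norm (e k (dil a t x)) powr p + norm (e k x) powr p))"
        by simp
    qed
    also have "\<dots> = 2 powr p * ((LINT x|lebesgue. norm (\<phi> k (dil a t x) - \<phi> k x) powr p)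
        + 2 powr p * ((LINT x|lebesgue. norm (e k (dil a t x)) powr p) + (LINT x|lebesgue. norm (e k x) powr p)))"
    proof -
      note i = int[OF pd, of k] int[OF edL(1), of k] int[OF eL, of k]
      show ?thesis
        by (simp only: Bochner_Integration.integral_add[OF i(1)] Bochner_Integration.integral_add[OF i(2,3)]
          integral_mult_right_zero integrable_mult_right Bochner_Integration.integrable_add[OF i(2,3)])
    qed
    also have "\<dots> = 2 powr p * ((LINT x|lebesgue. norm (\<phi> k (dil a t x) - \<phi> k x) powr p) + 2 powr p * (\<alpha> k / t ^ DIM('a) + \<alpha> k))"
      using edL(2)[of k] ea[of k] by simp
    also have "\<dots> \<le> 2 powr p * ((t - 1) powr p * (2 powr p * (Z + R powr p * \<beta> k)) + 2 powr p * (\<alpha> k / t ^ DIM('a) + \<alpha> k))"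
    proof (intro mult_left_mono add_right_mono)
      have "(LINT x|lebesgue. norm (\<phi> k (dil a t x) - \<phi> k x) powr p) \<le> (t - 1) powr p * (LINT x|lebesgue. norm (grad (\<phi> k) x) powr p * norm (x - a) powr p)"
        using test_function_dil_difference[OF tf t p] by simp
      also have "\<dots> \<le> (t - 1) powr p * (2 powr p * (Z + R powr p * \<beta> k))"
      proof (rule mult_left_mono)
        have "(LINT x|lebesgue. norm (grad (\<phi> k) x) powr p * norm (x - a) powr p) \<le>
           (LINT x|lebesgue. 2 powr p * (norm (zero_ext \<Omega> v x) powr p * norm (x - a) powr p + norm (E k x) powr p * norm (x - a) powr p))"
        proof (rule integral_mono)
          fix x
          have "norm (zero_ext \<Omega> v x + E k x) powr p \<le> 2 powr p * (norm (zero_ext \<Omega> v x) powr p + norm (E k x) powr p)"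
            by (rule powr_norm_add_le[OF p0(1)])
          from mult_right_mono[OF this, of "norm (x - a) powr p"]
          show "norm (grad (\<phi> k) x) powr p * norm (x - a) powr p \<le>
            2 powr p * (norm (zero_ext \<Omega> v x) powr p * norm (x - a) powr p + norm (E k x) powr p * norm (x - a) powr p)"
            by (simp add: E_def algebra_simps)
        qed (use gi(1) vi(1) Ei(1) in auto)
        also have "\<dots> = 2 powr p * (Z + (LINT x|lebesgue. norm (E k x) powr p * norm (x - a) powr p))"
          using vi(1) Ei(1)[of k] by (simp add: Z_def)
        also have "\<dots> \<le> 2 powr p * (Z + R powr p * \<beta> k)"
          using Ei(2)[of k] by (intro mult_left_mono add_left_mono) (auto simp: \<beta>_def E_def mult.commute)
        finally show "(LINT x|lebesgue. norm (grad (\<phi> k) x) powr p * norm (x - a) powr p) \<le> 2 powr p * (Z + R powr p * \<beta> k)" .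
      qed simp
      finally show "(LINT x|lebesgue. norm (\<phi> k (dil a t x) - \<phi> k x) powr p) \<le> (t - 1) powr p * (2 powr p * (Z + R powr p * \<beta> k))" .
    qed simp
    finally show ?thesis .
  qed
  have lim\<alpha>: "\<alpha> \<longlonglongrightarrow> 0" and lim\<beta>: "\<beta> \<longlonglongrightarrow> 0"
    using W0_approx_ext[OF W \<Omega>] by (simp_all add: \<alpha>_def[abs_def] \<beta>_def[abs_def])
  have "(\<lambda>k. 2 powr p * ((t - 1) powr p * (2 powr p * (Z + R powr p * \<beta> k)) + 2 powr p * (\<alpha> k / t ^ DIM('a) + \<alpha> k))) \<longlonglongrightarrow>
     2 powr p * ((t - 1) powr p * (2 powr p * (Z + R powr p * 0)) + 2 powr p * (0 / t ^ DIM('a) + 0))"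
    using t0 by (intro tendsto_intros lim\<alpha> lim\<beta>) auto
  then have "(LINT x|lebesgue. \<bar>zero_ext \<Omega> u (dil a t x) - zero_ext \<Omega> u x\<bar> powr p) \<le>
      2 powr p * ((t - 1) powr p * (2 powr p * (Z + R powr p * 0)) + 2 powr p * (0 / t ^ DIM('a) + 0))"
    by (rule LIMSEQ_le_const) (use main in blast)
  also have "\<dots> = (2 * 2) powr p * (t - 1) powr p * Z"
    unfolding powr_mult by simp
  finally show ?thesis by (simp add: Z_def)
qed

section \<open>Pointwise estimates\<close>

text \<open>The form evaluated at r\<xi> + \<eta> is a nonnegative quadratic polynomial in r, hence
  has nonpositive discriminant. The form may be degenerate, so the leading coefficient a = 0 is a
  separate case.\<close>

lemma psd_Cauchy_Schwarz:
  fixes M :: "real^'n^'n"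
  assumes sym: "transpose M = M" and psd: "\<And>\<xi>. 0 \<le> (M *v \<xi>) \<bullet> \<xi>"
  shows "(M *v \<xi>) \<bullet> \<eta> \<le> sqrt ((M *v \<xi>) \<bullet> \<xi>) * sqrt ((M *v \<eta>) \<bullet> \<eta>)"
proof -
  define a where "a = (M *v \<xi>) \<bullet> \<xi>"
  define b where "b = (M *v \<xi>) \<bullet> \<eta>"
  define c where "c = (M *v \<eta>) \<bullet> \<eta>"
  have symb: "(M *v \<eta>) \<bullet> \<xi> = b"
    using dot_lmul_matrix[of \<eta> M \<xi>] sym by (metis b_def dot_lmul_matrix inner_commute transpose_matrix_vector)
  have q: "0 \<le> r\<^sup>2 * a + 2 * r * b + c" for r
  proof -
    have "(M *v (r *\<^sub>R \<xi> + \<eta>)) \<bullet> (r *\<^sub>R \<xi> + \<eta>) = r\<^sup>2 * a + 2 * r * b + c"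
      by (simp add: matrix_vector_right_distrib matrix_vector_mult_scaleR inner_add_left inner_add_right
        symb flip: a_def b_def c_def) (simp add: power2_eq_square algebra_simps)
    then show ?thesis using psd[of "r *\<^sub>R \<xi> + \<eta>"] by simp
  qed
  have ac: "a \<ge> 0" "c \<ge> 0" using psd by (simp_all add: a_def c_def)
  have "b\<^sup>2 \<le> a * c"
  proof (cases "a = 0")
    case True
    have "b = 0"
    proof (rule ccontr)
      assume "b \<noteq> 0"
      \<comment> \<open>For a = 0 the polynomial is 2rb + c, and this r gives it the value
        -1.\<close>
      then show False using q[of "- (c + 1) / (2 * b)"] True by (simp add: field_simps)
    qed
    then show ?thesis using True by simp
  next
    case False
    then have "0 \<le> a * ((b / a)\<^sup>2 * a + 2 * (- b / a) * b + c)"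
      using q[of "- b / a"] ac by simp
    also have "\<dots> = a * c - b\<^sup>2" using False by (simp add: field_simps power2_eq_square)
    finally show ?thesis by simp
  qed
  then have "b \<le> sqrt (a * c)" by (rule real_le_rsqrt)
  then show ?thesis by (simp add: real_sqrt_mult a_def b_def c_def)
qed

lemma sqrt_powr: "x \<ge> 0 \<Longrightarrow> sqrt x powr r = x powr (r / 2)" for x r :: real
  by (simp add: powr_half_sqrt[symmetric] powr_powr)

text \<open>The function is the p-th power of the seminorm given by \<open>M\<close>. Cauchy-Schwarz
  bounds the mixed term, which reduces the claim to the scalar tangent line at the square root of
  the form. Where the form vanishes at \<xi>, the convention that 0 powr anything is 0 removes the
  linear term, so 1 < p < 2 is covered.\<close>

lemma quadratic_form_powr_convex:
  fixes M :: "real^'n^'n"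
  assumes sym: "transpose M = M" and psd: "\<And>\<xi>. 0 \<le> (M *v \<xi>) \<bullet> \<xi>" and p: "p > 1"
  shows "((M *v \<xi>) \<bullet> \<xi>) powr (p / 2) + p * (((M *v \<xi>) \<bullet> \<xi>) powr ((p - 2) / 2) * ((M *v \<xi>) \<bullet> (\<eta> - \<xi>)))
    \<le> ((M *v \<eta>) \<bullet> \<eta>) powr (p / 2)"
proof -
  define a where "a = (M *v \<xi>) \<bullet> \<xi>"
  define b where "b = (M *v \<xi>) \<bullet> \<eta>"
  define c where "c = (M *v \<eta>) \<bullet> \<eta>"
  have ac: "a \<ge> 0" "c \<ge> 0" using psd by (simp_all add: a_def c_def)
  have "a powr ((p - 2) / 2) * (b - a) \<le> sqrt a powr (p - 1) * (sqrt c - sqrt a)"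
  proof (cases "a = 0")
    case False
    have "b \<le> sqrt a * sqrt c"
      using psd_Cauchy_Schwarz[OF sym psd, of \<xi> \<eta>] by (simp add: a_def b_def c_def)
    then have "a powr ((p - 2) / 2) * (b - a) \<le> a powr ((p - 2) / 2) * (sqrt a * (sqrt c - sqrt a))"
      using ac by (intro mult_left_mono) (auto simp: algebra_simps)
    also have "\<dots> = (sqrt a powr (p - 2) * sqrt a powr 1) * (sqrt c - sqrt a)"
      using ac sqrt_powr by simp
    also have "\<dots> = sqrt a powr (p - 1) * (sqrt c - sqrt a)"
      by (simp only: powr_add[symmetric]) simp
    finally show ?thesis .
  qed (use p in simp)
  then have "p * (a powr ((p - 2) / 2) * (b - a)) \<le> p * (sqrt a powr (p - 1) * (sqrt c - sqrt a))"
    using p by (intro mult_left_mono) auto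
  then have "a powr (p / 2) + p * (a powr ((p - 2) / 2) * (b - a)) \<le> c powr (p / 2)"
    using powr_tangent_line[OF p, of "sqrt a" "sqrt c"] ac by (simp add: sqrt_powr)
  then show ?thesis by (simp add: a_def b_def c_def inner_diff_right)
qed

text \<open>This is the integrated form of the differential lower bound along the segment from
  \<open>dil x\<^sub>0 s y\<close> to \<open>y\<close>. As s > 0 the segment avoids
  \<open>x\<^sub>0\<close>, where \<open>A\<close> need not be differentiable; \<xi> \<noteq> 0
  keeps the form positive, so its power is differentiable.\<close>

lemma radial_growth:
  fixes A :: "real^'n \<Rightarrow> real^'n^'n"
  assumes p: "p > 1" and star: "star_shaped_wrt x\<^sub>0 \<Omega>"
    and diff: "\<And>x i j. x \<in> \<Omega> - {x\<^sub>0} \<Longrightarrow> (\<lambda>x. A x $ i $ j) differentiable (at x)"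
    and pos: "\<And>x \<xi>. x \<in> \<Omega> \<Longrightarrow> \<xi> \<noteq> 0 \<Longrightarrow> 0 < (A x *v \<xi>) \<bullet> \<xi>"
    and const: "0 < \<gamma>"
    and lower: "\<And>x \<xi>. x \<in> \<Omega> \<Longrightarrow>
      radial_derivative A p x\<^sub>0 x \<xi> \<ge> \<gamma> * C\<^sub>0 * norm (x - x\<^sub>0) powr \<gamma> * norm \<xi> powr p"
    and y: "y \<in> \<Omega>" "y \<noteq> x\<^sub>0" and s: "0 < s" "s \<le> 1"
  shows "((A (dil x\<^sub>0 s y) *v \<xi>) \<bullet> \<xi>) powr (p / 2) + C\<^sub>0 * (1 - s powr \<gamma>) * (norm (y - x\<^sub>0) powr \<gamma> * norm \<xi> powr p)
    \<le> ((A y *v \<xi>) \<bullet> \<xi>) powr (p / 2)"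
proof (cases "\<xi> = 0")
  case True
  then show ?thesis using p by simp
next
  case False
  define q where "q x = (A x *v \<xi>) \<bullet> \<xi>" for x
  define N where "N x = q x powr (p / 2)" for x
  define k where "k = C\<^sub>0 * (norm (y - x\<^sub>0) powr \<gamma> * norm \<xi> powr p)"
  have Nd: "N differentiable (at x)" if x: "x \<in> \<Omega> - {x\<^sub>0}" for x
  proof -
    have "q x > 0" using pos x False by (simp add: q_def)
    have "q = (\<lambda>x. \<Sum>i\<in>UNIV. (\<Sum>j\<in>UNIV. A x $ i $ j * \<xi> $ j) * \<xi> $ i)"
      by (simp add: q_def fun_eq_iff matrix_vector_mult_def inner_vec_def)
    then have "q differentiable (at x)"
      using diff[OF x] by (auto intro!: differentiable_sum differentiable_mult)
    then obtain D where "(q has_derivative D) (at x)" by (auto simp: differentiable_def)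
    from has_derivative_powr[OF this has_derivative_const[of "p / 2"] \<open>q x > 0\<close>]
    show ?thesis unfolding N_def[abs_def] differentiable_def by blast
  qed
  \<comment> \<open>At distance factor r the lower bound carries r^\<gamma>; the chain rule divides
    by r, and \<gamma> r^(\<gamma> - 1) is the derivative of r^\<gamma>. Subtracting
    \<open>k * r powr \<gamma>\<close> therefore leaves a nondecreasing function.\<close>
  define g where "g r = N (dil x\<^sub>0 r y) - k * r powr \<gamma>" for r
  have "g s \<le> g 1"
  proof (rule DERIV_nonneg_imp_nondecreasing[OF s(2)])
    fix r assume r: "s \<le> r" "r \<le> 1"
    define z where "z = dil x\<^sub>0 r y"
    have r0: "r > 0" using r s by simp
    have z: "z \<in> \<Omega> - {x\<^sub>0}"
      using star_shaped_wrt_dil[OF star y(1), of r] r r0 y by (auto simp: z_def dil_def)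
    have d: "((\<lambda>r. dil x\<^sub>0 r y) has_derivative (\<lambda>h. h *\<^sub>R (y - x\<^sub>0))) (at r)"
      unfolding dil_def[abs_def] by (auto intro!: derivative_eq_intros)
    have "GDERIV N z :> grad N z" using Nd[OF z] by (rule gderiv_grad)
    then have "((\<lambda>r. N (dil x\<^sub>0 r y)) has_derivative (\<lambda>h. (h *\<^sub>R (y - x\<^sub>0)) \<bullet> grad N z)) (at r)"
      using has_derivative_compose[OF d, of N "\<lambda>h. h \<bullet> grad N z"] by (simp add: gderiv_def z_def)
    then have "DERIV (\<lambda>r. N (dil x\<^sub>0 r y)) r :> (y - x\<^sub>0) \<bullet> grad N z"
      by (simp add: has_field_derivative_def mult_commute_abs)
    moreover have "DERIV (\<lambda>r. k * r powr \<gamma>) r :> k * (\<gamma> * r powr (\<gamma> - 1))"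
      using r0 by (auto intro!: derivative_eq_intros)
    ultimately have D: "DERIV g r :> (y - x\<^sub>0) \<bullet> grad N z - k * (\<gamma> * r powr (\<gamma> - 1))"
      unfolding g_def[abs_def] by (rule DERIV_diff)
    have zr: "z - x\<^sub>0 = r *\<^sub>R (y - x\<^sub>0)" by (simp add: z_def dil_def)
    have "radial_derivative A p x\<^sub>0 z \<xi> = (z - x\<^sub>0) \<bullet> grad N z"
      using z by (simp add: radial_derivative_def N_def[abs_def] q_def)
    also have "\<dots> = r * ((y - x\<^sub>0) \<bullet> grad N z)" by (simp add: zr)
    finally have "r * ((y - x\<^sub>0) \<bullet> grad N z) \<ge> \<gamma> * C\<^sub>0 * norm (z - x\<^sub>0) powr \<gamma> * norm \<xi> powr p"
      using lower[of z \<xi>] z by simp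
    also have "norm (z - x\<^sub>0) powr \<gamma> = r * r powr (\<gamma> - 1) * norm (y - x\<^sub>0) powr \<gamma>"
      using r0 by (simp add: zr powr_mult powr_diff)
    finally have "r * (k * (\<gamma> * r powr (\<gamma> - 1))) \<le> r * ((y - x\<^sub>0) \<bullet> grad N z)"
      by (simp add: k_def mult_ac)
    then have "(y - x\<^sub>0) \<bullet> grad N z - k * (\<gamma> * r powr (\<gamma> - 1)) \<ge> 0"
      using r0 by (simp add: mult_le_cancel_left)
    then show "\<exists>y. DERIV g r :> y \<and> y \<ge> 0" using D by blast
  qed
  then show ?thesis by (simp add: g_def N_def q_def k_def algebra_simps)
qed

section \<open>First-order expansions and homogeneous functions\<close>

lemma Ck_1_MVT:
  fixes \<Phi> :: "'a::euclidean_space \<Rightarrow> real"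
  assumes "Ck 1 \<Phi>"
  obtains r where "0 < r" "r < 1" "\<Phi> y - \<Phi> x = grad \<Phi> (x + r *\<^sub>R (y - x)) \<bullet> (y - x)"
proof -
  have D: "DERIV (\<lambda>r. \<Phi> (x + r *\<^sub>R (y - x))) r :> grad \<Phi> (x + r *\<^sub>R (y - x)) \<bullet> (y - x)" for r
  proof -
    have d: "((\<lambda>r. x + r *\<^sub>R (y - x)) has_derivative (\<lambda>h. h *\<^sub>R (y - x))) (at r)"
      by (auto intro!: derivative_eq_intros)
    have "((\<lambda>r. \<Phi> (x + r *\<^sub>R (y - x))) has_derivative (\<lambda>h. (h *\<^sub>R (y - x)) \<bullet> grad \<Phi> (x + r *\<^sub>R (y - x)))) (at r)"
      using has_derivative_compose[OF d Ck_1_gderiv[OF assms, unfolded gderiv_def]] by simp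
    then show ?thesis by (simp add: has_field_derivative_def mult_commute_abs inner_commute)
  qed
  obtain r where "0 < r" "r < 1"
    "\<Phi> (x + 1 *\<^sub>R (y - x)) - \<Phi> (x + 0 *\<^sub>R (y - x)) = (1 - 0) * (grad \<Phi> (x + r *\<^sub>R (y - x)) \<bullet> (y - x))"
    using MVT2[of 0 1 "\<lambda>r. \<Phi> (x + r *\<^sub>R (y - x))", OF _ D] by auto
  then show ?thesis using that by simp
qed

text \<open>At distances below d, uniform continuity of the gradient on the ball gives the term with
  \<epsilon>. At distances of at least d, the crude bound 2B |y - x| is absorbed into the p-th power
  because |y - x|^(1 - p) \<le> d^(1 - p). A p-th power is the error that the difference estimate
  controls.\<close>

lemma Ck_1_Taylor_bounded:
  fixes \<Phi> :: "'a::euclidean_space \<Rightarrow> real"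
  assumes \<Phi>: "Ck 1 \<Phi>" and e: "\<epsilon> > 0" and p: "p \<ge> 1"
  obtains C where "C \<ge> 0"
    "\<And>x y. norm x \<le> M \<Longrightarrow> norm y \<le> M \<Longrightarrow>
      \<bar>\<Phi> y - \<Phi> x - grad \<Phi> x \<bullet> (y - x)\<bar> \<le> \<epsilon> * norm (y - x) + C * norm (y - x) powr p"
proof -
  have gc: "continuous_on (cball 0 M) (grad \<Phi>)"
    using Ck_1_continuous_grad[OF \<Phi>] continuous_on_subset by blast
  then have "uniformly_continuous_on (cball 0 M) (grad \<Phi>)"
    by (rule compact_uniformly_continuous) simp
  then obtain d where d: "d > 0" "\<And>x y. x \<in> cball 0 M \<Longrightarrow> y \<in> cball 0 M \<Longrightarrow> dist y x < d \<Longrightarrow> dist (grad \<Phi> y) (grad \<Phi> x) < \<epsilon>"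
    using e unfolding uniformly_continuous_on_def by metis
  have "bounded (grad \<Phi> ` cball 0 M)"
    using gc by (intro compact_imp_bounded compact_continuous_image) auto
  then obtain B where B: "B > 0" "\<And>x. x \<in> cball 0 M \<Longrightarrow> norm (grad \<Phi> x) \<le> B"
    by (auto simp: bounded_pos)
  define C where "C = 2 * B * d powr (1 - p)"
  have C: "C \<ge> 0" using B by (simp add: C_def)
  show ?thesis
  proof (rule that[OF C])
    fix x y :: 'a assume xy: "norm x \<le> M" "norm y \<le> M"
    obtain r where r: "0 < r" "r < 1" "\<Phi> y - \<Phi> x = grad \<Phi> (x + r *\<^sub>R (y - x)) \<bullet> (y - x)"
      using Ck_1_MVT[OF \<Phi>] by metis
    define z where "z = x + r *\<^sub>R (y - x)"
    have zi: "z \<in> cball 0 M"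
    proof -
      have "(1 - r) *\<^sub>R x + r *\<^sub>R y \<in> cball 0 M"
        using xy r by (intro convexD[OF convex_cball]) auto
      then show ?thesis by (simp add: z_def algebra_simps)
    qed
    have "\<Phi> y - \<Phi> x - grad \<Phi> x \<bullet> (y - x) = (grad \<Phi> z - grad \<Phi> x) \<bullet> (y - x)"
      by (simp add: r(3) z_def inner_diff_left)
    then have *: "\<bar>\<Phi> y - \<Phi> x - grad \<Phi> x \<bullet> (y - x)\<bar> \<le> norm (grad \<Phi> z - grad \<Phi> x) * norm (y - x)"
      using Cauchy_Schwarz_ineq2 by metis
    have nn: "\<epsilon> * norm (y - x) \<ge> 0" "C * norm (y - x) powr p \<ge> 0" using e C by auto
    show "\<bar>\<Phi> y - \<Phi> x - grad \<Phi> x \<bullet> (y - x)\<bar> \<le> \<epsilon> * norm (y - x) + C * norm (y - x) powr p"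
    proof (cases "norm (y - x) < d")
      case True
      have "norm (z - x) \<le> norm (y - x)" using r by (simp add: z_def mult_left_le_one_le)
      then have "norm (grad \<Phi> z - grad \<Phi> x) < \<epsilon>"
        using d(2)[of x z] zi xy True by (simp add: dist_norm)
      then have "norm (grad \<Phi> z - grad \<Phi> x) * norm (y - x) \<le> \<epsilon> * norm (y - x)"
        by (intro mult_right_mono) auto
      then show ?thesis using * nn by linarith
    next
      case False
      have "norm (grad \<Phi> z - grad \<Phi> x) \<le> 2 * B"
        using B(2)[OF zi] B(2)[of x] xy norm_triangle_ineq4[of "grad \<Phi> z" "grad \<Phi> x"] by simp
      then have "norm (grad \<Phi> z - grad \<Phi> x) * norm (y - x) \<le> 2 * B * norm (y - x)"
        by (intro mult_right_mono) auto
      also have "2 * B * norm (y - x) = 2 * B * (norm (y - x) powr (1 - p) * norm (y - x) powr p)"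
        using False d(1) by (simp flip: powr_add)
      also have "2 * B * (norm (y - x) powr (1 - p) * norm (y - x) powr p) \<le> 2 * B * (d powr (1 - p) * norm (y - x) powr p)"
        using False B d p by (intro mult_left_mono mult_right_mono powr_mono2') auto
      finally have "norm (grad \<Phi> z - grad \<Phi> x) * norm (y - x) \<le> C * norm (y - x) powr p" by (simp add: C_def)
      then show ?thesis using * nn by linarith
    qed
  qed
qed

lemma homogeneous_zero:
  assumes "homogeneous q H" "q > 0"
  shows "H 0 = 0"
proof -
  have "H (2 *\<^sub>R 0) = 2 powr q * H 0"
    using assms(1) unfolding homogeneous_def by (metis zero_less_numeral)
  then have "(2 powr q - 1) * H 0 = 0" by (simp add: algebra_simps)
  moreover have "(2::real) powr q > 1" using assms(2) by simp
  ultimately show ?thesis using assms(2) by auto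
qed

text \<open>The function r -> H(r s) is differentiated at 1 twice, by the chain rule and as r^q
  H(s). The two expressions agree only for r > 0, hence the passage to functions equal near
  1.\<close>

lemma Euler_homogeneous:
  fixes H :: "'a::euclidean_space \<Rightarrow> real"
  assumes H: "Ck 1 H" "homogeneous q H"
  shows "grad H s \<bullet> s = q * H s"
proof -
  have "((\<lambda>r. H (r *\<^sub>R s)) has_derivative (\<lambda>h. (h *\<^sub>R s) \<bullet> grad H (1 *\<^sub>R s))) (at 1)"
    by (rule has_derivative_compose[where g = H, OF _ Ck_1_gderiv[OF H(1), unfolded gderiv_def]])
       (auto intro!: derivative_eq_intros)
  then have "DERIV (\<lambda>r. H (r *\<^sub>R s)) 1 :> grad H s \<bullet> s"
    by (simp add: has_field_derivative_def mult_commute_abs inner_commute)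
  moreover have "DERIV (\<lambda>r. r powr q * H s) 1 :> q * H s"
    by (auto intro!: derivative_eq_intros)
  then have "DERIV (\<lambda>r. H (r *\<^sub>R s)) 1 :> q * H s"
    by (rule DERIV_cong_ev[THEN iffD1, rotated 3])
       (use H(2) in \<open>auto simp: homogeneous_def intro!: eventually_mono[OF eventually_gt_at_top[of 0]] eventually_nhds_in_open[of "{0<..}", THEN eventually_mono]\<close>)
  ultimately show ?thesis by (rule DERIV_unique)
qed

text \<open>The \<open>GREATEST\<close> in \<open>M_max\<close> has content because the p-unit
  sphere is compact and the maximum is attained. A nonzero \<open>s\<close> is scaled to that sphere
  by T^(-1/p), and homogeneity restores the factor T.\<close>

lemma homogeneous_le_M_max:
  fixes F :: "real^'d \<Rightarrow> real"
  assumes F: "continuous_on UNIV F" "homogeneous p F" and p: "p > 0"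
  shows "F s \<le> M_max p F * (\<Sum>j\<in>UNIV. \<bar>s $ j\<bar> powr p)"
proof (cases "s = 0")
  case True
  then show ?thesis using homogeneous_zero[OF F(2) p] p by simp
next
  case False
  define S where "S = {s :: real^'d. (\<Sum>j\<in>UNIV. \<bar>s $ j\<bar> powr p) = 1}"
  have "closed S"
    unfolding S_def using p
    by (intro closed_Collect_eq continuous_on_sum continuous_on_powr' continuous_on_rabs continuous_on_const
      continuous_on_component continuous_on_id) auto
  moreover have "bounded S"
  proof -
    have "norm s \<le> real CARD('d)" if "s \<in> S" for s
    proof -
      have "\<bar>s $ j\<bar> \<le> 1" for j
      proof (rule ccontr)
        assume "\<not> \<bar>s $ j\<bar> \<le> 1"
        then have "1 < \<bar>s $ j\<bar> powr p" using p by simp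
        also have "\<dots> \<le> (\<Sum>j\<in>UNIV. \<bar>s $ j\<bar> powr p)" by (rule member_le_sum) auto
        finally show False using that by (simp add: S_def)
      qed
      then have "(\<Sum>j\<in>UNIV. \<bar>s $ j\<bar>) \<le> real CARD('d)"
        using sum_bounded_above[of UNIV "\<lambda>j. \<bar>s $ j\<bar>" 1] by simp
      then show ?thesis using norm_le_l1_cart[of s] by linarith
    qed
    then show ?thesis by (auto simp: bounded_iff)
  qed
  ultimately have S: "compact S" by (simp add: compact_eq_bounded_closed)
  define T where "T = (\<Sum>j\<in>UNIV. \<bar>s $ j\<bar> powr p)"
  define c where "c = T powr (1 / p)"
  obtain i where "s $ i \<noteq> 0" using False by (auto simp: vec_eq_iff)
  then have "0 < \<bar>s $ i\<bar> powr p" by simp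
  also have "\<dots> \<le> T" unfolding T_def by (rule member_le_sum) auto
  finally have T: "T > 0" .
  then have c: "c > 0" "c powr p = T" using p by (simp_all add: c_def powr_powr)
  have sc: "(1 / c) *\<^sub>R s \<in> S"
  proof -
    have "\<bar>((1 / c) *\<^sub>R s) $ j\<bar> powr p = \<bar>s $ j\<bar> powr p / T" for j
      using c by (simp add: abs_mult powr_mult powr_divide)
    then show ?thesis using T by (simp add: S_def T_def flip: sum_divide_distrib)
  qed
  obtain m where m: "m \<in> S" "\<And>s. s \<in> S \<Longrightarrow> F s \<le> F m"
    using continuous_attains_sup[OF S _ continuous_on_subset[OF F(1)]] sc by auto
  have "M_max p F = F m"
    unfolding M_max_def using m by (intro Greatest_equality) (auto simp: S_def)
  then have "F ((1 / c) *\<^sub>R s) \<le> M_max p F" using m(2)[OF sc] by simp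
  moreover have "F s = T * F ((1 / c) *\<^sub>R s)"
  proof -
    have "F (c *\<^sub>R (1 / c) *\<^sub>R s) = c powr p * F ((1 / c) *\<^sub>R s)"
      using F(2) c(1) unfolding homogeneous_def by blast
    then show ?thesis using c by simp
  qed
  ultimately show ?thesis using T by (simp add: T_def[symmetric] mult.commute)
qed

section \<open>The energy functional and the Pohozaev inequality\<close>

lemma norm_powr_le_sum:
  fixes s :: "real^'d"
  assumes "p > 0"
  shows "norm s powr p \<le> real CARD('d) powr p * (\<Sum>j\<in>UNIV. \<bar>s $ j\<bar> powr p)"
proof -
  have "Max (range (\<lambda>j. \<bar>s $ j\<bar>)) \<in> range (\<lambda>j. \<bar>s $ j\<bar>)" by (rule Max_in) auto
  then obtain i where i: "Max (range (\<lambda>j. \<bar>s $ j\<bar>)) = \<bar>s $ i\<bar>" by (rule imageE)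
  have "norm s \<le> (\<Sum>j\<in>UNIV. \<bar>s $ j\<bar>)" by (rule norm_le_l1_cart)
  also have "\<dots> \<le> real CARD('d) * \<bar>s $ i\<bar>"
    using sum_bounded_above[of UNIV "\<lambda>j. \<bar>s $ j\<bar>" "\<bar>s $ i\<bar>"] by (simp flip: i)
  finally have "norm s powr p \<le> (real CARD('d) * \<bar>s $ i\<bar>) powr p"
    using assms by (intro powr_mono2) auto
  also have "\<dots> = real CARD('d) powr p * \<bar>s $ i\<bar> powr p" by (simp add: powr_mult)
  also have "\<dots> \<le> real CARD('d) powr p * (\<Sum>j\<in>UNIV. \<bar>s $ j\<bar> powr p)"
    by (intro mult_left_mono member_le_sum) auto
  finally show ?thesis .
qed

lemma borel_measurable_vec_nth_comp:
  "f \<in> borel_measurable M \<Longrightarrow> (\<lambda>x. f x $ i) \<in> borel_measurable M" for f :: "'a \<Rightarrow> real^'n"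
  by (rule measurable_compose[OF _ borel_measurable_continuous_onI]) (auto intro: continuous_on_component continuous_on_id)

lemma borel_measurable_quadratic:
  fixes B :: "real^'n \<Rightarrow> real^'n^'n"
  assumes B: "continuous_on S B" and S: "S \<in> sets lebesgue"
    and U: "U \<in> borel_measurable (lebesgue_on S)" "V \<in> borel_measurable (lebesgue_on S)"
  shows "(\<lambda>x. (B x *v U x) \<bullet> V x) \<in> borel_measurable (lebesgue_on S)"
proof -
  have "(\<lambda>x. B x $ i $ j) \<in> borel_measurable (lebesgue_on S)" for i j
    by (rule continuous_imp_measurable_on_sets_lebesgue[OF _ S]) (intro continuous_on_component B)
  then show ?thesis
    unfolding matrix_vector_mult_def inner_vec_def inner_real_def vec_lambda_beta
    by (intro borel_measurable_sum borel_measurable_times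
        borel_measurable_vec_nth_comp[OF U(1)] borel_measurable_vec_nth_comp[OF U(2)])
qed

lemma powr_slope_at_right_0: "((\<lambda>h::real. ((1 + h) powr a - 1) / h) \<longlongrightarrow> a) (at_right 0)"
proof -
  have "DERIV (\<lambda>h::real. (1 + h) powr a) 0 :> a"
    by (auto intro!: derivative_eq_intros)
  then have "((\<lambda>h::real. ((1 + h) powr a - 1) / h) \<longlongrightarrow> a) (at 0)"
    by (simp add: has_field_derivative_iff)
  then show ?thesis by (rule filterlim_mono) (auto intro: at_le)
qed

text \<open>The data of the operator are collected apart from any solution, so that the energy
  lemmas apply alike to the gradients of a solution and to those of its dilates.\<close>

locale dirichlet_form =
  fixes \<Omega> :: "(real^'n) set" and x\<^sub>0 :: "real^'n" and A :: "real^'n \<Rightarrow> real^'n^'n"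
    and p \<gamma> C\<^sub>0 :: real
  assumes p: "1 < p"
    and open_\<Omega>: "open \<Omega>" and bounded_\<Omega>: "bounded \<Omega>"
    and star: "star_shaped_wrt x\<^sub>0 \<Omega>"
    and A_cont: "continuous_on (closure \<Omega>) A"
    and A_diff: "\<And>x i j. x \<in> \<Omega> - {x\<^sub>0} \<Longrightarrow> (\<lambda>x. A x $ i $ j) differentiable (at x)"
    and A_sym: "\<And>x. x \<in> \<Omega> \<Longrightarrow> transpose (A x) = A x"
    and A_pos: "\<And>x \<xi>. x \<in> \<Omega> \<Longrightarrow> \<xi> \<noteq> 0 \<Longrightarrow> 0 < (A x *v \<xi>) \<bullet> \<xi>"
    and const: "0 < \<gamma>"
    and lower: "\<And>x \<xi>. x \<in> \<Omega> \<Longrightarrow>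
      radial_derivative A p x\<^sub>0 x \<xi> \<ge> \<gamma> * C\<^sub>0 * norm (x - x\<^sub>0) powr \<gamma> * norm \<xi> powr p"
begin

text \<open>The p-th power of the length of \<xi> in the metric given by \<open>A x\<close>. Its
  integral over gradients is p times the energy whose first variation is the weak form of the
  operator.\<close>

definition N :: "real^'n \<Rightarrow> real^'n \<Rightarrow> real" where
  "N x \<xi> = ((A x *v \<xi>) \<bullet> \<xi>) powr (p / 2)"

lemma A_psd: "x \<in> \<Omega> \<Longrightarrow> 0 \<le> (A x *v \<xi>) \<bullet> \<xi>"
  using A_pos[of x \<xi>] by (cases "\<xi> = 0") auto

lemma N_nonneg: "0 \<le> N x \<xi>" by (simp add: N_def)

lemma N_zero [simp]: "N x 0 = 0" by (simp add: N_def)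

lemma N_scaleR: "x \<in> \<Omega> \<Longrightarrow> t > 0 \<Longrightarrow> N x (t *\<^sub>R \<xi>) = t powr p * N x \<xi>"
proof -
  assume "x \<in> \<Omega>" "t > 0"
  have "(A x *v (t *\<^sub>R \<xi>)) \<bullet> (t *\<^sub>R \<xi>) = t\<^sup>2 * ((A x *v \<xi>) \<bullet> \<xi>)"
    by (simp add: matrix_vector_mult_scaleR power2_eq_square)
  moreover have "(t\<^sup>2) powr (p / 2) = t powr p"
    using sqrt_powr[of "t\<^sup>2" p] \<open>t > 0\<close> by simp
  ultimately show ?thesis by (simp add: N_def powr_mult)
qed

lemma \<Omega>_lmeasurable: "\<Omega> \<in> lmeasurable"
  using open_\<Omega> bounded_\<Omega> by (simp add: lmeasurable_open)

lemma \<Omega>_sets [simp]: "\<Omega> \<in> sets lebesgue"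
  using \<Omega>_lmeasurable by blast

lemma A_cont_\<Omega>: "continuous_on \<Omega> A"
  using A_cont closure_subset continuous_on_subset by blast

lemma dil_in_\<Omega>: "x \<in> \<Omega> \<Longrightarrow> 0 < s \<Longrightarrow> s \<le> 1 \<Longrightarrow> dil x\<^sub>0 s x \<in> \<Omega>"
  using star_shaped_wrt_dil[OF star] by simp

lemma A_dil_cont: "0 < s \<Longrightarrow> s \<le> 1 \<Longrightarrow> continuous_on \<Omega> (\<lambda>x. A (dil x\<^sub>0 s x))"
  by (rule continuous_on_compose2[OF A_cont_\<Omega>])
    (auto intro!: continuous_on_dil continuous_on_const continuous_on_id dil_in_\<Omega>)

lemma N_growth: obtains C where "C \<ge> 0" "\<And>x \<xi>. x \<in> \<Omega> \<Longrightarrow> N x \<xi> \<le> C * norm \<xi> powr p"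
proof -
  have "compact (closure \<Omega>)" using bounded_\<Omega> by simp
  then have "bounded (A ` closure \<Omega>)"
    using A_cont by (intro compact_imp_bounded compact_continuous_image)
  then obtain B where B: "B > 0" "\<And>x. x \<in> closure \<Omega> \<Longrightarrow> norm (A x) \<le> B"
    by (auto simp: bounded_pos)
  define C where "C = (real CARD('n) * B) powr (p / 2)"
  show ?thesis
  proof (rule that[of C])
    fix x \<xi> assume x: "x \<in> \<Omega>"
    have Ax: "norm (A x) \<le> B" using B(2) x closure_subset by blast
    have "\<bar>(A x *v \<xi>) $ i\<bar> \<le> B * norm \<xi>" for i
    proof -
      have "\<bar>(A x *v \<xi>) $ i\<bar> \<le> norm (A x $ i) * norm \<xi>"
        unfolding matrix_vector_mul_component by (rule Cauchy_Schwarz_ineq2)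
      also have "\<dots> \<le> B * norm \<xi>"
        using order_trans[OF Finite_Cartesian_Product.norm_nth_le[of "A x" i] Ax] by (intro mult_right_mono) auto
      finally show ?thesis .
    qed
    then have "(\<Sum>i\<in>UNIV. \<bar>(A x *v \<xi>) $ i\<bar>) \<le> real CARD('n) * (B * norm \<xi>)"
      using sum_bounded_above[of UNIV "\<lambda>i. \<bar>(A x *v \<xi>) $ i\<bar>"] by simp
    then have "norm (A x *v \<xi>) \<le> real CARD('n) * (B * norm \<xi>)"
      using norm_le_l1_cart[of "A x *v \<xi>"] by linarith
    then have "norm (A x *v \<xi>) * norm \<xi> \<le> (real CARD('n) * (B * norm \<xi>)) * norm \<xi>"
      by (rule mult_right_mono) simp
    then have "(A x *v \<xi>) \<bullet> \<xi> \<le> (real CARD('n) * B) * (norm \<xi>)\<^sup>2"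
      using norm_cauchy_schwarz[of "A x *v \<xi>" \<xi>] by (simp add: power2_eq_square mult_ac)
    then have "N x \<xi> \<le> ((real CARD('n) * B) * (norm \<xi>)\<^sup>2) powr (p / 2)"
      unfolding N_def using A_psd[OF x] p by (intro powr_mono2) auto
    also have "\<dots> = C * norm \<xi> powr p"
      using sqrt_powr[of "(norm \<xi>)\<^sup>2" p] by (simp add: C_def powr_mult)
    finally show "N x \<xi> \<le> C * norm \<xi> powr p" .
  qed (simp add: C_def)
qed

text \<open>Dilated coefficients appear because the change of variables moves the dilation from the
  gradient onto \<open>A\<close>; s = 1 is the ordinary case.\<close>

lemma integrable_N_dil:
  assumes U: "in_Lp \<Omega> p U" and s: "0 < s" "s \<le> 1"
  shows "integrable (lebesgue_on \<Omega>) (\<lambda>x. N (dil x\<^sub>0 s x) (U x))"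
proof -
  obtain C where C: "C \<ge> 0" "\<And>x \<xi>. x \<in> \<Omega> \<Longrightarrow> N x \<xi> \<le> C * norm \<xi> powr p" using N_growth by blast
  show ?thesis
  proof (rule Bochner_Integration.integrable_bound)
    show "integrable (lebesgue_on \<Omega>) (\<lambda>x. C * norm (U x) powr p)"
      using U by (auto simp: in_Lp_def)
    have "U \<in> borel_measurable (lebesgue_on \<Omega>)" using U by (simp add: in_Lp_def)
    then show "(\<lambda>x. N (dil x\<^sub>0 s x) (U x)) \<in> borel_measurable (lebesgue_on \<Omega>)"
      unfolding N_def
      by (intro powr_real_measurable borel_measurable_quadratic A_dil_cont s borel_measurable_const) simp_all
    show "AE x in lebesgue_on \<Omega>. norm (N (dil x\<^sub>0 s x) (U x)) \<le> norm (C * norm (U x) powr p)"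
      using C dil_in_\<Omega>[OF _ s] by (intro AE_I2) (auto simp: N_nonneg)
  qed
qed

lemma integrable_N: "in_Lp \<Omega> p U \<Longrightarrow> integrable (lebesgue_on \<Omega>) (\<lambda>x. N x (U x))"
  using integrable_N_dil[of U 1] by simp

abbreviation flux :: "real^'n \<Rightarrow> real^'n \<Rightarrow> real^'n \<Rightarrow> real" where
  "flux x \<xi> \<eta> \<equiv> ((A x *v \<xi>) \<bullet> \<xi>) powr ((p - 2) / 2) * ((A x *v \<xi>) \<bullet> \<eta>)"

lemma N_convex: "x \<in> \<Omega> \<Longrightarrow> N x \<xi> + p * flux x \<xi> (\<eta> - \<xi>) \<le> N x \<eta>"
  unfolding N_def by (intro quadratic_form_powr_convex A_sym A_psd p)

lemma flux_self: "x \<in> \<Omega> \<Longrightarrow> flux x \<xi> \<xi> = N x \<xi>"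
proof -
  assume "x \<in> \<Omega>"
  then have "(A x *v \<xi>) \<bullet> \<xi> = ((A x *v \<xi>) \<bullet> \<xi>) powr 1" using A_psd by simp
  then have "flux x \<xi> \<xi> = ((A x *v \<xi>) \<bullet> \<xi>) powr ((p - 2) / 2) * ((A x *v \<xi>) \<bullet> \<xi>) powr 1" by simp
  also have "\<dots> = N x \<xi>" unfolding N_def powr_add[symmetric] by (simp add: field_simps)
  finally show ?thesis .
qed

text \<open>Convexity supplies the dominating function: the tangent inequality at U, applied towards
  U + V and towards U - V, bounds p times |flux| by the sum of the two energies.\<close>

lemma integrable_flux:
  assumes U: "in_Lp \<Omega> p U" and V: "in_Lp \<Omega> p V"
  shows "integrable (lebesgue_on \<Omega>) (\<lambda>x. flux x (U x) (V x))"
proof (rule Bochner_Integration.integrable_bound)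
  have p0: "p > 0" using p by simp
  show "integrable (lebesgue_on \<Omega>) (\<lambda>x. (N x (U x + V x) + N x (U x - V x)) / p)"
    using integrable_N[OF in_Lp_add[OF U V p0]] integrable_N[OF in_Lp_diff[OF U V p0]] by auto
  have m: "U \<in> borel_measurable (lebesgue_on \<Omega>)" "V \<in> borel_measurable (lebesgue_on \<Omega>)" using U V by (simp_all add: in_Lp_def)
  then show "(\<lambda>x. flux x (U x) (V x)) \<in> borel_measurable (lebesgue_on \<Omega>)"
    by (intro borel_measurable_times powr_real_measurable borel_measurable_quadratic A_cont_\<Omega> borel_measurable_const) simp_all
  show "AE x in lebesgue_on \<Omega>. norm (flux x (U x) (V x)) \<le> norm ((N x (U x + V x) + N x (U x - V x)) / p)"
  proof (rule AE_I2)
    fix x assume "x \<in> space (lebesgue_on \<Omega>)"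
    then have x: "x \<in> \<Omega>" by simp
    have "p * flux x (U x) (V x) \<le> N x (U x + V x) - N x (U x)"
      using N_convex[OF x, of "U x" "U x + V x"] by simp
    moreover have "- (p * flux x (U x) (V x)) \<le> N x (U x - V x) - N x (U x)"
      using N_convex[OF x, of "U x" "U x - V x"] by simp
    ultimately have "\<bar>p * flux x (U x) (V x)\<bar> \<le> N x (U x + V x) + N x (U x - V x)"
      using N_nonneg[of x "U x"] N_nonneg[of x "U x + V x"] N_nonneg[of x "U x - V x"] by linarith
    then have "\<bar>flux x (U x) (V x)\<bar> \<le> (N x (U x + V x) + N x (U x - V x)) / p"
      using p0 by (simp add: abs_mult field_simps)
    also have "\<dots> \<le> \<bar>(N x (U x + V x) + N x (U x - V x)) / p\<bar>" by (rule abs_ge_self)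
    finally show "norm (flux x (U x) (V x)) \<le> norm ((N x (U x + V x) + N x (U x - V x)) / p)" by simp
  qed
qed

lemma integral_N_convex:
  assumes U: "in_Lp \<Omega> p U" and V: "in_Lp \<Omega> p V"
  shows "(LINT x|lebesgue_on \<Omega>. N x (U x)) +
    p * ((LINT x|lebesgue_on \<Omega>. flux x (U x) (V x)) - (LINT x|lebesgue_on \<Omega>. flux x (U x) (U x)))
    \<le> (LINT x|lebesgue_on \<Omega>. N x (V x))"
proof -
  note i = integrable_N[OF U] integrable_N[OF V] integrable_flux[OF U V] integrable_flux[OF U U]
  have "(LINT x|lebesgue_on \<Omega>. N x (U x)) +
    p * ((LINT x|lebesgue_on \<Omega>. flux x (U x) (V x)) - (LINT x|lebesgue_on \<Omega>. flux x (U x) (U x)))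
    = (LINT x|lebesgue_on \<Omega>. N x (U x) + p * (flux x (U x) (V x) - flux x (U x) (U x)))"
    using i by simp
  also have "\<dots> \<le> (LINT x|lebesgue_on \<Omega>. N x (V x))"
  proof (rule integral_mono)
    show "integrable (lebesgue_on \<Omega>) (\<lambda>x. N x (U x) + p * (flux x (U x) (V x) - flux x (U x) (U x)))"
      using i by (intro Bochner_Integration.integrable_add integrable_mult_right Bochner_Integration.integrable_diff)
    fix x assume "x \<in> space (lebesgue_on \<Omega>)"
    then show "N x (U x) + p * (flux x (U x) (V x) - flux x (U x) (U x)) \<le> N x (V x)"
      using N_convex[of x "U x" "V x"] by (simp add: inner_diff_right right_diff_distrib)
  qed (rule i)
  finally show ?thesis .
qed

text \<open>Substituting y = \<open>dil x\<^sub>0 t x\<close> gives t^(p - n) times an energy of the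
  undilated gradient with coefficients taken at the contracted point
  \<open>dil x\<^sub>0 (1 / t) y\<close>. There \<open>radial_growth\<close> with s = 1 / t yields
  the gain.\<close>

lemma integral_N_dil:
  assumes V: "in_Lp \<Omega> p V" and t: "t > 1"
  shows "(LINT x|lebesgue_on \<Omega>. N x (t *\<^sub>R zero_ext \<Omega> V (dil x\<^sub>0 t x)))
    \<le> t powr (p - CARD('n)) * ((LINT x|lebesgue_on \<Omega>. N x (V x))
        - C\<^sub>0 * (1 - t powr - \<gamma>) * (LINT x|lebesgue_on \<Omega>. norm (x - x\<^sub>0) powr \<gamma> * norm (V x) powr p))"
proof -
  have s: "0 < 1 / t" "1 / t \<le> 1" "t > 0" using t by auto
  define Q where "Q = zero_ext \<Omega> (\<lambda>y. t powr p * N (dil x\<^sub>0 (1 / t) y) (V y))"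
  have Ni: "integrable (lebesgue_on \<Omega>) (\<lambda>y. N (dil x\<^sub>0 (1 / t) y) (V y))"
    by (rule integrable_N_dil[OF V s(1,2)])
  then have Qi: "integrable lebesgue Q"
    unfolding Q_def by (subst integrable_ext[symmetric]) auto
  have "zero_ext \<Omega> (\<lambda>x. N x (t *\<^sub>R zero_ext \<Omega> V (dil x\<^sub>0 t x))) = (\<lambda>x. Q (dil x\<^sub>0 t x))"
  proof
    fix x
    show "zero_ext \<Omega> (\<lambda>x. N x (t *\<^sub>R zero_ext \<Omega> V (dil x\<^sub>0 t x))) x = Q (dil x\<^sub>0 t x)"
    proof (cases "dil x\<^sub>0 t x \<in> \<Omega>")
      case True
      then have "x \<in> \<Omega>" using star_shaped_wrt_dil_inverse[OF star] t by simp
      then show ?thesis using True s by (simp add: Q_def N_scaleR)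
    next
      case False
      then show ?thesis by (cases "x \<in> \<Omega>") (simp_all add: Q_def)
    qed
  qed
  then have "(LINT x|lebesgue_on \<Omega>. N x (t *\<^sub>R zero_ext \<Omega> V (dil x\<^sub>0 t x))) = (LINT x|lebesgue. Q x) / t ^ CARD('n)"
    using lebesgue_integral_dil(2)[OF Qi s(3), of x\<^sub>0] by (simp add: integral_ext)
  also have "(LINT x|lebesgue. Q x) = t powr p * (LINT x|lebesgue_on \<Omega>. N (dil x\<^sub>0 (1 / t) x) (V x))"
    unfolding Q_def by (subst integral_ext[symmetric]) auto
  also have "t powr p * (LINT x|lebesgue_on \<Omega>. N (dil x\<^sub>0 (1 / t) x) (V x)) / t ^ CARD('n)
      = t powr (p - CARD('n)) * (LINT x|lebesgue_on \<Omega>. N (dil x\<^sub>0 (1 / t) x) (V x))"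
    using s by (simp add: powr_diff powr_realpow)
  also have "\<dots> \<le> t powr (p - CARD('n)) * ((LINT x|lebesgue_on \<Omega>. N x (V x))
        - C\<^sub>0 * (1 - t powr - \<gamma>) * (LINT x|lebesgue_on \<Omega>. norm (x - x\<^sub>0) powr \<gamma> * norm (V x) powr p))"
  proof (rule mult_left_mono)
    obtain R where R: "\<And>x. x \<in> \<Omega> \<Longrightarrow> norm (x - x\<^sub>0) \<le> R"
      using bounded_\<Omega> unfolding bounded_any_center[of _ x\<^sub>0] by (metis dist_commute dist_norm)
    have "norm (x - x\<^sub>0) \<le> R" if "zero_ext \<Omega> V x \<noteq> 0" for x
      using that R by (cases "x \<in> \<Omega>") auto
    then have "integrable lebesgue (\<lambda>x. norm (zero_ext \<Omega> V x) powr p * norm (x - x\<^sub>0) powr \<gamma>)"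
      using const V by (intro integrable_weighted_powr(1)[where R = R]) (auto simp flip: in_Lp_ext)
    also have "(\<lambda>x. norm (zero_ext \<Omega> V x) powr p * norm (x - x\<^sub>0) powr \<gamma>) = zero_ext \<Omega> (\<lambda>x. norm (x - x\<^sub>0) powr \<gamma> * norm (V x) powr p)"
      by (auto simp: fun_eq_iff zero_ext_def indicator_def)
    finally have Wi: "integrable (lebesgue_on \<Omega>) (\<lambda>x. norm (x - x\<^sub>0) powr \<gamma> * norm (V x) powr p)"
      by (subst integrable_ext) auto
    have "(LINT x|lebesgue_on \<Omega>. N (dil x\<^sub>0 (1 / t) x) (V x)) \<le>
      (LINT x|lebesgue_on \<Omega>. N x (V x) - C\<^sub>0 * (1 - t powr - \<gamma>) * (norm (x - x\<^sub>0) powr \<gamma> * norm (V x) powr p))"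
    proof (rule integral_mono)
      fix x assume "x \<in> space (lebesgue_on \<Omega>)"
      then have x: "x \<in> \<Omega>" by simp
      show "N (dil x\<^sub>0 (1 / t) x) (V x) \<le> N x (V x) - C\<^sub>0 * (1 - t powr - \<gamma>) * (norm (x - x\<^sub>0) powr \<gamma> * norm (V x) powr p)"
      \<comment> \<open>At the centre the dilation does nothing and the weight is 0, so the
        inequality is trivial there, while \<open>radial_growth\<close> excludes this point.\<close>
      proof (cases "x = x\<^sub>0")
        case False
        have "t powr - \<gamma> = (1 / t) powr \<gamma>" using s by (simp add: powr_minus powr_divide divide_simps)
        then show ?thesis
          using radial_growth[OF p star A_diff A_pos const lower x False s(1,2), of "V x"]
          by (simp add: N_def)
      qed (simp add: dil_def)
    qed (use Ni integrable_N[OF V] Wi in auto)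
    also have "\<dots> = (LINT x|lebesgue_on \<Omega>. N x (V x))
        - C\<^sub>0 * (1 - t powr - \<gamma>) * (LINT x|lebesgue_on \<Omega>. norm (x - x\<^sub>0) powr \<gamma> * norm (V x) powr p)"
      using integrable_N[OF V] Wi by simp
    finally show "(LINT x|lebesgue_on \<Omega>. N (dil x\<^sub>0 (1 / t) x) (V x)) \<le> (LINT x|lebesgue_on \<Omega>. N x (V x))
        - C\<^sub>0 * (1 - t powr - \<gamma>) * (LINT x|lebesgue_on \<Omega>. norm (x - x\<^sub>0) powr \<gamma> * norm (V x) powr p)" .
  qed simp
  finally show ?thesis .
qed

end

text \<open>A Hardy type inequality from the single dilation t = 2. Comparing the function with its
  dilate costs 2^p; the dilate contributes 2^(p - n) of the left side, which is absorbed since p <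
  n, and the difference contributes 2^p * 4^p = 8^p.\<close>

lemma W0_approx_weighted_Poincare:
  fixes \<Omega> :: "'a::euclidean_space set"
  assumes W: "W0_approx \<Omega> p u v \<phi>" and p: "p > 1" "p < DIM('a)" and \<Omega>: "\<Omega> \<in> sets lebesgue"
    and R: "\<And>x. x \<in> \<Omega> \<Longrightarrow> norm (x - a) \<le> R"
  shows "(LINT x|lebesgue. \<bar>zero_ext \<Omega> u x\<bar> powr p) \<le>
    8 powr p / (1 - 2 powr (p - DIM('a))) * (LINT x|lebesgue. norm (zero_ext \<Omega> v x) powr p * norm (x - a) powr p)"
proof -
  have p0: "p > 0" using p by simp
  have uL: "in_Lp UNIV p (zero_ext \<Omega> u)" using W in_Lp_ext[OF \<Omega>] by (auto simp: W0_approx_def)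
  define P where "P = (LINT x|lebesgue. \<bar>zero_ext \<Omega> u x\<bar> powr p)"
  define Z where "Z = (LINT x|lebesgue. norm (zero_ext \<Omega> v x) powr p * norm (x - a) powr p)"
  have D: "(LINT x|lebesgue. \<bar>zero_ext \<Omega> u (dil a 2 x) - zero_ext \<Omega> u x\<bar> powr p) \<le> 4 powr p * Z"
    using W0_approx_dil_difference[OF W _ p(1) \<Omega> R, of 2] by (simp add: Z_def)
  have udL: "in_Lp UNIV p (\<lambda>x. zero_ext \<Omega> u (dil a 2 x))" using in_Lp_dil(1)[OF uL, of 2] by simp
  have dL: "in_Lp UNIV p (\<lambda>x. zero_ext \<Omega> u (dil a 2 x) - zero_ext \<Omega> u x)" using p0 by (intro in_Lp_diff udL uL) auto
  have i: "integrable lebesgue (\<lambda>x. \<bar>zero_ext \<Omega> u x\<bar> powr p)" "integrable lebesgue (\<lambda>x. \<bar>zero_ext \<Omega> u (dil a 2 x)\<bar> powr p)"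
    "integrable lebesgue (\<lambda>x. \<bar>zero_ext \<Omega> u (dil a 2 x) - zero_ext \<Omega> u x\<bar> powr p)"
    using uL udL dL by (simp_all add: in_Lp_UNIV)
  have "P \<le> (LINT x|lebesgue. 2 powr p * (\<bar>zero_ext \<Omega> u (dil a 2 x)\<bar> powr p + \<bar>zero_ext \<Omega> u (dil a 2 x) - zero_ext \<Omega> u x\<bar> powr p))"
    unfolding P_def
  proof (rule integral_mono)
    fix x
    show "\<bar>zero_ext \<Omega> u x\<bar> powr p \<le> 2 powr p * (\<bar>zero_ext \<Omega> u (dil a 2 x)\<bar> powr p + \<bar>zero_ext \<Omega> u (dil a 2 x) - zero_ext \<Omega> u x\<bar> powr p)"
      using powr_norm_add_le[OF p0, of "zero_ext \<Omega> u (dil a 2 x)" "zero_ext \<Omega> u x - zero_ext \<Omega> u (dil a 2 x)"]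
      by (simp add: abs_minus_commute)
  qed (use i in auto)
  also have "\<dots> = 2 powr p * (P / 2 ^ DIM('a) + (LINT x|lebesgue. \<bar>zero_ext \<Omega> u (dil a 2 x) - zero_ext \<Omega> u x\<bar> powr p))"
    using i in_Lp_dil(2)[OF uL, of 2 a] by (simp add: P_def)
  also have "\<dots> \<le> 2 powr p * (P / 2 ^ DIM('a) + 4 powr p * Z)"
    using D by simp
  also have "\<dots> = 2 powr (p - DIM('a)) * P + 8 powr p * Z"
  proof -
    have "(8::real) powr p = (2 * 4) powr p" by simp
    also have "\<dots> = 2 powr p * 4 powr p" by (rule powr_mult)
    finally have "(8::real) powr p = 2 powr p * 4 powr p" .
    then show ?thesis by (simp add: powr_diff powr_realpow algebra_simps)
  qed
  finally have "(1 - 2 powr (p - DIM('a))) * P \<le> 8 powr p * Z" by (simp add: algebra_simps)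
  moreover have "2 powr (p - DIM('a)) < (1::real)"
  proof -
    have "2 powr (p - DIM('a)) < (2::real) powr 0" using p(2) by (intro powr_less_mono) auto
    then show ?thesis by simp
  qed
  ultimately show ?thesis unfolding P_def[symmetric] Z_def[symmetric] by (simp add: field_simps)
qed

text \<open>The right-hand side of the system is the gradient of one potential \<Phi>, and \<Phi>(0)
  = 0 makes it compatible with zero extension. Representatives \<open>V\<close> of the weak
  gradients and their approximating sequences are fixed once, so that every dilate inherits explicit
  ones.\<close>

locale dirichlet_solution = dirichlet_form \<Omega> x\<^sub>0 A p \<gamma> C\<^sub>0
  for \<Omega> :: "(real^'n) set" and x\<^sub>0 and A and p \<gamma> C\<^sub>0 +
  fixes u :: "real^'n \<Rightarrow> real^'d" and V :: "'d \<Rightarrow> real^'n \<Rightarrow> real^'n" and \<phi> :: "'d \<Rightarrow> nat \<Rightarrow> real^'n \<Rightarrow> real"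
    and \<Phi> :: "real^'d \<Rightarrow> real" and M :: real
  assumes W0: "\<And>j. W0_approx \<Omega> p (\<lambda>x. u x $ j) (V j) (\<phi> j)"
    and u_cont: "continuous_on \<Omega> u"
    and u_bound: "M \<ge> 0" "\<And>x. x \<in> \<Omega> \<Longrightarrow> norm (u x) \<le> M"
    and \<Phi>: "Ck 1 \<Phi>" "\<Phi> 0 = 0"
    and weak: "\<And>j w V'. in_W0 \<Omega> p w \<Longrightarrow> has_weak_gradient \<Omega> w V' \<Longrightarrow>
      (LINT x|lebesgue_on \<Omega>. flux x (V j x) (V' x)) = (LINT x|lebesgue_on \<Omega>. grad \<Phi> (u x) $ j * w x)"
begin

definition v :: "real \<Rightarrow> real^'n \<Rightarrow> real^'d" where
  "v t x = zero_ext \<Omega> u (dil x\<^sub>0 t x)"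

lemma v_nth: "v t x $ j = zero_ext \<Omega> (\<lambda>x. u x $ j) (dil x\<^sub>0 t x)"
  by (simp add: v_def zero_ext_def)

lemma v_bound: "norm (v t x) \<le> M"
  using u_bound by (cases "dil x\<^sub>0 t x \<in> \<Omega>") (auto simp: v_def)

definition K :: real where "K = (\<Sum>j\<in>UNIV. LINT x|lebesgue_on \<Omega>. N x (V j x))"

definition Wt :: real where
  "Wt = (\<Sum>j\<in>UNIV. LINT x|lebesgue_on \<Omega>. norm (x - x\<^sub>0) powr \<gamma> * norm (V j x) powr p)"

lemma p_ge_1: "1 \<le> p" using p by simp

lemma V_Lp: "in_Lp \<Omega> p (V j)" and u_Lp: "in_Lp \<Omega> p (\<lambda>x. u x $ j)"
  using W0[of j] by (simp_all add: W0_approx_def)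

lemma v_W0: "t \<ge> 1 \<Longrightarrow> W0_approx \<Omega> p (\<lambda>x. v t x $ j) (\<lambda>x. t *\<^sub>R zero_ext \<Omega> (V j) (dil x\<^sub>0 t x)) (\<lambda>k x. \<phi> j k (dil x\<^sub>0 t x))"
  unfolding v_nth using p by (intro W0_approx_dil[OF W0 star]) auto

lemma u_meas: "u \<in> borel_measurable (lebesgue_on \<Omega>)"
  by (rule continuous_imp_measurable_on_sets_lebesgue[OF u_cont \<Omega>_sets])

lemma v_meas: "t > 0 \<Longrightarrow> v t \<in> borel_measurable (lebesgue_on \<Omega>)"
  unfolding v_def[abs_def] using u_meas
  by (intro measurable_restrict_space1 borel_measurable_dil) (auto simp: measurable_ext)

lemma integrable_bounded:
  fixes f :: "real^'n \<Rightarrow> real"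
  assumes "f \<in> borel_measurable (lebesgue_on \<Omega>)" "\<And>x. x \<in> \<Omega> \<Longrightarrow> \<bar>f x\<bar> \<le> B"
  shows "integrable (lebesgue_on \<Omega>) f"
proof -
  interpret finite_measure "lebesgue_on \<Omega>"
    using \<Omega>_lmeasurable by (rule finite_measure_lebesgue_on)
  show ?thesis using assms by (intro integrable_const_bound[where B = B] AE_I2) auto
qed

lemma integrable_continuous_comp:
  fixes f :: "real^'d \<Rightarrow> real"
  assumes f: "continuous_on UNIV f" and g: "g \<in> borel_measurable (lebesgue_on \<Omega>)" "\<And>x. x \<in> \<Omega> \<Longrightarrow> norm (g x) \<le> M"
  shows "integrable (lebesgue_on \<Omega>) (\<lambda>x. f (g x))"
proof -
  have "bounded (f ` cball 0 M)"
    using f by (intro compact_imp_bounded compact_continuous_image) (auto intro: continuous_on_subset)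
  then obtain B where "\<forall>z\<in>f ` cball 0 M. norm z \<le> B"
    unfolding bounded_iff ..
  then have B: "\<bar>f y\<bar> \<le> B" if "y \<in> cball 0 M" for y
    using that by fastforce
  show ?thesis
  proof (rule integrable_bounded[where B = B])
    show "(\<lambda>x. f (g x)) \<in> borel_measurable (lebesgue_on \<Omega>)"
      by (rule measurable_compose[OF g(1) borel_measurable_continuous_onI[OF f]])
  qed (use B g in auto)
qed

lemma integrable_f_mult:
  assumes w: "in_Lp \<Omega> p w"
  shows "integrable (lebesgue_on \<Omega>) (\<lambda>x. grad \<Phi> (u x) $ j * w x)"
proof -
  have gc: "continuous_on UNIV (\<lambda>s. grad \<Phi> s $ j)"
    by (intro continuous_on_component Ck_1_continuous_grad \<Phi>)
  have "bounded ((\<lambda>s. grad \<Phi> s $ j) ` cball 0 M)"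
    using gc by (intro compact_imp_bounded compact_continuous_image) (auto intro: continuous_on_subset)
  then obtain B where "\<forall>z\<in>(\<lambda>s. grad \<Phi> s $ j) ` cball 0 M. norm z \<le> B"
    unfolding bounded_iff ..
  then have B: "\<bar>grad \<Phi> y $ j\<bar> \<le> B" if "y \<in> cball 0 M" for y
    using that by fastforce
  show ?thesis
  proof (rule Bochner_Integration.integrable_bound)
    show "integrable (lebesgue_on \<Omega>) (\<lambda>x. B * w x)"
      using in_Lp_imp_integrable[OF w p_ge_1 \<Omega>_lmeasurable] by simp
    show "(\<lambda>x. grad \<Phi> (u x) $ j * w x) \<in> borel_measurable (lebesgue_on \<Omega>)"
      using w by (intro borel_measurable_times measurable_compose[OF u_meas borel_measurable_continuous_onI[OF gc]])
        (simp add: in_Lp_def)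
    show "AE x in lebesgue_on \<Omega>. norm (grad \<Phi> (u x) $ j * w x) \<le> norm (B * w x)"
    proof (rule AE_I2)
      fix x assume "x \<in> space (lebesgue_on \<Omega>)"
      then have "\<bar>grad \<Phi> (u x) $ j\<bar> \<le> \<bar>B\<bar>" using B[of "u x"] u_bound by simp
      then show "norm (grad \<Phi> (u x) $ j * w x) \<le> norm (B * w x)"
        by (simp add: abs_mult mult_right_mono)
    qed
  qed
qed

text \<open>Each component of the equation is tested with the same component of \<open>u\<close>;
  the flux paired with its own gradient is \<open>N\<close>.\<close>

lemma energy: "K = (LINT x|lebesgue_on \<Omega>. grad \<Phi> (u x) \<bullet> u x)"
proof -
  have "(LINT x|lebesgue_on \<Omega>. N x (V j x)) = (LINT x|lebesgue_on \<Omega>. grad \<Phi> (u x) $ j * u x $ j)" for j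
  proof -
    have "(LINT x|lebesgue_on \<Omega>. N x (V j x)) = (LINT x|lebesgue_on \<Omega>. flux x (V j x) (V j x))"
      by (intro Bochner_Integration.integral_cong) (auto simp: flux_self)
    then show ?thesis
      using weak[OF W0_approx_imp[OF W0 p_ge_1 \<Omega>_lmeasurable]] by simp
  qed
  then show ?thesis
    using integrable_f_mult[OF u_Lp] by (simp add: K_def inner_vec_def)
qed

text \<open>The principal part of the system is decoupled, so convexity is applied to each
  component. Its linear term is the difference of the equation tested with the dilate and with
  \<open>u\<close>, which converts it into the integral of the right-hand side; the couplings
  reappear only after summing over j.\<close>

lemma dilation_inequality:
  assumes t: "t > 1"
  shows "p * (LINT x|lebesgue_on \<Omega>. grad \<Phi> (u x) \<bullet> (v t x - u x))
    \<le> t powr (p - CARD('n)) * (K - C\<^sub>0 * (1 - t powr - \<gamma>) * Wt) - K"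
proof -
  have t1: "t \<ge> 1" using t by simp
  define V' where "V' j x = t *\<^sub>R zero_ext \<Omega> (V j) (dil x\<^sub>0 t x)" for j x
  have vW: "W0_approx \<Omega> p (\<lambda>x. v t x $ j) (V' j) (\<lambda>k x. \<phi> j k (dil x\<^sub>0 t x))" for j
    using v_W0[OF t1] by (simp add: V'_def[abs_def])
  have V'L: "in_Lp \<Omega> p (V' j)" and vL: "in_Lp \<Omega> p (\<lambda>x. v t x $ j)" for j
    using vW[of j] by (simp_all add: W0_approx_def)
  have main: "p * (LINT x|lebesgue_on \<Omega>. grad \<Phi> (u x) $ j * (v t x - u x) $ j) \<le>
    t powr (p - CARD('n)) * ((LINT x|lebesgue_on \<Omega>. N x (V j x))
        - C\<^sub>0 * (1 - t powr - \<gamma>) * (LINT x|lebesgue_on \<Omega>. norm (x - x\<^sub>0) powr \<gamma> * norm (V j x) powr p))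
    - (LINT x|lebesgue_on \<Omega>. N x (V j x))" for j
  proof -
    have "(LINT x|lebesgue_on \<Omega>. grad \<Phi> (u x) $ j * (v t x - u x) $ j)
      = (LINT x|lebesgue_on \<Omega>. grad \<Phi> (u x) $ j * v t x $ j) - (LINT x|lebesgue_on \<Omega>. grad \<Phi> (u x) $ j * u x $ j)"
      using integrable_f_mult[OF vL] integrable_f_mult[OF u_Lp] by (simp add: right_diff_distrib)
    also have "\<dots> = (LINT x|lebesgue_on \<Omega>. flux x (V j x) (V' j x)) - (LINT x|lebesgue_on \<Omega>. flux x (V j x) (V j x))"
      using weak[OF W0_approx_imp[OF W0 p_ge_1 \<Omega>_lmeasurable]] weak[OF W0_approx_imp[OF vW p_ge_1 \<Omega>_lmeasurable]] by simp
    finally show ?thesis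
      using integral_N_convex[OF V_Lp V'L, of j j] integral_N_dil[OF V_Lp t, of j] by (simp add: V'_def)
  qed
  have "p * (LINT x|lebesgue_on \<Omega>. grad \<Phi> (u x) \<bullet> (v t x - u x)) =
    (\<Sum>j\<in>UNIV. p * (LINT x|lebesgue_on \<Omega>. grad \<Phi> (u x) $ j * (v t x - u x) $ j))"
  proof -
    have "integrable (lebesgue_on \<Omega>) (\<lambda>x. grad \<Phi> (u x) $ j * (v t x - u x) $ j)" for j
      using integrable_f_mult[OF vL] integrable_f_mult[OF u_Lp] by (simp add: right_diff_distrib)
    then show ?thesis by (simp add: inner_vec_def sum_distrib_left)
  qed
  also have "\<dots> \<le> (\<Sum>j\<in>UNIV. t powr (p - CARD('n)) * ((LINT x|lebesgue_on \<Omega>. N x (V j x))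
        - C\<^sub>0 * (1 - t powr - \<gamma>) * (LINT x|lebesgue_on \<Omega>. norm (x - x\<^sub>0) powr \<gamma> * norm (V j x) powr p))
    - (LINT x|lebesgue_on \<Omega>. N x (V j x)))"
    by (rule sum_mono) (rule main)
  also have "\<dots> = t powr (p - CARD('n)) * (K - C\<^sub>0 * (1 - t powr - \<gamma>) * Wt) - K"
    by (simp add: K_def Wt_def sum_subtractf sum_distrib_left right_diff_distrib)
  finally show ?thesis .
qed

text \<open>Because \<Phi>(0) = 0, applying \<Phi> commutes with extension by zero, and only the
  Jacobian of the dilation remains.\<close>

lemma integral_\<Phi>_v:
  assumes t: "t \<ge> 1"
  shows "(LINT x|lebesgue_on \<Omega>. \<Phi> (v t x)) = t powr - CARD('n) * (LINT x|lebesgue_on \<Omega>. \<Phi> (u x))"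
proof -
  have c: "continuous_on UNIV \<Phi>" using \<Phi>(1) Ck_Suc_continuous[of 0 \<Phi>] by simp
  have i: "integrable lebesgue (zero_ext \<Omega> (\<lambda>x. \<Phi> (u x)))"
    using integrable_continuous_comp[OF c u_meas u_bound(2)] by (simp add: integrable_ext)
  have "zero_ext \<Omega> (\<lambda>x. \<Phi> (v t x)) = (\<lambda>x. zero_ext \<Omega> (\<lambda>x. \<Phi> (u x)) (dil x\<^sub>0 t x))"
  proof
    fix x
    show "zero_ext \<Omega> (\<lambda>x. \<Phi> (v t x)) x = zero_ext \<Omega> (\<lambda>x. \<Phi> (u x)) (dil x\<^sub>0 t x)"
    proof (cases "dil x\<^sub>0 t x \<in> \<Omega>")
      case True
      then show ?thesis using star_shaped_wrt_dil_inverse[OF star True t] by (simp add: v_def)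
    next
      case False
      then show ?thesis by (cases "x \<in> \<Omega>") (simp_all add: v_def \<Phi>)
    qed
  qed
  then show ?thesis
    using lebesgue_integral_dil(2)[OF i, of t x\<^sub>0] t
    by (simp add: integral_ext powr_minus powr_realpow field_simps)
qed

text \<open>The order of quantifiers matters: \<open>D\<close> is independent of \<epsilon> and t,
  while \<open>C\<close> may depend on \<epsilon> but not on t. After division by t - 1 the last
  term vanishes as t -> 1, and what remains is a multiple of \<epsilon>. The dilation differences
  enter only through their p-th powers.\<close>

lemma Taylor_remainder:
  obtains D where "D \<ge> 0"
    "\<And>\<epsilon>. \<epsilon> > 0 \<Longrightarrow> \<exists>C\<ge>0. \<forall>t>1. (LINT x|lebesgue_on \<Omega>. \<Phi> (v t x)) - (LINT x|lebesgue_on \<Omega>. \<Phi> (u x))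
       \<le> (LINT x|lebesgue_on \<Omega>. grad \<Phi> (u x) \<bullet> (v t x - u x)) + \<epsilon> * (t - 1) * D + C * (t - 1) powr p * D"
proof -
  obtain R where R: "\<And>x. x \<in> \<Omega> \<Longrightarrow> norm (x - x\<^sub>0) \<le> R"
    using bounded_\<Omega> unfolding bounded_any_center[of _ x\<^sub>0] by (metis dist_commute dist_norm)
  define Z where "Z j = (LINT x|lebesgue. norm (zero_ext \<Omega> (V j) x) powr p * norm (x - x\<^sub>0) powr p)" for j
  define D1 where "D1 = real CARD('d) powr p * (\<Sum>j\<in>UNIV. 4 powr p * Z j)"
  have Z0: "Z j \<ge> 0" for j unfolding Z_def by (intro integral_nonneg_AE) auto
  have D1: "D1 \<ge> 0" unfolding D1_def using Z0 by (intro mult_nonneg_nonneg sum_nonneg) auto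
  define D where "D = measure lebesgue \<Omega> + D1"
  have D: "D \<ge> 0" "D1 \<le> D" using D1 by (auto simp: D_def)
  show ?thesis
  proof (rule that[OF D(1)])
    fix \<epsilon> :: real assume e: "\<epsilon> > 0"
    obtain C where C: "C \<ge> 0" "\<And>x y. norm x \<le> M \<Longrightarrow> norm y \<le> M \<Longrightarrow>
      \<bar>\<Phi> y - \<Phi> x - grad \<Phi> x \<bullet> (y - x)\<bar> \<le> \<epsilon> * norm (y - x) + C * norm (y - x) powr p"
      using Ck_1_Taylor_bounded[OF \<Phi>(1) e p_ge_1, of M] by blast
    show "\<exists>C\<ge>0. \<forall>t>1. (LINT x|lebesgue_on \<Omega>. \<Phi> (v t x)) - (LINT x|lebesgue_on \<Omega>. \<Phi> (u x))
       \<le> (LINT x|lebesgue_on \<Omega>. grad \<Phi> (u x) \<bullet> (v t x - u x)) + \<epsilon> * (t - 1) * D + C * (t - 1) powr p * D"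
    proof (rule exI[of _ C], intro conjI allI impI C(1))
      fix t :: real assume t: "t > 1"
      define h where "h = t - 1"
      have h: "h > 0" using t by (simp add: h_def)
      have t1: "t \<ge> 1" using t by simp
      define \<delta> where "\<delta> j x = (v t x - u x) $ j" for j x
      have vL: "in_Lp \<Omega> p (\<lambda>x. v t x $ j)" for j using v_W0[OF t1, of j] by (simp add: W0_approx_def)
      have \<delta>L: "in_Lp \<Omega> p (\<delta> j)" for j
        unfolding \<delta>_def[abs_def] vector_minus_component using p by (intro in_Lp_diff vL u_Lp) auto
      have \<delta>i: "integrable (lebesgue_on \<Omega>) (\<lambda>x. \<bar>\<delta> j x\<bar> powr p)" for j
        using \<delta>L[of j] by (simp add: in_Lp_def)
      have \<delta>b: "(LINT x|lebesgue_on \<Omega>. \<bar>\<delta> j x\<bar> powr p) \<le> 4 powr p * h powr p * Z j" for j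
      proof -
        have uL: "in_Lp UNIV p (zero_ext \<Omega> (\<lambda>x. u x $ j))" using u_Lp in_Lp_ext[OF \<Omega>_sets] by blast
        have "in_Lp UNIV p (\<lambda>x. zero_ext \<Omega> (\<lambda>x. u x $ j) (dil x\<^sub>0 t x) - zero_ext \<Omega> (\<lambda>x. u x $ j) x)"
          using p t by (intro in_Lp_diff in_Lp_dil uL) auto
        then have i: "integrable lebesgue (\<lambda>x. \<bar>zero_ext \<Omega> (\<lambda>x. u x $ j) (dil x\<^sub>0 t x) - zero_ext \<Omega> (\<lambda>x. u x $ j) x\<bar> powr p)"
          by (simp add: in_Lp_UNIV)
        have "(LINT x|lebesgue_on \<Omega>. \<bar>\<delta> j x\<bar> powr p) = (LINT x|lebesgue. zero_ext \<Omega> (\<lambda>x. \<bar>\<delta> j x\<bar> powr p) x)"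
          by (simp add: integral_ext)
        also have "\<dots> \<le> (LINT x|lebesgue. \<bar>zero_ext \<Omega> (\<lambda>x. u x $ j) (dil x\<^sub>0 t x) - zero_ext \<Omega> (\<lambda>x. u x $ j) x\<bar> powr p)"
        proof (rule integral_mono[OF _ i])
          show "integrable lebesgue (zero_ext \<Omega> (\<lambda>x. \<bar>\<delta> j x\<bar> powr p))" using \<delta>i[of j] by (simp add: integrable_ext)
          show "zero_ext \<Omega> (\<lambda>x. \<bar>\<delta> j x\<bar> powr p) x \<le> \<bar>zero_ext \<Omega> (\<lambda>x. u x $ j) (dil x\<^sub>0 t x) - zero_ext \<Omega> (\<lambda>x. u x $ j) x\<bar> powr p" for x
            by (cases "x \<in> \<Omega>") (simp_all add: \<delta>_def v_nth)
        qed
        also have "\<dots> \<le> 4 powr p * h powr p * Z j"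
          unfolding Z_def h_def by (rule W0_approx_dil_difference[OF W0 t p \<Omega>_sets R])
        finally show ?thesis .
      qed
      define P where "P x = (\<Sum>j\<in>UNIV. real CARD('d) powr p * \<bar>\<delta> j x\<bar> powr p)" for x
      have Pi: "integrable (lebesgue_on \<Omega>) P" unfolding P_def[abs_def] using \<delta>i by auto
      have Pb: "(LINT x|lebesgue_on \<Omega>. P x) \<le> h powr p * D1"
      proof -
        have "(LINT x|lebesgue_on \<Omega>. P x) = (\<Sum>j\<in>UNIV. real CARD('d) powr p * (LINT x|lebesgue_on \<Omega>. \<bar>\<delta> j x\<bar> powr p))"
          unfolding P_def using \<delta>i by simp
        also have "\<dots> \<le> (\<Sum>j\<in>UNIV. real CARD('d) powr p * (4 powr p * h powr p * Z j))"
          by (intro sum_mono mult_left_mono \<delta>b) auto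
        also have "\<dots> = h powr p * D1" by (simp add: D1_def sum_distrib_left mult_ac)
        finally show ?thesis .
      qed
      have nP: "norm (v t x - u x) powr p \<le> P x" for x
        using norm_powr_le_sum[of p "v t x - u x"] p by (simp add: P_def \<delta>_def sum_distrib_left)
      have c: "continuous_on UNIV \<Phi>" using \<Phi>(1) Ck_Suc_continuous[of 0 \<Phi>] by simp
      have iv: "integrable (lebesgue_on \<Omega>) (\<lambda>x. \<Phi> (v t x))"
        using v_meas[of t] t v_bound by (intro integrable_continuous_comp c) auto
      have iu: "integrable (lebesgue_on \<Omega>) (\<lambda>x. \<Phi> (u x))"
        by (intro integrable_continuous_comp c u_meas u_bound)
      have ifd: "integrable (lebesgue_on \<Omega>) (\<lambda>x. grad \<Phi> (u x) \<bullet> (v t x - u x))"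
        using integrable_f_mult[OF \<delta>L] by (simp add: inner_vec_def \<delta>_def)
      \<comment> \<open>This is the coefficient in \<open>le_eps_powr\<close> at threshold h. The
        p-th power integral is of order h^p and q h^p = h, so the first-power integral of the
        difference is of order h = t - 1.\<close>
      define q where "q = h powr (1 - p)"
      interpret finite_measure "lebesgue_on \<Omega>"
        using \<Omega>_lmeasurable by (rule finite_measure_lebesgue_on)
      have "(LINT x|lebesgue_on \<Omega>. \<Phi> (v t x)) - (LINT x|lebesgue_on \<Omega>. \<Phi> (u x)) = (LINT x|lebesgue_on \<Omega>. \<Phi> (v t x) - \<Phi> (u x))"
        using iv iu by simp
      also have "\<dots> \<le> (LINT x|lebesgue_on \<Omega>. grad \<Phi> (u x) \<bullet> (v t x - u x) + (\<epsilon> * h + (\<epsilon> * q + C) * P x))"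
      proof (rule integral_mono)
        fix x assume "x \<in> space (lebesgue_on \<Omega>)"
        then have x: "x \<in> \<Omega>" by simp
        have "\<Phi> (v t x) - \<Phi> (u x) - grad \<Phi> (u x) \<bullet> (v t x - u x) \<le> \<epsilon> * norm (v t x - u x) + C * norm (v t x - u x) powr p"
          using C(2)[OF u_bound(2)[OF x] v_bound, of t x] by linarith
        also have "\<dots> \<le> \<epsilon> * (h + q * norm (v t x - u x) powr p) + C * norm (v t x - u x) powr p"
          using le_eps_powr[OF _ h p_ge_1, of "norm (v t x - u x)"] e
          by (intro add_right_mono mult_left_mono) (auto simp: q_def)
        also have "\<dots> = \<epsilon> * h + (\<epsilon> * q + C) * norm (v t x - u x) powr p" by (simp add: algebra_simps)
        also have "\<dots> \<le> \<epsilon> * h + (\<epsilon> * q + C) * P x"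
          using e C(1) nP by (intro add_left_mono mult_left_mono) (auto simp: q_def)
        finally show "\<Phi> (v t x) - \<Phi> (u x) \<le> grad \<Phi> (u x) \<bullet> (v t x - u x) + (\<epsilon> * h + (\<epsilon> * q + C) * P x)" by linarith
      qed (use iv iu ifd Pi in auto)
      also have "\<dots> = (LINT x|lebesgue_on \<Omega>. grad \<Phi> (u x) \<bullet> (v t x - u x)) + (\<epsilon> * h * measure lebesgue \<Omega> + (\<epsilon> * q + C) * (LINT x|lebesgue_on \<Omega>. P x))"
        using ifd Pi by (simp add: measure_restrict_space)
      also have "\<dots> \<le> (LINT x|lebesgue_on \<Omega>. grad \<Phi> (u x) \<bullet> (v t x - u x)) + (\<epsilon> * h * measure lebesgue \<Omega> + (\<epsilon> * q + C) * (h powr p * D1))"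
        using Pb e C(1) by (intro add_left_mono mult_left_mono) (auto simp: q_def)
      also have "\<dots> = (LINT x|lebesgue_on \<Omega>. grad \<Phi> (u x) \<bullet> (v t x - u x)) + (\<epsilon> * h * D + C * h powr p * D1)"
      proof -
        have "q * h powr p = h" using h by (simp add: q_def flip: powr_add)
        then have "\<epsilon> * q * (h powr p * D1) = \<epsilon> * h * D1" by simp
        then show ?thesis by (simp add: D_def algebra_simps)
      qed
      also have "\<dots> \<le> (LINT x|lebesgue_on \<Omega>. grad \<Phi> (u x) \<bullet> (v t x - u x)) + (\<epsilon> * h * D + C * h powr p * D)"
        using D C(1) by (intro add_left_mono mult_left_mono) auto
      finally show "(LINT x|lebesgue_on \<Omega>. \<Phi> (v t x)) - (LINT x|lebesgue_on \<Omega>. \<Phi> (u x))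
       \<le> (LINT x|lebesgue_on \<Omega>. grad \<Phi> (u x) \<bullet> (v t x - u x)) + \<epsilon> * (t - 1) * D + C * (t - 1) powr p * D"
        by (simp add: h_def)
    qed
  qed
qed

text \<open>With t = 1 + h, the inequality for the dilates and the Taylor bound are combined and
  divided by h. The slopes of t^(-n), t^(p - n) and t^(-\<gamma>) at 1 produce the coefficients, and
  h^(p - 1) tends to 0 since p > 1. Here \<epsilon> stays fixed, because \<open>C\<close> depends on
  it; it is sent to 0 only after h.\<close>

lemma Pohozaev_inequality:
  "(CARD('n) - p) * K + C\<^sub>0 * \<gamma> * Wt \<le> p * CARD('n) * (LINT x|lebesgue_on \<Omega>. \<Phi> (u x))"
proof -
  define n where "n = real CARD('n)"
  define J where "J = (LINT x|lebesgue_on \<Omega>. \<Phi> (u x))"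
  obtain D where D: "D \<ge> 0"
    "\<And>\<epsilon>. \<epsilon> > 0 \<Longrightarrow> \<exists>C\<ge>0. \<forall>t>1. (LINT x|lebesgue_on \<Omega>. \<Phi> (v t x)) - J
       \<le> (LINT x|lebesgue_on \<Omega>. grad \<Phi> (u x) \<bullet> (v t x - u x)) + \<epsilon> * (t - 1) * D + C * (t - 1) powr p * D"
    unfolding J_def by (rule Taylor_remainder) blast
  have main: "p * (- n * J) \<le> (p - n) * K - C\<^sub>0 * \<gamma> * Wt + p * D * \<epsilon>" if e: "\<epsilon> > 0" for \<epsilon>
  proof -
    obtain C where C: "\<And>t. t > 1 \<Longrightarrow> (LINT x|lebesgue_on \<Omega>. \<Phi> (v t x)) - J
       \<le> (LINT x|lebesgue_on \<Omega>. grad \<Phi> (u x) \<bullet> (v t x - u x)) + \<epsilon> * (t - 1) * D + C * (t - 1) powr p * D"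
      using D(2)[OF e] by blast
    have ineq: "p * (((1 + h) powr (- n) - 1) / h * J) \<le>
      ((1 + h) powr (p - n) - 1) / h * K - (1 + h) powr (p - n) * C\<^sub>0 * (- (((1 + h) powr (- \<gamma>) - 1) / h)) * Wt
      + p * D * \<epsilon> + p * D * C * h powr (p - 1)" if h: "h > 0" for h
    proof -
      have t: "1 + h > 1" using h by simp
      have "(LINT x|lebesgue_on \<Omega>. \<Phi> (v (1 + h) x)) = (1 + h) powr (- n) * J"
        using integral_\<Phi>_v[of "1 + h"] h by (simp add: J_def n_def)
      then have "(1 + h) powr (- n) * J - J \<le> (LINT x|lebesgue_on \<Omega>. grad \<Phi> (u x) \<bullet> (v (1 + h) x - u x)) + \<epsilon> * h * D + C * h powr p * D"
        using C[OF t] by simp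
      then have "p * ((1 + h) powr (- n) * J - J) \<le> p * ((LINT x|lebesgue_on \<Omega>. grad \<Phi> (u x) \<bullet> (v (1 + h) x - u x)) + \<epsilon> * h * D + C * h powr p * D)"
        using p by (intro mult_left_mono) auto
      also have "\<dots> \<le> (1 + h) powr (p - n) * (K - C\<^sub>0 * (1 - (1 + h) powr - \<gamma>) * Wt) - K + p * (\<epsilon> * h * D + C * h powr p * D)"
        using dilation_inequality[OF t] by (simp add: distrib_left n_def)
      finally have XY: "p * ((1 + h) powr (- n) * J - J) \<le>
        (1 + h) powr (p - n) * (K - C\<^sub>0 * (1 - (1 + h) powr - \<gamma>) * Wt) - K + p * (\<epsilon> * h * D + C * h powr p * D)" .
      have hp: "h powr p = h * h powr (p - 1)" using h by (simp add: powr_diff)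
      have c: "h * (x / h * y) = x * y" for x y using h by simp
      have "h * (p * (((1 + h) powr (- n) - 1) / h * J)) = p * ((1 + h) powr (- n) * J - J)"
        by (subst mult.left_commute) (simp only: c left_diff_distrib mult_1)
      moreover have "h * (((1 + h) powr (p - n) - 1) / h * K - (1 + h) powr (p - n) * C\<^sub>0 * (- (((1 + h) powr (- \<gamma>) - 1) / h)) * Wt
        + p * D * \<epsilon> + p * D * C * h powr (p - 1)) =
        (1 + h) powr (p - n) * (K - C\<^sub>0 * (1 - (1 + h) powr - \<gamma>) * Wt) - K + p * (\<epsilon> * h * D + C * h powr p * D)"
      proof -
        have "h * (((1 + h) powr (p - n) - 1) / h * K - (1 + h) powr (p - n) * C\<^sub>0 * (- (((1 + h) powr (- \<gamma>) - 1) / h)) * Wt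
        + p * D * \<epsilon> + p * D * C * h powr (p - 1)) =
          h * (((1 + h) powr (p - n) - 1) / h * K) + h * (((1 + h) powr (- \<gamma>) - 1) / h * ((1 + h) powr (p - n) * C\<^sub>0 * Wt))
          + p * D * \<epsilon> * h + p * D * C * (h * h powr (p - 1))"
          by (simp add: algebra_simps)
        also have "\<dots> = ((1 + h) powr (p - n) - 1) * K + ((1 + h) powr (- \<gamma>) - 1) * ((1 + h) powr (p - n) * C\<^sub>0 * Wt)
          + p * D * \<epsilon> * h + p * D * C * h powr p"
          by (simp only: c hp)
        finally show ?thesis by (simp add: algebra_simps)
      qed
      ultimately show ?thesis using XY mult_le_cancel_left_pos[OF h] by metis
    qed
    have lim1: "((\<lambda>h. p * (((1 + h) powr (- n) - 1) / h * J)) \<longlongrightarrow> p * (- n * J)) (at_right 0)"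
      by (intro tendsto_intros powr_slope_at_right_0)
    have lim2: "((\<lambda>h. ((1 + h) powr (p - n) - 1) / h * K - (1 + h) powr (p - n) * C\<^sub>0 * (- (((1 + h) powr (- \<gamma>) - 1) / h)) * Wt
      + p * D * \<epsilon> + p * D * C * h powr (p - 1)) \<longlongrightarrow>
       (p - n) * K - (1 + 0) powr (p - n) * C\<^sub>0 * (- (- \<gamma>)) * Wt + p * D * \<epsilon> + p * D * C * 0 powr (p - 1)) (at_right 0)"
    proof -
      have "((\<lambda>h::real. h) \<longlongrightarrow> 0) (at_right 0)" by (rule tendsto_ident_at)
      then have "((\<lambda>h::real. h powr (p - 1)) \<longlongrightarrow> 0 powr (p - 1)) (at_right 0)"
        using p by (intro tendsto_powr2 tendsto_const) (auto simp: eventually_at_filter)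
      moreover have "((\<lambda>h::real. (1 + h) powr (p - n)) \<longlongrightarrow> (1 + 0) powr (p - n)) (at_right 0)"
        by (intro tendsto_powr tendsto_add tendsto_const tendsto_ident_at) simp
      ultimately show ?thesis by (intro tendsto_add tendsto_diff tendsto_mult tendsto_const tendsto_minus powr_slope_at_right_0)
    qed
    have "p * (- n * J) \<le> (p - n) * K - (1 + 0) powr (p - n) * C\<^sub>0 * (- (- \<gamma>)) * Wt + p * D * \<epsilon> + p * D * C * 0 powr (p - 1)"
      by (rule tendsto_le[OF trivial_limit_at_right_real lim2 lim1], rule eventually_mono[OF eventually_at_right_less[of 0]], rule ineq)
    then show ?thesis by simp
  qed
  have *: "p * (- n * J) - ((p - n) * K - C\<^sub>0 * \<gamma> * Wt) \<le> p * D * \<epsilon>" if "\<epsilon> > 0" for \<epsilon>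
    using main[OF that] by linarith
  have "p * (- n * J) - ((p - n) * K - C\<^sub>0 * \<gamma> * Wt) \<le> 0"
  proof (rule field_le_epsilon)
    fix e :: real assume "e > 0"
    moreover have "p * D \<ge> 0" using p D by simp
    \<comment> \<open>The denominator p D + 1 avoids a division by zero when D = 0.\<close>
    ultimately have "p * D * (e / (p * D + 1)) \<le> e" "e / (p * D + 1) > 0"
      by (auto simp: field_simps add_nonneg_pos)
    then show "p * (- n * J) - ((p - n) * K - C\<^sub>0 * \<gamma> * Wt) \<le> 0 + e"
      using *[of "e / (p * D + 1)"] by simp
  qed
  then show ?thesis by (simp add: J_def n_def algebra_simps)
qed

end

section \<open>Nonexistence\<close>

theorem theorem1p7:
  fixes \<Omega> :: "(real^'n) set" and x\<^sub>0 :: "real^'n" and A :: "real^'n \<Rightarrow> real^'n^'n"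
    and p \<tau> \<gamma> C\<^sub>0 :: real and G :: "real^'d \<Rightarrow> real"
  assumes p: "1 < p" "p < real CARD('n)"
    and domain: "open \<Omega>" "connected \<Omega>" "bounded \<Omega>" "C1_boundary \<Omega>"
    and star: "x\<^sub>0 \<in> \<Omega>" "star_shaped_wrt x\<^sub>0 \<Omega>"
    and A_cont: "continuous_on (closure \<Omega>) A"
    and A_C1: "\<And>i j. C1_upto (\<Omega> - {x\<^sub>0}) (closure \<Omega> - {x\<^sub>0}) (\<lambda>x. A x $ i $ j)"
    and A_sym: "\<And>x. x \<in> closure \<Omega> \<Longrightarrow> transpose (A x) = A x"
    and A_ell: "\<tau> > 0" "\<And>x \<xi>. x \<in> closure \<Omega> \<Longrightarrow> \<tau> * (norm \<xi>)\<^sup>2 \<le> (A x *v \<xi>) \<bullet> \<xi>"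
    and B_ext: "\<And>i j. \<exists>l. (b_entry A x\<^sub>0 i j \<longlongrightarrow> l) (at x\<^sub>0)"
    and G: "Ck 1 G" "homogeneous (sobolev_exponent (real CARD('n)) p) G"
      "\<And>s. s \<noteq> 0 \<Longrightarrow> G s > 0"
    and const: "C\<^sub>0 > 0" "0 < \<gamma>" "\<gamma> \<le> p"
    and lower: "\<And>x \<xi>. x \<in> \<Omega> \<Longrightarrow>
      radial_derivative A p x\<^sub>0 x \<xi> \<ge> \<gamma> * C\<^sub>0 * norm (x - x\<^sub>0) powr \<gamma> * norm \<xi> powr p"
  shows "\<exists>L>0. \<forall>F :: real^'d \<Rightarrow> real.
    Ck 1 F \<and> homogeneous p F \<and> M_max p F < L \<longrightarrow>
    \<not> (\<exists>u :: real^'n \<Rightarrow> real^'d.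
          (\<forall>j. C1_upto \<Omega> (closure \<Omega>) (\<lambda>x. u x $ j)) \<and>
          weak_solution \<Omega> A p F G u \<and> (\<exists>x\<in>\<Omega>. u x \<noteq> 0))"
proof -
  note p_bounds = p and const_pos = const
  interpret dirichlet_form \<Omega> x\<^sub>0 A p \<gamma> C\<^sub>0
  proof
    have cl: "x \<in> closure \<Omega>" if "x \<in> \<Omega>" for x using that closure_subset by blast
    show "(\<lambda>x. A x $ i $ j) differentiable (at x)" if "x \<in> \<Omega> - {x\<^sub>0}" for x i j
      using A_C1[of i j] that by (simp add: C1_upto_def)
    show "transpose (A x) = A x" if "x \<in> \<Omega>" for x using A_sym cl that by blast
    show "0 < (A x *v \<xi>) \<bullet> \<xi>" if "x \<in> \<Omega>" "\<xi> \<noteq> 0" for x \<xi>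
    proof -
      have "0 < \<tau> * (norm \<xi>)\<^sup>2" using A_ell(1) that by simp
      then show ?thesis using A_ell(2)[OF cl[OF that(1)], of \<xi>] by linarith
    qed
  qed (use p domain star A_cont const lower in auto)
  note p = p_bounds and const = const_pos
  define n where "n = real CARD('n)"
  define ps where "ps = sobolev_exponent n p"
  have n: "n > p" "n > 0" using p by (auto simp: n_def)
  have ps: "ps > 0" "n / ps = (n - p) / p" using n p by (auto simp: ps_def sobolev_exponent_def)
  obtain R0 where R0: "\<And>x. x \<in> \<Omega> \<Longrightarrow> norm (x - x\<^sub>0) \<le> R0"
    using bounded_\<Omega> unfolding bounded_any_center[of _ x\<^sub>0] by (metis dist_commute dist_norm)
  define R where "R = max R0 1"
  have R: "R > 0" "\<And>x. x \<in> \<Omega> \<Longrightarrow> norm (x - x\<^sub>0) \<le> R"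
    using R0 by (auto simp: R_def le_max_iff_disj)
  \<comment> \<open>The weighted Poincare constant times the cost R^(p - \<gamma>) of lowering the
    exponent of the weight from p to \<gamma>. Taking R \<ge> 1 ensures that it is positive.\<close>
  define c where "c = 8 powr p / (1 - 2 powr (p - n)) * R powr (p - \<gamma>)"
  have "2 powr (p - n) < (2::real) powr 0" using n by (intro powr_less_mono) auto
  then have c2: "2 powr (p - n) < (1::real)" by simp
  have c: "c > 0" unfolding c_def using R(1) c2 by (intro mult_pos_pos divide_pos_pos) auto
  \<comment> \<open>The value of the bound on \<open>M_max\<close> at which the upper estimate p M_F
    c W of the integral of p F(u) would meet the Pohozaev lower estimate C_0 \<gamma> W. It is fixed
    before F and u.\<close>
  define L where "L = C\<^sub>0 * \<gamma> / (p * c)"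
  have L: "L > 0" using const p c by (simp add: L_def)
  show ?thesis
  proof (intro exI[of _ L] conjI allI impI L notI)
    fix F :: "real^'d \<Rightarrow> real"
    assume F: "Ck 1 F \<and> homogeneous p F \<and> M_max p F < L"
    assume "\<exists>u :: real^'n \<Rightarrow> real^'d.
          (\<forall>j. C1_upto \<Omega> (closure \<Omega>) (\<lambda>x. u x $ j)) \<and>
          weak_solution \<Omega> A p F G u \<and> (\<exists>x\<in>\<Omega>. u x \<noteq> 0)"
    then obtain u :: "real^'n \<Rightarrow> real^'d" and y where u: "\<And>j. C1_upto \<Omega> (closure \<Omega>) (\<lambda>x. u x $ j)"
      and ws: "weak_solution \<Omega> A p F G u" and y: "y \<in> \<Omega>" "u y \<noteq> 0" by blast
    have uW: "in_W0 \<Omega> p (\<lambda>x. u x $ j)" for j using ws by (simp add: weak_solution_def)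
    have "\<forall>j. \<exists>V \<phi>. has_weak_gradient \<Omega> (\<lambda>x. u x $ j) V \<and> W0_approx \<Omega> p (\<lambda>x. u x $ j) V \<phi>"
      using in_W0_E[OF uW] by metis
    then obtain V \<phi> where V: "\<And>j. has_weak_gradient \<Omega> (\<lambda>x. u x $ j) (V j)"
      and W: "\<And>j. W0_approx \<Omega> p (\<lambda>x. u x $ j) (V j) (\<phi> j)" by metis
    define \<Phi> where "\<Phi> s = F s / p + G s / ps" for s
    have g\<Phi>: "GDERIV \<Phi> s :> (1 / p) *\<^sub>R grad F s + (1 / ps) *\<^sub>R grad G s" for s
    proof -
      have "(F has_derivative (\<lambda>h. h \<bullet> grad F s)) (at s)" "(G has_derivative (\<lambda>h. h \<bullet> grad G s)) (at s)"
        using F G(1) Ck_1_gderiv unfolding gderiv_def by blast+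
      then show ?thesis
        unfolding gderiv_def \<Phi>_def[abs_def] using p ps by (auto intro!: derivative_eq_intros simp: inner_add_right)
    qed
    then have grad\<Phi>: "grad \<Phi> s = (1 / p) *\<^sub>R grad F s + (1 / ps) *\<^sub>R grad G s" for s by (rule grad_eq)
    have C\<Phi>: "Ck 1 \<Phi>"
    proof -
      have "continuous_on UNIV (\<lambda>s. ((1 / p) *\<^sub>R grad F s + (1 / ps) *\<^sub>R grad G s) \<bullet> b)" for b
        using F by (intro continuous_on_inner continuous_on_add continuous_on_scaleR continuous_on_const Ck_1_continuous_grad G(1)) auto
      then show ?thesis
        using g\<Phi> by (auto simp: grad\<Phi> gderiv_def differentiable_def simp del: inner_add_left inner_simps)
    qed
    have Gh: "homogeneous ps G" using G(2) by (simp add: ps_def n_def)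
    have \<Phi>0: "\<Phi> 0 = 0"
      using homogeneous_zero[of p F] homogeneous_zero[OF Gh ps(1)] F p by (simp add: \<Phi>_def)
    have ucl: "continuous_on (closure \<Omega>) u"
    proof -
      have "continuous_on (closure \<Omega>) (\<lambda>x. \<chi> j. u x $ j)"
        using u by (intro continuous_on_vec_lambda) (simp add: C1_upto_def)
      then show ?thesis by simp
    qed
    have "bounded (u ` closure \<Omega>)"
      using ucl bounded_\<Omega> by (intro compact_imp_bounded compact_continuous_image) auto
    then obtain M where M: "M > 0" "\<And>x. x \<in> closure \<Omega> \<Longrightarrow> norm (u x) \<le> M"
      by (auto simp: bounded_pos)
    interpret dirichlet_solution \<Omega> x\<^sub>0 A p \<gamma> C\<^sub>0 u V \<phi> \<Phi> M
    proof
      show "continuous_on \<Omega> u" using ucl closure_subset continuous_on_subset by blast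
      show "norm (u x) \<le> M" if "x \<in> \<Omega>" for x using M(2) that closure_subset by blast
      show "(LINT x|lebesgue_on \<Omega>. flux x (V j x) (V' x)) = (LINT x|lebesgue_on \<Omega>. grad \<Phi> (u x) $ j * w x)"
        if "in_W0 \<Omega> p w" "has_weak_gradient \<Omega> w V'" for j w V'
        using ws that V[of j] unfolding weak_solution_def by (simp add: grad\<Phi> ps_def n_def)
    qed (use W M C\<Phi> \<Phi>0 in auto)
    have Fc: "continuous_on UNIV F" and Gc: "continuous_on UNIV G"
      using F G(1) Ck_Suc_continuous[of 0 F] Ck_Suc_continuous[of 0 G] by simp_all
    define IF where "IF = (LINT x|lebesgue_on \<Omega>. F (u x))"
    define IG where "IG = (LINT x|lebesgue_on \<Omega>. G (u x))"
    have iF: "integrable (lebesgue_on \<Omega>) (\<lambda>x. F (u x))" and iG: "integrable (lebesgue_on \<Omega>) (\<lambda>x. G (u x))"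
      by (intro integrable_continuous_comp Fc Gc u_meas u_bound; assumption)+
    \<comment> \<open>The factors 1/p and 1/p^* in the system cancel the degrees produced by Euler's
      identity.\<close>
    have "grad \<Phi> (u x) \<bullet> u x = F (u x) + G (u x)" for x
      using Euler_homogeneous[OF G(1) Gh, of "u x"] Euler_homogeneous[of F p "u x"] F p ps
      by (simp add: grad\<Phi> inner_add_left)
    then have K: "K = IF + IG" using energy iF iG by (simp add: IF_def IG_def)
    have J: "(LINT x|lebesgue_on \<Omega>. \<Phi> (u x)) = IF / p + IG / ps"
      using iF iG by (simp add: \<Phi>_def IF_def IG_def)
    \<comment> \<open>Criticality of the exponent: n / p^* = (n - p) / p gives \<integral>G(u) the
      factor n - p, equal to its factor on the other side of the Pohozaev inequality.\<close>
    have "p * n * (IF / p + IG / ps) = n * IF + p * IG * (n / ps)" using p ps by (simp add: field_simps)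
    also have "\<dots> = n * IF + (n - p) * IG" using p by (simp add: ps(2))
    finally have "(n - p) * (IF + IG) + C\<^sub>0 * \<gamma> * Wt \<le> n * IF + (n - p) * IG"
      using Pohozaev_inequality by (simp add: K J n_def)
    then have poh: "C\<^sub>0 * \<gamma> * Wt \<le> p * IF" by (simp add: algebra_simps)
    define P where "P = (\<Sum>j\<in>UNIV. LINT x|lebesgue_on \<Omega>. \<bar>u x $ j\<bar> powr p)"
    have ui: "integrable (lebesgue_on \<Omega>) (\<lambda>x. \<bar>u x $ j\<bar> powr p)" for j
      using u_Lp[of j] by (simp add: in_Lp_def)
    have IFP: "IF \<le> M_max p F * P"
    proof -
      have "IF \<le> (LINT x|lebesgue_on \<Omega>. M_max p F * (\<Sum>j\<in>UNIV. \<bar>u x $ j\<bar> powr p))"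
        unfolding IF_def
      proof (rule integral_mono[OF iF])
        show "integrable (lebesgue_on \<Omega>) (\<lambda>x. M_max p F * (\<Sum>j\<in>UNIV. \<bar>u x $ j\<bar> powr p))"
          using ui by auto
        show "F (u x) \<le> M_max p F * (\<Sum>j\<in>UNIV. \<bar>u x $ j\<bar> powr p)" for x
          using F p by (intro homogeneous_le_M_max Fc) auto
      qed
      also have "\<dots> = M_max p F * P" using ui by (simp add: P_def)
      finally show ?thesis .
    qed
    have PW: "P \<le> c * Wt"
    proof -
      have "(LINT x|lebesgue_on \<Omega>. \<bar>u x $ j\<bar> powr p) \<le> c * (LINT x|lebesgue_on \<Omega>. norm (x - x\<^sub>0) powr \<gamma> * norm (V j x) powr p)" for j
      proof -
        have vL: "in_Lp UNIV p (zero_ext \<Omega> (V j))" using V_Lp in_Lp_ext[OF \<Omega>_sets] by blast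
        have vR: "norm (x - x\<^sub>0) \<le> R" if "zero_ext \<Omega> (V j) x \<noteq> 0" for x
          using that R by (cases "x \<in> \<Omega>") auto
        have ip: "integrable lebesgue (\<lambda>x. norm (zero_ext \<Omega> (V j) x) powr p * norm (x - x\<^sub>0) powr p)"
          "integrable lebesgue (\<lambda>x. norm (zero_ext \<Omega> (V j) x) powr p * norm (x - x\<^sub>0) powr \<gamma>)"
          using p const by (auto intro!: integrable_weighted_powr(1)[OF vL vR])
        have e1: "zero_ext \<Omega> (\<lambda>x. \<bar>u x $ j\<bar> powr p) = (\<lambda>x. \<bar>zero_ext \<Omega> (\<lambda>x. u x $ j) x\<bar> powr p)"
          and e2: "zero_ext \<Omega> (\<lambda>x. norm (x - x\<^sub>0) powr \<gamma> * norm (V j x) powr p) = (\<lambda>x. norm (zero_ext \<Omega> (V j) x) powr p * norm (x - x\<^sub>0) powr \<gamma>)"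
          by (auto simp: fun_eq_iff zero_ext_def indicator_def)
        have "(LINT x|lebesgue. norm (zero_ext \<Omega> (V j) x) powr p * norm (x - x\<^sub>0) powr p)
          \<le> (LINT x|lebesgue. R powr (p - \<gamma>) * (norm (zero_ext \<Omega> (V j) x) powr p * norm (x - x\<^sub>0) powr \<gamma>))"
        proof (rule integral_mono)
          fix x
          show "norm (zero_ext \<Omega> (V j) x) powr p * norm (x - x\<^sub>0) powr p \<le> R powr (p - \<gamma>) * (norm (zero_ext \<Omega> (V j) x) powr p * norm (x - x\<^sub>0) powr \<gamma>)"
          proof (cases "zero_ext \<Omega> (V j) x = 0")
            case False
            \<comment> \<open>Part of the weight is sacrificed: |x - x_0|^(p - \<gamma>) is at most
              R^(p - \<gamma>) because p - \<gamma> \<ge> 0, leaving the weight that the Pohozaev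
              inequality controls.\<close>
            have "norm (x - x\<^sub>0) powr p = norm (x - x\<^sub>0) powr (p - \<gamma>) * norm (x - x\<^sub>0) powr \<gamma>"
              by (simp flip: powr_add)
            also have "\<dots> \<le> R powr (p - \<gamma>) * norm (x - x\<^sub>0) powr \<gamma>"
              using vR[OF False] const by (intro mult_right_mono powr_mono2) auto
            finally have "norm (zero_ext \<Omega> (V j) x) powr p * norm (x - x\<^sub>0) powr p
               \<le> norm (zero_ext \<Omega> (V j) x) powr p * (R powr (p - \<gamma>) * norm (x - x\<^sub>0) powr \<gamma>)"
              by (rule mult_left_mono) simp
            then show ?thesis by (simp add: mult_ac)
          qed simp
        qed (use ip in auto)
        then have le: "(LINT x|lebesgue. norm (zero_ext \<Omega> (V j) x) powr p * norm (x - x\<^sub>0) powr p)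
          \<le> R powr (p - \<gamma>) * (LINT x|lebesgue. norm (zero_ext \<Omega> (V j) x) powr p * norm (x - x\<^sub>0) powr \<gamma>)" by simp
        have "(LINT x|lebesgue_on \<Omega>. \<bar>u x $ j\<bar> powr p) = (LINT x|lebesgue. \<bar>zero_ext \<Omega> (\<lambda>x. u x $ j) x\<bar> powr p)"
          by (simp add: integral_ext e1)
        also have "\<dots> \<le> 8 powr p / (1 - 2 powr (p - n)) * (LINT x|lebesgue. norm (zero_ext \<Omega> (V j) x) powr p * norm (x - x\<^sub>0) powr p)"
          using W0_approx_weighted_Poincare[OF W p(1) _ \<Omega>_sets R(2), of j] n by (simp add: n_def)
        also have "\<dots> \<le> 8 powr p / (1 - 2 powr (p - n)) * (R powr (p - \<gamma>) * (LINT x|lebesgue. norm (zero_ext \<Omega> (V j) x) powr p * norm (x - x\<^sub>0) powr \<gamma>))"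
          using c2 by (intro mult_left_mono le) auto
        also have "\<dots> = c * (LINT x|lebesgue_on \<Omega>. norm (x - x\<^sub>0) powr \<gamma> * norm (V j x) powr p)"
          by (simp add: integral_ext e2 c_def)
        finally show ?thesis .
      qed
      then show ?thesis unfolding P_def Wt_def sum_distrib_left by (rule sum_mono)
    qed
    have P: "P > 0"
    proof -
      obtain i where i: "u y $ i \<noteq> 0" using y(2) by (auto simp: vec_eq_iff)
      have "(LINT x|lebesgue_on \<Omega>. \<bar>u x $ i\<bar> powr p) \<noteq> 0"
      proof
        assume z: "(LINT x|lebesgue_on \<Omega>. \<bar>u x $ i\<bar> powr p) = 0"
        have "AE x in lebesgue_on \<Omega>. \<bar>u x $ i\<bar> powr p = 0"
          using integral_nonneg_eq_0_iff_AE[OF ui[of i]] z by simp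
        then have "AE x in lebesgue. x \<in> \<Omega> \<longrightarrow> u x $ i = 0"
          by (subst (asm) AE_restrict_space_iff) auto
        then have ae: "AE x in lebesgue. x \<notin> {x \<in> \<Omega>. u x $ i \<noteq> 0}" by simp
        \<comment> \<open>Continuity turns almost everywhere into everywhere: the set where the
          component is nonzero is open, and an open negligible set is empty.\<close>
        have "continuous_on \<Omega> (\<lambda>x. u x $ i)" by (intro continuous_on_component u_cont)
        then have "open (\<Omega> \<inter> (\<lambda>x. u x $ i) -` (- {0}))"
          by (rule continuous_open_preimage[OF _ open_\<Omega>]) auto
        moreover have "\<Omega> \<inter> (\<lambda>x. u x $ i) -` (- {0}) = {x \<in> \<Omega>. u x $ i \<noteq> 0}" by auto
        ultimately have op: "open {x \<in> \<Omega>. u x $ i \<noteq> 0}" by simp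
        then have "negligible {x \<in> \<Omega>. u x $ i \<noteq> 0}"
          using ae by (simp add: negligible_iff_null_sets AE_iff_null_sets)
        then have "{x \<in> \<Omega>. u x $ i \<noteq> 0} = {}"
          using op open_not_negligible by metis
        then show False using y(1) i by blast
      qed
      moreover have nn: "0 \<le> (LINT x|lebesgue_on \<Omega>. \<bar>u x $ j\<bar> powr p)" for j
        by (intro integral_nonneg_AE) auto
      ultimately have "0 < (LINT x|lebesgue_on \<Omega>. \<bar>u x $ i\<bar> powr p)" by (simp add: order_less_le)
      also have "\<dots> \<le> P" unfolding P_def using nn by (intro member_le_sum) auto
      finally show ?thesis .
    qed
    \<comment> \<open>The chain compares multiples of P, which is strictly positive, so the
      contradiction does not depend on the sign of \<open>M_max p F\<close>.\<close>
    have "L * P * p \<le> L * (c * Wt) * p" using PW L p by (intro mult_right_mono mult_left_mono) auto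
    also have "\<dots> = C\<^sub>0 * \<gamma> * Wt" using p c by (simp add: L_def)
    also have "\<dots> \<le> p * IF" by (rule poh)
    also have "\<dots> \<le> p * (M_max p F * P)" using IFP p by (intro mult_left_mono) auto
    finally have "(L - M_max p F) * (P * p) \<le> 0" by (simp add: algebra_simps)
    moreover have "(L - M_max p F) * (P * p) > 0" using F P p by (intro mult_pos_pos) auto
    ultimately show False by simp
  qed
qed

end
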